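(* Let $F$ be an infinite field of characteristic $2$, regarded as an extension of $\mathbf{F}_2$, and let $T \subseteq F$ be a transcendence basis for $F$ over $\mathbf{F}_2$. If the multiplicative group $F^\times$ is indecomposable, then $T$ is nonempty and the following conditions hold. (1) $F^\times$ is a torsion-free abelian group of infinite rank. (2) $F/\mathbf{F}_2(T)$ is an infinite algebraic extension (i.e. it is algebraic and $[F:\mathbf{F}_2(T)]$ is infinite). (3) If $T$ is finite, then $F$ cannot be generated as a field over $\mathbf{F}_2(T)$ by algebraic elements whose degrees over $\mathbf{F}_2(T)$ are bounded.
   Context: $\mathbf{F}_2$ is the field with two elements, and $\mathbf{F}_2(T)$ denotes the subfield of $F$ generated over $\mathbf{F}_2$ by $T$. An abelian group is indecomposable if it is not isomorphic to a direct sum of two nontrivial groups. A group is torsion-free if it contains no nontrivial elements of finite order. The rank of an abelian group is the size of a maximal subset that is linearly independent over $\mathbf{Z}$. *)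

theory Defs
  imports "HOL-Algebra.Algebra"
begin

section \<open>Abelian groups\<close>

text \<open>
  Letting the summands range only over groups with the same element type as \<^term>\<open>G\<close> is no
  restriction: both factors of a decomposition embed into \<^term>\<open>G\<close>.
\<close>

definition indecomposable_group :: "('a, 'b) monoid_scheme \<Rightarrow> bool"
  where "indecomposable_group G \<longleftrightarrow>
    \<not> (\<exists>(A :: 'a monoid) (B :: 'a monoid).
          comm_group A \<and> comm_group B \<and> \<not> trivial_group A \<and> \<not> trivial_group B \<and> G \<cong> A \<times>\<times> B)"

definition torsion_free_group :: "('a, 'b) monoid_scheme \<Rightarrow> bool"
  where "torsion_free_group G \<longleftrightarrow>
    (\<forall>x \<in> carrier G. \<forall>n::nat. n > 0 \<longrightarrow> x [^]\<^bsub>G\<^esub> n = \<one>\<^bsub>G\<^esub> \<longrightarrow> x = \<one>\<^bsub>G\<^esub>)"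

definition int_independent :: "('a, 'b) monoid_scheme \<Rightarrow> 'a set \<Rightarrow> bool"
  where "int_independent G B \<longleftrightarrow> B \<subseteq> carrier G \<and>
    (\<forall>A (c :: 'a \<Rightarrow> int). finite A \<longrightarrow> A \<subseteq> B \<longrightarrow>
        (\<Otimes>\<^bsub>G\<^esub>b\<in>A. b [^]\<^bsub>G\<^esub> c b) = \<one>\<^bsub>G\<^esub> \<longrightarrow> (\<forall>b\<in>A. c b = 0))"

definition maximal_int_independent :: "('a, 'b) monoid_scheme \<Rightarrow> 'a set \<Rightarrow> bool"
  where "maximal_int_independent G B \<longleftrightarrow> int_independent G B \<and>
    (\<forall>C. int_independent G C \<longrightarrow> B \<subseteq> C \<longrightarrow> C = B)"

text \<open>
  All maximal independent subsets of an abelian group have the same cardinality, the rank.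
  The definition below does not presuppose this: it asks every maximal independent
  subset to be infinite, and, so as not to hold vacuously, that there is one.
\<close>

definition infinite_rank :: "('a, 'b) monoid_scheme \<Rightarrow> bool"
  where "infinite_rank G \<longleftrightarrow>
    (\<exists>B. maximal_int_independent G B) \<and> (\<forall>B. maximal_int_independent G B \<longrightarrow> infinite B)"


section \<open>Fields and transcendence bases\<close>

text \<open>The library's \<^term>\<open>group.ord\<close> is \<^term>\<open>0::nat\<close> on elements of infinite order.\<close>

definition ring_char :: "('a, 'b) ring_scheme \<Rightarrow> nat"
  where "ring_char R = group.ord (add_monoid R) \<one>\<^bsub>R\<^esub>"

definition prime_subfield :: "('a, 'b) ring_scheme \<Rightarrow> 'a set"
  where "prime_subfield R = generate_field R {}"

definition field_adjoin :: "('a, 'b) ring_scheme \<Rightarrow> 'a set \<Rightarrow> 'a set \<Rightarrow> 'a set"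
  where "field_adjoin R K S = generate_field R (K \<union> S)"

text \<open>
  Multivariate polynomials are the library's indexed polynomials: finitely supported functions
  from monomials (multisets of indeterminates) to coefficients. Here the set of indeterminates is
  a set of elements of the ring, and the indeterminate indexed by an element is evaluated at
  that element.
\<close>

definition eval_at_indices :: "('a, 'b) ring_scheme \<Rightarrow> ('a multiset \<Rightarrow> 'a) \<Rightarrow> 'a"
  where "eval_at_indices R P =
    (\<Oplus>\<^bsub>R\<^esub>m \<in> {m. P m \<noteq> \<zero>\<^bsub>R\<^esub>}.
       P m \<otimes>\<^bsub>R\<^esub> (\<Otimes>\<^bsub>R\<^esub>t \<in> set_mset m. t [^]\<^bsub>R\<^esub> count m t))"

definition algebraically_independent :: "('a, 'b) ring_scheme \<Rightarrow> 'a set \<Rightarrow> 'a set \<Rightarrow> bool"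
  where "algebraically_independent R K T \<longleftrightarrow> T \<subseteq> carrier R \<and>
    (\<forall>P \<in> ring.indexed_pset R T K.
        eval_at_indices R P = \<zero>\<^bsub>R\<^esub> \<longrightarrow> P = ring.indexed_const R \<zero>\<^bsub>R\<^esub>)"

definition algebraic_extension :: "('a, 'b) ring_scheme \<Rightarrow> 'a set \<Rightarrow> bool"
  where "algebraic_extension R K \<longleftrightarrow> (\<forall>x \<in> carrier R. (ring.algebraic R over K) x)"

definition transcendence_basis :: "('a, 'b) ring_scheme \<Rightarrow> 'a set \<Rightarrow> 'a set \<Rightarrow> bool"
  where "transcendence_basis R K T \<longleftrightarrow>
    algebraically_independent R K T \<and> algebraic_extension R (field_adjoin R K T)"

text \<open>
  The field \<^term>\<open>R\<close> is generated over the subfield \<^term>\<open>K\<close> by elements that are algebraic over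
  \<^term>\<open>K\<close> with bounded degrees; the degree of an element is that of its minimal polynomial.
\<close>

definition generated_in_bounded_degree :: "('a, 'b) ring_scheme \<Rightarrow> 'a set \<Rightarrow> bool"
  where "generated_in_bounded_degree R K \<longleftrightarrow>
    (\<exists>S d. S \<subseteq> carrier R \<and>
       (\<forall>x \<in> S. (ring.algebraic R over K) x \<and> degree (ring.Irr R K x) \<le> d) \<and>
       field_adjoin R K S = carrier R)"

end

theory Submission imports Defs "HOL-Library.Countable_Set" begin

text \<open>
  A nonzero homomorphism from an abelian group to the integers splits off an infinite cyclic direct
  factor. Therefore an indecomposable group of infinite rank has no such homomorphism
  (\<open>no_additive_on_indecomposable_infinite_rank\<close>). The theorem follows by locating the torsion and
  the rank of the multiplicative group, and then constructing a homomorphism to the integers in the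
  two situations that have to be excluded.

  As to torsion, a field has at most \<open>n\<close> solutions of \<open>x ^ n = 1\<close>, which makes every primary
  component of the multiplicative group a direct factor (\<open>primary_component_is_factor\<close>). A
  nontrivial primary component would be the whole group, and the field would be a union of finite
  fields with \<open>2 ^ n\<close> elements of which \<open>p ^ l\<close> are nonzero. Since \<open>p ^ l + 1 = 2 ^ n\<close> is impossible
  for \<open>l \<ge> 2\<close>, this does not happen in an infinite field (\<open>torsion_free_unit_group\<close>). In particular
  the field is not algebraic over its prime field, and \<open>T\<close> is not empty.

  For the rank, the sequence \<open>P 0 = t\<close>, \<open>P (n + 1) = P n * (1 + P n)\<close> has the property that the
  elements \<open>1 + P n\<close> are pairwise coprime. For each of them there is a valuation at which it is
  positive, and the others are units there, so they are independent (\<open>infinite_rank_unit_group\<close>).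

  For the degree, fix \<open>t\<close> in \<open>T\<close> and let \<open>k\<close> be the field generated by the rest of \<open>T\<close>. On a finite
  extension of \<open>k(t)\<close> some extension of the \<open>t\<close>-adic valuation is, up to a factor, integer-valued,
  hence a nonzero homomorphism (\<open>exists_additive_valuation\<close>). So the whole field is not a finite
  extension.

  As to generators of bounded degree, if \<open>T\<close> is finite, then the field is countable. Replace \<open>k\<close> by
  its algebraic closure in the field. A homomorphism that is trivial on \<open>k\<close> is constructed along a
  chain of root-closed subgroups of finite rank over the nonzero elements of \<open>k\<close>
  (\<open>exists_additive_if_locally_separated\<close>). A step of the chain succeeds if the next subgroup is
  generated by one element over the previous one. Valuations of finite extensions \<open>L\<close> of \<open>k(t)\<close>
  provide this, as soon as the elements of the subgroup have a common power, with exponent \<open>N > 0\<close>,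
  in one such \<open>L\<close>. Here the bound \<open>d\<close> on the degrees enters: if some positive power of \<open>x\<close> lies in
  \<open>L\<close>, then so does \<open>x ^ N\<close>, where \<open>N = 2 ^ d * (2 ^ d! - 1)\<close> (\<open>root_exponent_bound\<close>). The first
  factor takes care of the inseparable part. For the second one, let \<open>z\<close> be the quotient of two
  conjugates of \<open>x ^ 2 ^ d\<close> over \<open>L\<close>, a root of unity of odd order. Because the field has no roots
  of unity except \<open>1\<close>, the element \<open>z ^ 2\<close> is a conjugate of \<open>z\<close>, by an automorphism whose \<open>d!\<close>-th
  power fixes all elements of degree at most \<open>d\<close> and their conjugates, and with them \<open>z\<close>. Hence
  \<open>z ^ 2 ^ d! = z\<close>.
\<close>

section \<open>Indecomposable groups and homomorphisms to the integers\<close>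

text \<open>
  Homomorphisms to the integers appear as functions that are additive on a set, because their
  domains vary among the subgroups of one fixed group.
\<close>

definition (in monoid) additive_on :: "'a set \<Rightarrow> ('a \<Rightarrow> int) \<Rightarrow> bool"
  where "additive_on A f \<longleftrightarrow> (\<forall>x\<in>A. \<forall>y\<in>A. f (x \<otimes> y) = f x + f y)"

text \<open>
  Multiplication identifies the direct product of the two subgroups with the whole group.
\<close>

lemma (in comm_group) indecomposable_imp_trivial_factor:
  assumes ind: "indecomposable_group G"
    and H: "subgroup H G" and K: "subgroup K G" and HK: "H \<inter> K = {\<one>}"
    and cover: "\<And>g. g \<in> carrier G \<Longrightarrow> \<exists>h\<in>H. \<exists>k\<in>K. g = h \<otimes> k"
  shows "H = {\<one>} \<or> K = {\<one>}"
proof -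
  define A :: "'a monoid" where "A = \<lparr>carrier = H, monoid.mult = (\<otimes>), one = \<one>\<rparr>"
  define B :: "'a monoid" where "B = \<lparr>carrier = K, monoid.mult = (\<otimes>), one = \<one>\<rparr>"
  have cg: "comm_group \<lparr>carrier = S, monoid.mult = (\<otimes>), one = \<one>\<rparr>" if "subgroup S G" for S
  proof (rule comm_groupI)
    fix x assume "x \<in> carrier \<lparr>carrier = S, monoid.mult = (\<otimes>), one = \<one>\<rparr>"
    then have "x \<in> S" by simp
    with that have "inv x \<in> S" "inv x \<otimes> x = \<one>"
      by (auto simp: subgroup.m_inv_closed subgroup.mem_carrier)
    then show "\<exists>y\<in>carrier \<lparr>carrier = S, monoid.mult = (\<otimes>), one = \<one>\<rparr>.
        y \<otimes>\<^bsub>\<lparr>carrier = S, monoid.mult = (\<otimes>), one = \<one>\<rparr>\<^esub> x = \<one>\<^bsub>\<lparr>carrier = S, monoid.mult = (\<otimes>), one = \<one>\<rparr>\<^esub>"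
      by auto
  qed (use that in \<open>auto simp: subgroup.m_closed subgroup.one_closed subgroup.mem_carrier m_ac\<close>)
  have Hc: "\<And>x. x \<in> H \<Longrightarrow> x \<in> carrier G" and Kc: "\<And>x. x \<in> K \<Longrightarrow> x \<in> carrier G"
    using subgroup.mem_carrier[OF H] subgroup.mem_carrier[OF K] by auto
  have uniq: "h = h' \<and> k = k'" if "h \<in> H" "h' \<in> H" "k \<in> K" "k' \<in> K" "h \<otimes> k = h' \<otimes> k'" for h h' k k'
  proof -
    have c: "h \<in> carrier G" "h' \<in> carrier G" "k \<in> carrier G" "k' \<in> carrier G" using that Hc Kc by auto
    have "inv h' \<otimes> (h \<otimes> k) \<otimes> inv k = inv h' \<otimes> (h' \<otimes> k') \<otimes> inv k" using that by simp
    moreover have "inv h' \<otimes> (h \<otimes> k) \<otimes> inv k = inv h' \<otimes> h" using c by (simp add: m_assoc)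
    moreover have "inv h' \<otimes> (h' \<otimes> k') \<otimes> inv k = k' \<otimes> inv k"
      using c by (simp add: m_assoc[symmetric])
    ultimately have eq: "inv h' \<otimes> h = k' \<otimes> inv k" by simp
    moreover have "inv h' \<otimes> h \<in> H" "k' \<otimes> inv k \<in> K"
      using that H K by (auto simp: subgroup.m_closed subgroup.m_inv_closed)
    ultimately have "inv h' \<otimes> h = \<one>" and e2: "k' \<otimes> inv k = \<one>" using HK by auto
    then have "h' \<otimes> (inv h' \<otimes> h) = h'" using c by simp
    moreover have "h' \<otimes> (inv h' \<otimes> h) = h" using c by (simp add: m_assoc[symmetric])
    moreover have "(k' \<otimes> inv k) \<otimes> k = k" using e2 c by simp
    moreover have "(k' \<otimes> inv k) \<otimes> k = k'" using c by (simp add: m_assoc)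
    ultimately show ?thesis by simp
  qed
  define \<phi> where "\<phi> = (\<lambda>(h, k). h \<otimes> k)"
  have "\<phi> \<in> iso (A \<times>\<times> B) G"
  proof (rule isoI)
    show "\<phi> \<in> hom (A \<times>\<times> B) G"
      by (rule homI) (auto simp: \<phi>_def A_def B_def DirProd_def Hc Kc m_ac)
    have "inj_on \<phi> (H \<times> K)"
      using uniq by (auto simp: inj_on_def \<phi>_def)
    moreover have "\<phi> ` (H \<times> K) = carrier G"
    proof
      show "\<phi> ` (H \<times> K) \<subseteq> carrier G" using Hc Kc by (auto simp: \<phi>_def)
      show "carrier G \<subseteq> \<phi> ` (H \<times> K)"
      proof
        fix g assume "g \<in> carrier G"
        from cover[OF this] obtain h k where "h \<in> H" "k \<in> K" "g = h \<otimes> k" by auto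
        then show "g \<in> \<phi> ` (H \<times> K)" unfolding \<phi>_def by (auto intro!: image_eqI[of _ _ "(h,k)"])
      qed
    qed
    ultimately show "bij_betw \<phi> (carrier (A \<times>\<times> B)) (carrier G)"
      by (simp add: bij_betw_def DirProd_def A_def B_def)
  qed
  then have "A \<times>\<times> B \<cong> G" by (auto simp: is_iso_def)
  moreover have "group (A \<times>\<times> B)"
    using cg[OF H] cg[OF K] by (intro DirProd_group) (auto simp: A_def B_def comm_group_def)
  ultimately have "G \<cong> A \<times>\<times> B" using group.iso_sym by blast
  moreover have "comm_group A" "comm_group B" using cg H K by (auto simp: A_def B_def)
  ultimately have "trivial_group A \<or> trivial_group B"
    using ind unfolding indecomposable_group_def by blast
  then show ?thesis by (auto simp: trivial_group_def A_def B_def)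
qed

lemma (in group) additive_on_subgroup_props:
  assumes A: "subgroup A G" and f: "additive_on A f"
  shows "f \<one> = 0" "x \<in> A \<Longrightarrow> f (inv x) = - f x" "x \<in> A \<Longrightarrow> f (x [^] (n::nat)) = int n * f x"
    "x \<in> A \<Longrightarrow> f (x [^] (m::int)) = m * f x"
proof -
  have add: "f (x \<otimes> y) = f x + f y" if "x \<in> A" "y \<in> A" for x y
    using f that by (auto simp: additive_on_def)
  note mem = subgroup.one_closed[OF A] subgroup.m_closed[OF A] subgroup.m_inv_closed[OF A] subgroup.mem_carrier[OF A]
  have one: "f \<one> = 0" using add[OF mem(1) mem(1)] by simp
  have inv: "f (inv x) = - f x" if "x \<in> A" for x
    using add[OF that mem(3)[OF that]] mem(4)[OF that] one by simp
  have pow: "x [^] n \<in> A \<and> f (x [^] (n::nat)) = int n * f x" if "x \<in> A" for x n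
    using that mem by (induction n) (auto simp: one add algebra_simps)
  show "f \<one> = 0" by (rule one)
  show "f (inv x) = - f x" if "x \<in> A" using inv that .
  show "f (x [^] (n::nat)) = int n * f x" if "x \<in> A" using pow[OF that] by blast
  show "f (x [^] (m::int)) = m * f x" if "x \<in> A"
    using pow[OF that] inv mem(4)[OF that] by (cases m rule: int_cases2) (simp_all add: int_pow_int int_pow_neg)
qed

text \<open>
  The values of \<open>f\<close> form a nonzero subgroup of the integers; the witness takes its least positive
  element as value.
\<close>

lemma (in group) exists_generating_value:
  assumes A: "subgroup A G" and f: "additive_on A f" and z: "z \<in> A" "f z \<noteq> 0"
  shows "\<exists>x0\<in>A. f x0 > 0 \<and> (\<forall>x\<in>A. f x0 dvd f x)"
proof -
  note fp = additive_on_subgroup_props[OF A f]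
  have add: "f (x \<otimes> y) = f x + f y" if "x \<in> A" "y \<in> A" for x y
    using f that by (auto simp: additive_on_def)
  define P where "P n \<longleftrightarrow> n > 0 \<and> (\<exists>x\<in>A. f x = int n)" for n :: nat
  have "\<exists>n. P n"
  proof (cases "f z > 0")
    case True then show ?thesis using z by (intro exI[of _ "nat (f z)"]) (auto simp: P_def)
  next
    case False
    then show ?thesis using z fp(2)[of z] subgroup.m_inv_closed[OF A z(1)]
      by (intro exI[of _ "nat (- f z)"]) (auto simp: P_def intro!: bexI[of _ "inv z"])
  qed
  then have Pd: "P (Least P)" by (rule LeastI_ex)
  define d where "d = Least P"
  have d0: "d > 0" using Pd by (simp add: d_def P_def)
  obtain x0 where x0: "x0 \<in> A" "f x0 = int d" using Pd by (auto simp: d_def P_def)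
  have "int d dvd f x" if x: "x \<in> A" for x
  proof (rule ccontr)
    assume nd: "\<not> int d dvd f x"
    let ?r = "f x mod int d"
    have r: "0 < ?r" "?r < int d"
      using nd d0 pos_mod_sign[of "int d" "f x"] by (auto simp: dvd_eq_mod_eq_0 order_le_less)
    have pA: "x0 [^] (- (f x div int d)) \<in> A" using subgroup_int_pow_closed[OF A x0(1)] .
    have "f (x \<otimes> x0 [^] (- (f x div int d))) = ?r"
      using add[OF x pA] fp(4)[OF x0(1)] x0(2) by (simp add: minus_div_mult_eq_mod[symmetric] del: int_pow_neg)
    then have "P (nat ?r)" using r subgroup.m_closed[OF A x pA] unfolding P_def
      by (intro conjI bexI[of _ "x \<otimes> x0 [^] (- (f x div int d))"]) auto
    then have "d \<le> nat ?r" unfolding d_def by (rule Least_le)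
    then show False using r by linarith
  qed
  then show ?thesis using x0 d0 by (intro bexI[of _ x0]) auto
qed

text \<open>
  The infinite cyclic group generated by an element whose value generates all values of \<open>f\<close> is a
  complement of the kernel, so the kernel has to be trivial.
\<close>

lemma (in comm_group) indecomposable_imp_additive_inj:
  assumes ind: "indecomposable_group G" and f: "additive_on (carrier G) f"
    and z: "z \<in> carrier G" "f z \<noteq> 0"
  shows "\<forall>x\<in>carrier G. f x = 0 \<longrightarrow> x = \<one>"
proof -
  note fp = additive_on_subgroup_props[OF subgroup_self f]
  have add: "f (x \<otimes> y) = f x + f y" if "x \<in> carrier G" "y \<in> carrier G" for x y
    using f that by (auto simp: additive_on_def)
  obtain x0 where x0: "x0 \<in> carrier G" "f x0 > 0" and dvd: "\<And>x. x \<in> carrier G \<Longrightarrow> f x0 dvd f x"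
    using exists_generating_value[OF subgroup_self f z] by blast
  define H where "H = generate G {x0}"
  define K where "K = {x\<in>carrier G. f x = 0}"
  have Hpow: "H = {x0 [^] m | m::int. m \<in> UNIV}" unfolding H_def by (rule generate_pow[OF x0(1)])
  have H: "subgroup H G" unfolding H_def using x0(1) by (intro generate_is_subgroup) simp
  have K: "subgroup K G"
    by (unfold_locales) (auto simp: K_def add fp)
  have "H \<inter> K = {\<one>}"
  proof -
    have "x = \<one>" if "x \<in> H" "x \<in> K" for x
    proof -
      from that(1) obtain m :: int where m: "x = x0 [^] m" unfolding Hpow by blast
      then have "m * f x0 = 0" using that(2) fp(4)[OF x0(1), of m] by (simp add: K_def)
      then show ?thesis using x0(2) m by simp
    qed
    then show ?thesis using subgroup.one_closed[OF H] subgroup.one_closed[OF K] by blast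
  qed
  moreover have "\<exists>h\<in>H. \<exists>k\<in>K. g = h \<otimes> k" if g: "g \<in> carrier G" for g
  proof -
    obtain m where m: "f g = f x0 * m" using dvd[OF g] by (auto elim: dvdE)
    have "g = x0 [^] m \<otimes> (inv (x0 [^] m) \<otimes> g)" using g x0(1) by (simp add: m_assoc[symmetric])
    moreover have "inv (x0 [^] m) \<otimes> g \<in> K" using g x0(1) m by (simp add: K_def add fp)
    ultimately show ?thesis unfolding Hpow by blast
  qed
  ultimately have "H = {\<one>} \<or> K = {\<one>}"
    using indecomposable_imp_trivial_factor[OF ind H K] by blast
  moreover have "x0 \<in> H" unfolding H_def by (intro generate.incl) simp
  then have "H \<noteq> {\<one>}" using x0(2) fp(1) by auto
  ultimately have "K = {\<one>}" by blast
  then show ?thesis by (auto simp: K_def)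
qed

text \<open>
  A homomorphism with a nonzero value would be injective, and then any two elements \<open>a\<close>, \<open>b\<close> would
  satisfy the relation \<open>a [^] f b = b [^] f a\<close>, which independent elements do not.
\<close>

lemma (in comm_group) no_additive_on_indecomposable_infinite_rank:
  assumes ind: "indecomposable_group G" and rank: "infinite_rank G"
    and f: "additive_on (carrier G) f" and z: "z \<in> carrier G"
  shows "f z = 0"
proof (rule ccontr)
  assume "f z \<noteq> 0"
  note inj = indecomposable_imp_additive_inj[OF ind f z this]
  note fp = additive_on_subgroup_props[OF subgroup_self f]
  obtain B where B: "int_independent G B" "infinite B"
    using rank unfolding infinite_rank_def maximal_int_independent_def by blast
  then obtain a where a: "a \<in> B" using infinite_imp_nonempty by blast
  have "infinite (B - {a})" using B by simp
  then obtain b where b: "b \<in> B" "b \<noteq> a" using infinite_imp_nonempty by blast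
  have c: "a \<in> carrier G" "b \<in> carrier G" using B a b by (auto simp: int_independent_def)
  have indep: "\<forall>b\<in>A. c b = 0"
    if "finite A" "A \<subseteq> B" "(\<Otimes>b\<in>A. b [^] c b) = \<one>" for A and c :: "'a \<Rightarrow> int"
    using B(1) that unfolding int_independent_def by blast
  define e where "e x = (if x = a then f b else - f a)" for x
  have "f (a [^] f b \<otimes> b [^] (- f a)) = 0"
    using f c by (simp add: additive_on_def fp del: int_pow_neg)
  then have rel: "a [^] f b \<otimes> b [^] (- f a) = \<one>" using inj c by blast
  have "(\<Otimes>x\<in>{a,b}. x [^] e x) = \<one>"
    using c b rel by (subst finprod_insert) (auto simp: e_def)
  then have "\<forall>x\<in>{a,b}. e x = 0" by (intro indep) (use a b in auto)
  then have "f a = 0" using b by (auto simp: e_def)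
  then have "a = \<one>" using inj c by blast
  have "(\<Otimes>x\<in>{a}. x [^] (1::int)) = \<one>" using \<open>a = \<one>\<close> by simp
  then have "\<forall>x\<in>{a}. (1::int) = 0" by (intro indep) (use a in auto)
  then show False by simp
qed

section \<open>Primary components\<close>

lemma (in comm_group) subgroup_mult_powers:
  assumes H: "subgroup H G" and y: "y \<in> carrier G"
  shows "subgroup {h \<otimes> y [^] (e::int) | h e. h \<in> H} G" (is "subgroup ?Q G")
    and "insert y H \<subseteq> {h \<otimes> y [^] (e::int) | h e. h \<in> H}"
proof -
  note Hc = subgroup.mem_carrier[OF H]
  show "subgroup ?Q G"
  proof (rule subgroupI)
    show "?Q \<subseteq> carrier G" using Hc y by auto
    show "?Q \<noteq> {}" using subgroup.one_closed[OF H] by auto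
    show "inv a \<in> ?Q" if "a \<in> ?Q" for a
    proof -
      from that obtain h e where a: "a = h \<otimes> y [^] (e::int)" "h \<in> H" by blast
      then have "inv a = inv h \<otimes> y [^] (- e)" using Hc y by (simp add: inv_mult int_pow_neg)
      then show ?thesis using subgroup.m_inv_closed[OF H a(2)] by blast
    qed
    show "a \<otimes> b \<in> ?Q" if ab: "a \<in> ?Q" "b \<in> ?Q" for a b
    proof -
      from ab obtain h e h' e' where a: "a = h \<otimes> y [^] (e::int)" "h \<in> H"
        "b = h' \<otimes> y [^] (e'::int)" "h' \<in> H" by blast
      then have "a \<otimes> b = (h \<otimes> h') \<otimes> y [^] (e + e')" using Hc y by (simp add: int_pow_mult m_ac)
      then show ?thesis using subgroup.m_closed[OF H a(2,4)] by blast
    qed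
  qed
  show "insert y H \<subseteq> ?Q"
  proof
    fix x assume "x \<in> insert y H"
    then show "x \<in> ?Q"
    proof
      assume "x = y"
      then have "x = \<one> \<otimes> y [^] (1::int)" using y by simp
      then show ?thesis using subgroup.one_closed[OF H] by blast
    next
      assume x: "x \<in> H"
      then have "x = x \<otimes> y [^] (0::int)" using Hc by simp
      then show ?thesis using x by blast
    qed
  qed
qed

text \<open>
  The \<open>n\<close> powers of \<open>x\<close> already exhaust the solutions of \<open>y [^] n = \<one>\<close>.
\<close>

lemma (in group) power_of_generator:
  assumes x: "x \<in> carrier G" "ord x = n" "n > 0"
    and few: "finite {y\<in>carrier G. y [^] n = \<one>}" "card {y\<in>carrier G. y [^] n = \<one>} \<le> n"
    and y: "y \<in> carrier G" "y [^] n = \<one>"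
  shows "\<exists>i::nat. y = x [^] i"
proof -
  let ?P = "(\<lambda>i::nat. x [^] i) ` {0..ord x - 1}"
  have sub: "?P \<subseteq> {y\<in>carrier G. y [^] n = \<one>}"
  proof clarify
    fix i :: nat
    have "(x [^] i) [^] n = (x [^] n) [^] i" using x by (simp add: nat_pow_pow mult.commute)
    also have "x [^] n = \<one>" using x pow_ord_eq_1[of x] by simp
    finally show "x [^] i \<in> carrier G \<and> (x [^] i) [^] n = \<one>" using x by simp
  qed
  have "card ?P = n" using ord_inj[OF x(1)] x by (simp add: card_image)
  then have "?P = {y\<in>carrier G. y [^] n = \<one>}"
    using sub few by (intro card_seteq) auto
  with y show ?thesis by blast
qed

lemma (in group) coprime_powers_mem_subgroup:
  fixes i j :: int
  assumes H: "subgroup H G" and x: "x \<in> carrier G" "x [^] i \<in> H" "x [^] j \<in> H" and "coprime i j"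
  shows "x \<in> H"
proof -
  obtain u v where uv: "u * i + v * j = 1" using \<open>coprime i j\<close> bezout_int[of i j] by auto
  have "(x [^] i) [^] u \<otimes> (x [^] j) [^] v \<in> H"
    by (rule subgroup.m_closed[OF H subgroup_int_pow_closed[OF H x(2)] subgroup_int_pow_closed[OF H x(3)]])
  also have "(x [^] i) [^] u \<otimes> (x [^] j) [^] v = x"
    using x uv by (simp add: int_pow_pow int_pow_mult[symmetric] mult.commute)
  finally show ?thesis .
qed

context comm_group
begin

context
  fixes p :: nat and C
  assumes p: "Factorial_Ring.prime p"
    and few: "\<And>n::nat. n > 0 \<Longrightarrow> finite {x\<in>carrier G. x [^] n = \<one>} \<and> card {x\<in>carrier G. x [^] n = \<one>} \<le> n"
    and C_def: "C = {x\<in>carrier G. \<exists>k. x [^] (p ^ k) = \<one>}"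
begin

lemma primary_component_subgroup: "subgroup C G"
proof
  have mono: "x [^] (p ^ l) = \<one>" if "x \<in> carrier G" "x [^] (p ^ k) = \<one>" "k \<le> l" for x k l
  proof -
    have "x [^] (p ^ l) = (x [^] (p ^ k)) [^] (p ^ (l - k))"
      using that(1,3) by (simp add: nat_pow_pow power_add[symmetric])
    then show ?thesis by (simp add: that(2))
  qed
  show "C \<subseteq> carrier G" by (auto simp: C_def)
  show "\<one> \<in> C" by (auto simp: C_def)
  show "x \<otimes> y \<in> C" if xy: "x \<in> C" "y \<in> C" for x y
  proof -
    from xy obtain k l where kl: "x [^] (p ^ k) = \<one>" "y [^] (p ^ l) = \<one>" and c: "x \<in> carrier G" "y \<in> carrier G"
      by (auto simp: C_def)
    have "(x \<otimes> y) [^] (p ^ (k + l)) = \<one>"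
      using mono[OF c(1) kl(1), of "k + l"] mono[OF c(2) kl(2), of "k + l"] c by (simp add: nat_pow_distrib)
    then show ?thesis using c by (auto simp: C_def)
  qed
  show "inv x \<in> C" if "x \<in> C" for x
    using that by (auto simp: C_def nat_pow_inv)
qed

text \<open>
  The hypothesis on the number of solutions leaves room for only one cyclic subgroup of each order.
  If the order of \<open>x\<close> exceeded \<open>p ^ j\<close>, the subgroup of order \<open>p ^ j\<close> would thus be generated by a
  \<open>p\<close>-th power, and \<open>c\<close>, which lies in it, would be one as well. Hence \<open>C\<close> is either divisible or of
  finite exponent.
\<close>

lemma primary_component_exponent:
  assumes c: "c \<in> C" "c [^] (p ^ j) = \<one>" "\<And>c'. c' \<in> C \<Longrightarrow> c \<noteq> c' [^] p" and x: "x \<in> C"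
  shows "x [^] (p ^ j) = \<one>"
proof (rule ccontr)
  note C = primary_component_subgroup
  have p1: "p > 1" using p prime_gt_1_nat by blast
  have Cc: "\<And>x. x \<in> C \<Longrightarrow> x \<in> carrier G" by (auto simp: C_def)
  have ordC: "\<exists>m. ord x = p ^ m" if "x \<in> C" for x
    using that p by (auto simp: C_def pow_eq_id divides_primepow_nat)
  assume nx: "x [^] (p ^ j) \<noteq> \<one>"
  obtain m where m: "ord x = p ^ m" using ordC[OF x] by blast
  have xc: "x \<in> carrier G" using x Cc by blast
  have "m > j"
  proof (rule ccontr)
    assume "\<not> m > j"
    then have "ord x dvd p ^ j" unfolding m by (simp add: le_imp_power_dvd)
    then show False using nx xc by (simp add: pow_eq_id)
  qed
  let ?y = "x [^] (p ^ (m - j))"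
  have "ord ?y = p ^ m div p ^ (m - j)"
    using xc m p1 by (subst ord_pow) (auto simp: le_imp_power_dvd)
  also have "p ^ m = p ^ j * p ^ (m - j)" using \<open>m > j\<close> by (simp flip: power_add)
  also have "\<dots> div p ^ (m - j) = p ^ j" using p1 by simp
  finally have oy: "ord ?y = p ^ j" .
  obtain i :: nat where i: "c = ?y [^] i"
    using power_of_generator[of ?y "p ^ j" c] xc oy few[of "p ^ j"] p1 c Cc by auto
  have "p ^ (m - j) * i = (p ^ (m - j - 1) * i) * p"
    using \<open>m > j\<close> by (cases "m - j") auto
  moreover have "c = x [^] (p ^ (m - j) * i)" using i xc by (simp add: nat_pow_pow)
  ultimately have "c = (x [^] (p ^ (m - j - 1) * i)) [^] p"
    using xc by (simp only: nat_pow_pow)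
  moreover have "x [^] (p ^ (m - j - 1) * i) \<in> C"
    using subgroup_int_pow_closed[OF C x, of "int (p ^ (m - j - 1) * i)"] by (simp only: int_pow_int)
  ultimately show False using c(3) by blast
qed

text \<open>
  Divisible subgroups and pure subgroups of finite exponent are direct factors of every abelian
  group that contains them; \<open>C\<close> is of one of these kinds. The complement is a subgroup \<open>H\<close> that is
  maximal among those that meet \<open>C\<close> trivially and contain \<open>H0\<close>. Here \<open>H0\<close> is trivial if \<open>C\<close> is
  divisible, and consists of the \<open>p ^ k\<close>-th powers if \<open>C\<close> has exponent \<open>p ^ k\<close>.

  If \<open>H\<close> and \<open>C\<close> did not generate the group, then some \<open>y\<close> outside \<open>M = H <#> C\<close> would have a power
  \<open>y [^] q = h \<otimes> c\<close> in it, for a prime \<open>q\<close>. As \<open>c\<close> is a \<open>q\<close>-th power in \<open>C\<close>, one can divide \<open>y\<close> by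
  its root and obtain \<open>z\<close> outside \<open>M\<close> with \<open>z [^] q\<close> in \<open>H\<close>. By the maximality of \<open>H\<close> some power
  \<open>z [^] j\<close> outside \<open>H\<close> lies in \<open>M\<close>; then \<open>q\<close> does not divide \<open>j\<close>, which puts \<open>z\<close> itself in \<open>M\<close>.
\<close>

lemma primary_component_is_factor:
  assumes C1: "C \<noteq> {\<one>}"
  shows "\<exists>H. subgroup H G \<and> H \<inter> C = {\<one>} \<and> (\<forall>g\<in>carrier G. \<exists>h\<in>H. \<exists>c\<in>C. g = h \<otimes> c)"
proof -
  note C = primary_component_subgroup
  have Cc: "\<And>x. x \<in> C \<Longrightarrow> x \<in> carrier G" by (auto simp: C_def)
  define dvb where "dvb \<longleftrightarrow> (\<forall>c\<in>C. \<exists>c'\<in>C. c = c' [^] p)"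
  define k where "k = (LEAST k. \<forall>x\<in>C. x [^] (p ^ k) = \<one>)"
  have k: "\<forall>x\<in>C. x [^] (p ^ k) = \<one>" if "\<not> dvb"
  proof -
    from that obtain c where c: "c \<in> C" "\<And>c'. c' \<in> C \<Longrightarrow> c \<noteq> c' [^] p" by (auto simp: dvb_def)
    then obtain j where "c [^] (p ^ j) = \<one>" by (auto simp: C_def)
    with primary_component_exponent c have "\<forall>x\<in>C. x [^] (p ^ j) = \<one>" by blast
    then show ?thesis unfolding k_def by (rule LeastI)
  qed
  define H0 where "H0 = (if dvb then {\<one>} else (\<lambda>x. x [^] (p ^ k)) ` carrier G)"
  have H0: "subgroup H0 G"
  proof
    show "H0 \<subseteq> carrier G" by (auto simp: H0_def)
    show "\<one> \<in> H0" by (auto simp: H0_def intro!: image_eqI[of _ _ \<one>])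
    show "x \<otimes> y \<in> H0" if "x \<in> H0" "y \<in> H0" for x y
      using that by (auto simp: H0_def nat_pow_distrib[symmetric] split: if_splits)
    show "inv x \<in> H0" if "x \<in> H0" for x
      using that by (auto simp: H0_def nat_pow_inv[symmetric] split: if_splits)
  qed
  have H0C: "H0 \<inter> C = {\<one>}"
  proof -
    have "x = \<one>" if x: "x \<in> H0" "x \<in> C" for x
    proof (cases dvb)
      case True then show ?thesis using x by (simp add: H0_def)
    next
      case False
      then obtain y where y: "y \<in> carrier G" "x = y [^] (p ^ k)" using x by (auto simp: H0_def)
      obtain l where "x [^] (p ^ l) = \<one>" using x by (auto simp: C_def)
      then have "y [^] (p ^ (k + l)) = \<one>" using y by (simp add: nat_pow_pow power_add)
      then have "y \<in> C" using y by (auto simp: C_def)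
      then show ?thesis using k[OF False] y by simp
    qed
    then show ?thesis using subgroup.one_closed[OF H0] subgroup.one_closed[OF C] by blast
  qed
  define Fam where "Fam = {H. subgroup H G \<and> H0 \<subseteq> H \<and> H \<inter> C = {\<one>}}"
  have "\<exists>M\<in>Fam. \<forall>N\<in>Fam. M \<subseteq> N \<longrightarrow> N = M"
  proof (rule subset_Zorn_nonempty)
    show "Fam \<noteq> {}" using H0 H0C by (auto simp: Fam_def)
    fix Ch assume ne: "Ch \<noteq> {}" and ch: "subset.chain Fam Ch"
    have sg: "subgroup H G" "H0 \<subseteq> H" "H \<inter> C = {\<one>}" if "H \<in> Ch" for H
      using ch that by (auto simp: subset.chain_def Fam_def)
    have "subgroup (\<Union>Ch) G"
    proof
      show "\<Union>Ch \<subseteq> carrier G" using subgroup.subset[OF sg(1)] by blast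
      show "\<one> \<in> \<Union>Ch" using ne subgroup.one_closed[OF sg(1)] by blast
      show "x \<otimes> y \<in> \<Union>Ch" if "x \<in> \<Union>Ch" "y \<in> \<Union>Ch" for x y
      proof -
        from that obtain A B where AB: "A \<in> Ch" "x \<in> A" "B \<in> Ch" "y \<in> B" by blast
        then have "A \<subseteq> B \<or> B \<subseteq> A" using ch by (auto simp: subset_chain_def)
        then have "x \<otimes> y \<in> A \<or> x \<otimes> y \<in> B"
          using AB subgroup.m_closed[OF sg(1)[OF AB(1)]] subgroup.m_closed[OF sg(1)[OF AB(3)]] by blast
        then show ?thesis using AB by blast
      qed
      show "inv x \<in> \<Union>Ch" if "x \<in> \<Union>Ch" for x
        using that subgroup.m_inv_closed[OF sg(1)] by blast
    qed
    moreover have "\<Union>Ch \<inter> C = {\<one>}"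
    proof -
      have "\<Union>Ch \<inter> C = (\<Union>H\<in>Ch. H \<inter> C)" by blast
      also have "\<dots> = (\<Union>H\<in>Ch. {\<one>})" using sg(3) by simp
      also have "\<dots> = {\<one>}" using ne by simp
      finally show ?thesis .
    qed
    ultimately show "\<Union>Ch \<in> Fam" using ne sg(2) by (auto simp: Fam_def)
  qed
  then obtain H where HS: "H \<in> Fam" and max: "\<And>N. N \<in> Fam \<Longrightarrow> H \<subseteq> N \<Longrightarrow> N = H" by blast
  then have H: "subgroup H G" "H0 \<subseteq> H" "H \<inter> C = {\<one>}" by (auto simp: Fam_def)
  have Hc: "\<And>x. x \<in> H \<Longrightarrow> x \<in> carrier G" using subgroup.mem_carrier[OF H(1)] by blast
  \<comment> \<open>By the maximality of \<open>H\<close>, adjoining \<open>y\<close> creates a nontrivial element of \<open>C\<close>.\<close>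
  have meet: "\<exists>h\<in>H. \<exists>i::int. \<exists>c\<in>C. c = h \<otimes> y [^] i \<and> y [^] i \<notin> H"
    if y: "y \<in> carrier G" "y \<notin> H" for y
  proof -
    define P where "P = {h \<otimes> y [^] (e::int) | h e. h \<in> H}"
    have P: "subgroup P G" "insert y H \<subseteq> P" unfolding P_def by (rule subgroup_mult_powers[OF H(1) y(1)])+
    then have "P \<notin> Fam" using max[of P] y by blast
    then have "P \<inter> C \<noteq> {\<one>}" using P H by (auto simp: Fam_def)
    then obtain c where c: "c \<in> P" "c \<in> C" "c \<noteq> \<one>"
      using subgroup.one_closed[OF P(1)] subgroup.one_closed[OF C] by blast
    then obtain h and i :: int where hi: "h \<in> H" "c = h \<otimes> y [^] i" by (auto simp: P_def)
    have "y [^] i \<notin> H"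
    proof
      assume "y [^] i \<in> H"
      then have "c \<in> H" using hi subgroup.m_closed[OF H(1)] by blast
      then show False using c H(3) by blast
    qed
    then show ?thesis using hi c by blast
  qed
  define M where "M = H <#> C"
  have M: "subgroup M G" unfolding M_def by (rule mult_subgroups[OF H(1) C])
  have HM: "H \<subseteq> M"
  proof
    fix h assume "h \<in> H"
    then have "h = h \<otimes> \<one>" using Hc by simp
    then show "h \<in> M" using \<open>h \<in> H\<close> subgroup.one_closed[OF C] by (auto simp: M_def set_mult_def)
  qed
  have pow_in_M: "y [^] i \<in> M" if "y \<in> carrier G" "h \<in> H" "c \<in> C" "c = h \<otimes> y [^] i" for y h c and i :: int
  proof -
    have "y [^] i = inv h \<otimes> c" using that Hc by (simp add: inv_solve_left)
    then show ?thesis using that subgroup.m_inv_closed[OF H(1)] by (auto simp: M_def set_mult_def)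
  qed
  have all: "x \<in> M" if x: "x \<in> carrier G" for x
  proof (rule ccontr)
    assume xM: "x \<notin> M"
    define Q where "Q n \<longleftrightarrow> n > 0 \<and> x [^] n \<in> M" for n :: nat
    have "x \<notin> H" using xM HM by blast
    from meet[OF x this] obtain h i c where hic: "h \<in> H" "c \<in> C" "c = h \<otimes> x [^] (i::int)" "x [^] i \<notin> H" by blast
    have iM: "x [^] i \<in> M" using pow_in_M[OF x] hic by blast
    have "i \<noteq> 0" using hic subgroup.one_closed[OF H(1)] by (metis int_pow_0)
    moreover have "x [^] \<bar>i\<bar> \<in> M"
      using iM subgroup.m_inv_closed[OF M iM] x by (cases "i < 0") (auto simp: int_pow_neg abs_if)
    then have "x [^] nat \<bar>i\<bar> \<in> M" by (simp add: pow_nat)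
    ultimately have "Q (nat \<bar>i\<bar>)" by (auto simp: Q_def)
    then have Qn: "Q (Least Q)" by (rule LeastI)
    define n where "n = Least Q"
    have n: "n > 0" "x [^] n \<in> M" using Qn by (auto simp: n_def Q_def)
    have "n \<noteq> 1" using n xM x by auto
    then obtain q where q: "Factorial_Ring.prime q" "q dvd n" using prime_factor_nat by blast
    then obtain n' where n': "n = q * n'" by blast
    have q1: "q > 1" using q prime_gt_1_nat by blast
    define y where "y = x [^] n'"
    have yc: "y \<in> carrier G" using x by (simp add: y_def)
    have "n' > 0" "n' < n" using n n' q1 by auto
    have "\<not> Q n'" using not_less_Least[of n' Q] \<open>n' < n\<close> unfolding n_def by blast
    then have yM: "y \<notin> M" using \<open>n' > 0\<close> by (auto simp: Q_def y_def)
    have yq: "y [^] q \<in> M" using n n' x by (simp add: y_def nat_pow_pow mult.commute)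
    then obtain h c where hc: "h \<in> H" "c \<in> C" "y [^] q = h \<otimes> c" by (auto simp: M_def set_mult_def)
    have hcc: "h \<in> carrier G" "c \<in> carrier G" using hc Hc Cc by auto
    \<comment> \<open>For \<open>q = p\<close> and \<open>C\<close> of exponent \<open>p ^ k\<close> the choice of \<open>H0\<close> is used: otherwise \<open>c\<close> would
        have order \<open>p ^ k\<close>, whereas \<open>c [^] p ^ (k - 1)\<close> lies both in \<open>H\<close> and in \<open>C\<close>.\<close>
    have cq: "\<exists>c'\<in>C. c = c' [^] q"
    proof (cases "q = p")
      case False
      obtain l where l: "c [^] (p ^ l) = \<one>" using hc by (auto simp: C_def)
      have "coprime q (p ^ l)" using False q p by (simp add: primes_coprime)
      then obtain u v where uv: "u * int q + v * int (p ^ l) = 1"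
        using bezout_int[of "int q" "int (p ^ l)"] by (auto simp: coprime_iff_gcd_eq_1[symmetric] simp flip: coprime_int_iff)
      have "c = c [^] (u * int q + v * int (p ^ l))" using uv hcc by simp
      also have "\<dots> = (c [^] u) [^] int q \<otimes> (c [^] int (p ^ l)) [^] v"
        using hcc by (simp only: int_pow_pow int_pow_mult[symmetric] mult.commute[of v])
      also have "\<dots> = (c [^] u) [^] q" using l hcc by (simp only: int_pow_int) simp
      finally show ?thesis using subgroup_int_pow_closed[OF C hc(2)] by blast
    next
      case True
      show ?thesis
      proof (rule ccontr)
        assume no: "\<not> ?thesis"
        then have nd: "\<not> dvb" using hc True by (auto simp: dvb_def)
        have "k \<noteq> 0"
        proof
          assume "k = 0"
          then have "\<forall>x\<in>C. x = \<one>" using k[OF nd] Cc by simp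
          then show False using C1 subgroup.one_closed[OF C] by blast
        qed
        have "y [^] (p ^ k) = (y [^] p) [^] (p ^ (k - 1))"
          using yc \<open>k \<noteq> 0\<close> by (simp add: nat_pow_pow power_eq_if)
        also have "\<dots> = h [^] (p ^ (k - 1)) \<otimes> c [^] (p ^ (k - 1))"
          using hc hcc True by (simp add: nat_pow_distrib)
        finally have eq: "c [^] (p ^ (k - 1)) = inv (h [^] (p ^ (k - 1))) \<otimes> y [^] (p ^ k)"
          using hcc yc by (simp add: m_assoc[symmetric])
        have "y [^] (p ^ k) \<in> H" using H(2) nd yc by (auto simp: H0_def)
        moreover have "h [^] (p ^ (k - 1)) \<in> H"
          using subgroup_int_pow_closed[OF H(1) hc(1), of "int (p ^ (k - 1))"] by (simp only: int_pow_int)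
        ultimately have "c [^] (p ^ (k - 1)) \<in> H"
          unfolding eq using subgroup.m_closed[OF H(1)] subgroup.m_inv_closed[OF H(1)] by blast
        moreover have "c [^] (p ^ (k - 1)) \<in> C"
          using subgroup_int_pow_closed[OF C hc(2), of "int (p ^ (k - 1))"] by (simp only: int_pow_int)
        ultimately have "c [^] (p ^ (k - 1)) = \<one>" using H(3) by blast
        then have "\<forall>x\<in>C. x [^] (p ^ (k - 1)) = \<one>" using primary_component_exponent[OF hc(2)] no True by blast
        then have "k \<le> k - 1" unfolding k_def by (rule Least_le)
        then show False using \<open>k \<noteq> 0\<close> by simp
      qed
    qed
    then obtain c' where c': "c' \<in> C" "c = c' [^] q" by blast
    have c'c: "c' \<in> carrier G" using c' Cc by blast
    define z where "z = y \<otimes> inv c'"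
    have zc: "z \<in> carrier G" using yc c'c by (simp add: z_def)
    have yz: "y = z \<otimes> c'" using yc c'c by (simp add: z_def m_assoc)
    have "c' = \<one> \<otimes> c'" using c'c by simp
    then have c'M: "c' \<in> M" using c' subgroup.one_closed[OF H(1)] unfolding M_def set_mult_def by blast
    have zM: "z \<notin> M" using yM yz c'M subgroup.m_closed[OF M] by blast
    have "h \<otimes> c = z [^] q \<otimes> c" using hc(3) yz c' zc c'c by (simp add: nat_pow_distrib)
    then have "z [^] q = h" using hcc zc by simp
    then have zq: "z [^] int q \<in> H" using hc by (simp add: int_pow_int)
    have "z \<notin> H" using zM HM by blast
    from meet[OF zc this] obtain h' j c'' where j: "h' \<in> H" "c'' \<in> C" "c'' = h' \<otimes> z [^] (j::int)" "z [^] j \<notin> H" by blast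
    have jM: "z [^] j \<in> M" using pow_in_M[OF zc] j by blast
    have "\<not> int q dvd j"
    proof
      assume "int q dvd j"
      then obtain m where "j = int q * m" by blast
      then have "z [^] j = (z [^] int q) [^] m" using zc by (simp add: int_pow_pow)
      then show False using j zq subgroup_int_pow_closed[OF H(1)] by metis
    qed
    then have "coprime (int q) j" using q by (simp add: prime_imp_coprime)
    then have "z \<in> M" using coprime_powers_mem_subgroup[OF M zc _ jM] zq HM by blast
    then show False using zM by blast
  qed
  show "\<exists>H. subgroup H G \<and> H \<inter> C = {\<one>} \<and> (\<forall>g\<in>carrier G. \<exists>h\<in>H. \<exists>c\<in>C. g = h \<otimes> c)"
    using H all by (intro exI[of _ H]) (auto simp: M_def set_mult_def)
qed

end
end

section \<open>Torsion in multiplicative groups\<close>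

text \<open>
  For even \<open>k\<close> the left-hand side is \<open>2\<close> modulo \<open>4\<close>. For odd \<open>k\<close> it is the product of \<open>p + 1\<close> and an
  alternating sum of \<open>k\<close> odd terms, which is an odd number greater than \<open>1\<close>.
\<close>

lemma prime_power_plus_one_not_power_of_2:
  fixes p k n :: nat
  assumes p: "odd p" "p > 1" and k: "k \<ge> 2" and eq: "p ^ k + 1 = 2 ^ n"
  shows False
proof (cases "even k")
  case True
  then obtain m where m: "k = 2 * m" by blast
  have "p ^ k mod 4 = 1"
  proof -
    have "odd (p ^ m)" using p by simp
    then obtain j where "p ^ m = 2 * j + 1" by (rule oddE)
    then have "p ^ k = (2 * j + 1) ^ 2" unfolding m by (simp add: power_mult[symmetric] mult.commute power_mult)
    also have "\<dots> = 4 * (j * j + j) + 1" by (simp add: power2_eq_square algebra_simps)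
    finally show ?thesis by simp
  qed
  then have "2 ^ n mod 4 = (2::nat)" unfolding eq[symmetric] by (simp add: mod_Suc)
  then have "n < 2"
  proof (rule_tac ccontr)
    assume "2 ^ n mod 4 = (2::nat)" "\<not> n < 2"
    then obtain i where "n = 2 + i" using le_Suc_ex[of 2 n] by auto
    then show False using \<open>2 ^ n mod 4 = 2\<close> by (simp add: power_add)
  qed
  moreover have "2 \<le> p ^ k"
    using p k by (metis One_nat_def Suc_leI numeral_2_eq_2 one_less_power zero_less_numeral less_le_trans pos2)
  then have "(2::nat) ^ n \<ge> 3" using eq by simp
  ultimately show False by (cases n) auto
next
  case False
  define q where "q = int p"
  have q: "q > 1" "odd q" using p by (auto simp: q_def)
  have *: "\<exists>c. q ^ (2 * j + 1) + 1 = (q + 1) * c \<and> odd c \<and> c \<ge> 1 \<and> (j > 0 \<longrightarrow> c > 1)" for j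
  proof (induction j)
    case 0 then show ?case by (intro exI[of _ 1]) auto
  next
    case (Suc j)
    then obtain c where c: "q ^ (2 * j + 1) + 1 = (q + 1) * c" "odd c" "c \<ge> 1" by blast
    have "q ^ (2 * Suc j + 1) + 1 = q * q * (q ^ (2 * j + 1) + 1) - q * q + 1" by (simp add: algebra_simps)
    also have "\<dots> = (q + 1) * (q * (q * c - 1) + 1)" unfolding c(1) by (simp add: algebra_simps)
    finally have "q ^ (2 * Suc j + 1) + 1 = (q + 1) * (q * (q * c - 1) + 1)" .
    moreover have "q * 1 \<le> q * c" using q c by (intro mult_left_mono) auto
    then have "q * c - 1 > 0" using q by linarith
    then have "q * (q * c - 1) > 0" using q by (intro mult_pos_pos) auto
    ultimately show ?case using q c by (intro exI[of _ "q * (q * c - 1) + 1"]) auto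
  qed
  obtain j where j: "k = 2 * j + 1" using False by (rule oddE)
  then have "j > 0" using k by simp
  with *[of j] obtain c where c: "q ^ k + 1 = (q + 1) * c" "odd c" "c > 1" unfolding j[symmetric] by blast
  have "2 ^ n = q ^ k + 1" using eq unfolding q_def by (metis of_nat_1 of_nat_add of_nat_numeral of_nat_power)
  then have "int (nat c) dvd int (2 ^ n)" using c by simp
  then have "nat c dvd 2 ^ n" by (simp only: of_nat_dvd_iff)
  then obtain i where "nat c = 2 ^ i" by (auto simp: divides_primepow_nat)
  moreover have "odd (nat c)" "nat c \<noteq> 1" using c by (auto simp: even_nat_iff)
  ultimately show False by (cases i) auto
qed

text \<open>
  A prime divisor of the order other than \<open>p\<close> would, by Sylow's theorem, be the order of a subgroup.
\<close>

lemma (in group) order_is_prime_power: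
  fixes p :: nat
  assumes p: "Factorial_Ring.prime p" and fin: "finite (carrier G)"
    and pow: "\<And>x. x \<in> carrier G \<Longrightarrow> \<exists>k. x [^] (p ^ k) = \<one>"
  shows "\<exists>k. order G = p ^ k"
proof (rule ccontr)
  assume no: "\<nexists>k. order G = p ^ k"
  have pos: "order G > 0" using fin by (simp add: order_gt_0_iff_finite)
  have "\<exists>q. Factorial_Ring.prime q \<and> q dvd order G \<and> q \<noteq> p"
  proof (rule ccontr)
    assume "\<not> ?thesis"
    then have "prime_factors (order G) \<subseteq> {p}" by (auto simp: in_prime_factors_iff)
    then have "(\<Prod>q\<in>prime_factors (order G). q ^ multiplicity q (order G)) = (\<Prod>q\<in>{p}. q ^ multiplicity q (order G))"
      by (intro prod.mono_neutral_left) (auto simp: in_prime_factors_iff p pos not_dvd_imp_multiplicity_0)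
    then have "order G = p ^ multiplicity p (order G)" using pos by (simp add: prime_factorization_nat[symmetric])
    then show False using no by blast
  qed
  then obtain q where q: "Factorial_Ring.prime q" "q dvd order G" "q \<noteq> p" by blast
  obtain m where m: "order G = q ^ 1 * m" using q by auto
  obtain H where H: "subgroup H G" "card H = q ^ 1" using sylow_thm[OF q(1) is_group m fin] by blast
  have "card H > 1" using H q prime_gt_1_nat by simp
  then have "H \<noteq> {\<one>}" by auto
  then obtain h where h: "h \<in> H" "h \<noteq> \<one>" using subgroup.one_closed[OF H(1)] by blast
  have hc: "h \<in> carrier G" using h H subgroup.mem_carrier by metis
  interpret H: group "G\<lparr>carrier := H\<rparr>" using H subgroup_imp_group by blast
  have "h [^]\<^bsub>G\<lparr>carrier := H\<rparr>\<^esub> order (G\<lparr>carrier := H\<rparr>) = \<one>\<^bsub>G\<lparr>carrier := H\<rparr>\<^esub>"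
    by (rule H.pow_order_eq_1) (simp add: h)
  then have "h [^] q = \<one>" using H(2) by (simp add: order_def nat_pow_consistent[symmetric])
  moreover obtain k where "h [^] (p ^ k) = \<one>" using pow hc by blast
  ultimately have "ord h dvd q" "ord h dvd p ^ k" using hc by (auto simp: pow_eq_id)
  moreover have "coprime q (p ^ k)" using q p by (simp add: primes_coprime)
  ultimately have "ord h = 1" using coprime_common_divisor_nat by blast
  then show False using h hc pow_ord_eq_1[OF hc] by simp
qed

abbreviation unit_group :: "('a, 'b) ring_scheme \<Rightarrow> 'a monoid"
  where "unit_group R \<equiv> Multiplicative_Group.mult_of R"

lemma (in field) comm_group_mult_of: "comm_group (unit_group R)"
  by (rule group.group_comm_groupI[OF field_mult_group]) (auto simp: m_comm)

lemma (in field) finite_card_roots: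
  assumes p: "p \<in> carrier (poly_ring R)" "p \<noteq> []"
  shows "finite {x\<in>carrier R. eval p x = \<zero>}" "card {x\<in>carrier R. eval p x = \<zero>} \<le> degree p"
proof -
  have eq: "{x\<in>carrier R. eval p x = \<zero>} = set_mset (roots p)"
    using roots_mem_iff_is_root[OF p(1)] p(2) by (auto simp: is_root_def)
  show "finite {x\<in>carrier R. eval p x = \<zero>}" unfolding eq by simp
  have "card (set_mset (roots p)) \<le> size (roots p)"
    unfolding size_multiset_overloaded_eq card_eq_sum by (rule sum_mono) (simp add: Suc_leI)
  then show "card {x\<in>carrier R. eval p x = \<zero>} \<le> degree p"
    unfolding eq using size_roots_le_degree[OF p(1)] by simp
qed

lemma (in ring) power_minus_const_poly:
  assumes K: "subring K R" and a: "a \<in> K" and n: "n > 0" and nz: "\<one> \<noteq> \<zero>"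
  defines "p \<equiv> \<one> # replicate (n - 1) \<zero> @ [\<ominus> a]"
  shows "p \<in> carrier (K[X])" "p \<noteq> []" "degree p = n" "x \<in> carrier R \<Longrightarrow> eval p x = x [^] n \<ominus> a"
proof -
  have ac: "a \<in> carrier R" using subringE(1)[OF K] a by auto
  show "p \<in> carrier (K[X])"
    using subringE[OF K] a nz by (auto simp: univ_poly_carrier[symmetric] polynomial_def p_def)
  show "p \<noteq> []" "degree p = n" using n by (auto simp: p_def)
  show "eval p x = x [^] n \<ominus> a" if "x \<in> carrier R"
    using that ac n eval_replicate[of "[\<ominus> a]" x "n - 1"] by (simp add: p_def a_minus_def)
qed

lemma (in domain) algebraic_if_power_mem:
  assumes K: "subring K R" and x: "x \<in> carrier R" and n: "n > 0" "x [^] (n::nat) \<in> K"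
  shows "(algebraic over K) x"
proof (rule algebraicI)
  show "eval (\<one> # replicate (n - 1) \<zero> @ [\<ominus> (x [^] n)]) x = \<zero>"
    using power_minus_const_poly(4)[OF K n(2,1) one_not_zero x] x by (simp add: r_neg a_minus_def)
qed (use power_minus_const_poly[OF K n(2,1) one_not_zero] in auto)

lemma (in field) finite_card_unity_roots:
  assumes n: "n > (0::nat)"
  shows "finite {x\<in>carrier R. x [^] n = \<one>}" "card {x\<in>carrier R. x [^] n = \<one>} \<le> n"
proof -
  note p = power_minus_const_poly[OF carrier_is_subring one_closed n one_not_zero]
  have eq: "{x\<in>carrier R. x [^] n = \<one>} = {x\<in>carrier R. eval (\<one> # replicate (n - 1) \<zero> @ [\<ominus> \<one>]) x = \<zero>}"
    using p(4) by auto
  note roots = finite_card_roots[OF p(1,2)]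
  show "finite {x\<in>carrier R. x [^] n = \<one>}" unfolding eq by (rule roots(1))
  show "card {x\<in>carrier R. x [^] n = \<one>} \<le> n" unfolding eq using roots(2) unfolding p(3) .
qed

lemma (in ring) finite_if_finite_dimension:
  assumes K: "subfield K R" "finite K" and E: "finite_dimension K E"
  shows "finite E"
proof -
  obtain n where "dimension n K E" using E by (auto simp: finite_dimension_def)
  then obtain Us where Us: "set Us \<subseteq> carrier R" "Span K Us = E" using exists_base[OF K(1)] by blast
  have "E = (\<lambda>Ks. combine Ks Us) ` {Ks. set Ks \<subseteq> K \<and> length Ks = length Us}"
    unfolding Us(2)[symmetric] Span_eq_combine_set_length_version[OF K(1) Us(1)] by auto
  then show ?thesis using finite_lists_length_eq[OF K(2)] by simp
qed

lemma (in domain) nat_pow_eq_zeroD: "x [^] (n::nat) = \<zero> \<Longrightarrow> x \<in> carrier R \<Longrightarrow> x = \<zero>"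
  by (induction n) (auto simp: integral_iff)

locale char2_field = field R for R (structure) +
  assumes one_plus_one: "\<one> \<oplus> \<one> = \<zero>"
begin

lemma add_self: "x \<in> carrier R \<Longrightarrow> x \<oplus> x = \<zero>"
  by (metis l_distr l_null l_one one_closed one_plus_one)

lemma minus_self: "x \<in> carrier R \<Longrightarrow> \<ominus> x = x"
  using add_self minus_equality by blast

lemma add_eq_zero_iff: "x \<in> carrier R \<Longrightarrow> y \<in> carrier R \<Longrightarrow> x \<oplus> y = \<zero> \<longleftrightarrow> x = y"
  by (metis add_self minus_equality minus_self)

lemma square_add:
  assumes "x \<in> carrier R" "y \<in> carrier R"
  shows "(x \<oplus> y) [^] (2::nat) = x [^] (2::nat) \<oplus> y [^] (2::nat)"
proof -
  have "(x \<oplus> y) [^] (2::nat) = x [^] (2::nat) \<oplus> (x \<otimes> y \<oplus> x \<otimes> y) \<oplus> y [^] (2::nat)"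
    using assms by (simp add: numeral_2_eq_2 l_distr r_distr a_ac m_ac)
  then show ?thesis using assms by (simp add: add_self)
qed

lemma frobenius_hom: "(\<lambda>x. x [^] (2 ^ n :: nat)) \<in> ring_hom R R"
proof (rule ring_hom_memI)
  show "(x \<oplus> y) [^] (2 ^ n :: nat) = x [^] (2 ^ n :: nat) \<oplus> y [^] (2 ^ n :: nat)"
    if "x \<in> carrier R" "y \<in> carrier R" for x y
  proof (induction n)
    case (Suc n)
    have *: "z [^] (2 ^ Suc n :: nat) = (z [^] (2 ^ n :: nat)) [^] (2::nat)" if "z \<in> carrier R" for z
      using that by (simp add: nat_pow_pow mult.commute)
    show ?case using that Suc
      by (simp only: *[OF that(1)] *[OF that(2)] *[OF a_closed[OF that]] Suc square_add nat_pow_closed)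
  qed (use that in auto)
qed (auto simp: nat_pow_distrib)

lemma prime_field: "subfield {\<zero>, \<one>} R"
proof (rule subfieldI')
  show "subring {\<zero>, \<one>} R"
    by (rule subringI) (auto simp: minus_self one_plus_one)
qed auto

lemma frobenius_inj:
  assumes "x \<in> carrier R" "y \<in> carrier R" "x [^] (2 ^ n :: nat) = y [^] (2 ^ n :: nat)"
  shows "x = y"
proof -
  have "(x \<oplus> y) [^] (2 ^ n :: nat) = \<zero>"
    using ring_hom_add[OF frobenius_hom assms(1,2)] assms by (simp add: add_self)
  then have "x \<oplus> y = \<zero>" using assms nat_pow_eq_zeroD[of "x \<oplus> y"] by simp
  then show ?thesis using add_eq_zero_iff assms by blast
qed

end

text \<open>
  If the \<open>p\<close>-primary component is nontrivial, it is a direct factor and therefore the whole group,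
  and \<open>p\<close> is odd because squaring is injective. A finite subfield that contains some \<open>y\<close> with
  \<open>y [^] p \<noteq> \<one>\<close> has \<open>2 ^ n\<close> elements, and \<open>p ^ l\<close> of them are nonzero for some \<open>l \<ge> 2\<close>; but
  \<open>p ^ l + 1 = 2 ^ n\<close> is impossible.
\<close>

lemma (in char2_field) torsion_free_unit_group:
  assumes inf: "infinite (carrier R)" and ind: "indecomposable_group (unit_group R)"
  shows "torsion_free_group (unit_group R)"
proof (rule ccontr)
  interpret M: comm_group "unit_group R" by (rule comm_group_mult_of)
  note [simp] = Multiplicative_Group.nat_pow_mult_of
  assume "\<not> torsion_free_group (unit_group R)"
  then obtain x n where x: "x \<in> carrier (unit_group R)" "n > (0::nat)" "x [^]\<^bsub>unit_group R\<^esub> n = \<one>\<^bsub>unit_group R\<^esub>"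
    "x \<noteq> \<one>\<^bsub>unit_group R\<^esub>" unfolding torsion_free_group_def by blast
  have "M.ord x dvd n" using x M.pow_eq_id by blast
  then have "M.ord x > 0" using x(2) by (intro Nat.gr0I) auto
  moreover have "M.ord x \<noteq> 1" using x M.pow_ord_eq_1[OF x(1)] by auto
  ultimately obtain p where p: "Factorial_Ring.prime p" "p dvd M.ord x" using prime_factor_nat by blast
  define C where "C = {x\<in>carrier (unit_group R). \<exists>k. x [^]\<^bsub>unit_group R\<^esub> (p ^ k) = \<one>\<^bsub>unit_group R\<^esub>}"
  have few: "finite {x\<in>carrier (unit_group R). x [^]\<^bsub>unit_group R\<^esub> n = \<one>\<^bsub>unit_group R\<^esub>} \<and>
      card {x\<in>carrier (unit_group R). x [^]\<^bsub>unit_group R\<^esub> n = \<one>\<^bsub>unit_group R\<^esub>} \<le> n" if "n > 0" for n :: nat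
  proof -
    have "{x\<in>carrier (unit_group R). x [^]\<^bsub>unit_group R\<^esub> n = \<one>\<^bsub>unit_group R\<^esub>} \<subseteq> {x\<in>carrier R. x [^] n = \<one>}" by auto
    then show ?thesis
      using finite_card_unity_roots[OF that] finite_subset card_mono[OF finite_card_unity_roots(1)[OF that]]
      by (meson le_trans)
  qed
  have C1: "C \<noteq> {\<one>\<^bsub>unit_group R\<^esub>}"
  proof -
    let ?s = "x [^]\<^bsub>unit_group R\<^esub> (M.ord x div p)"
    have "?s [^]\<^bsub>unit_group R\<^esub> (p ^ 1) = \<one>\<^bsub>unit_group R\<^esub>"
      using p x(1) M.pow_ord_eq_1[OF x(1)] by (simp only: M.nat_pow_pow power_one_right dvd_div_mult_self)
    moreover have "?s \<in> carrier (unit_group R)" using M.nat_pow_closed[OF x(1)] .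
    moreover have "?s \<noteq> \<one>\<^bsub>unit_group R\<^esub>"
    proof
      assume "?s = \<one>\<^bsub>unit_group R\<^esub>"
      then have "M.ord x dvd M.ord x div p" using M.pow_eq_id[OF x(1)] by blast
      moreover have "M.ord x div p < M.ord x" "0 < M.ord x div p"
        using p \<open>M.ord x > 0\<close> prime_gt_1_nat[OF p(1)] by (auto simp: dvd_imp_le div_greater_zero_iff prime_gt_0_nat)
      ultimately show False using nat_dvd_not_less by blast
    qed
    ultimately show ?thesis unfolding C_def by blast
  qed
  have p2: "odd p"
  proof
    assume "even p"
    then have "p = 2" using p primes_dvd_imp_eq two_is_prime_nat by blast
    then have "C \<subseteq> {\<one>}"
      using frobenius_inj[of _ \<one>] by (auto simp: C_def)
    moreover have "\<one> \<in> C" by (simp add: C_def)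
    ultimately have "C = {\<one>}" by blast
    then show False using C1 by simp
  qed
  obtain H where H: "subgroup H (unit_group R)" "H \<inter> C = {\<one>\<^bsub>unit_group R\<^esub>}"
     "\<forall>g\<in>carrier (unit_group R). \<exists>h\<in>H. \<exists>c\<in>C. g = h \<otimes>\<^bsub>unit_group R\<^esub> c"
    using M.primary_component_is_factor[OF p(1) few C_def C1] by blast
  note Csub = M.primary_component_subgroup[OF p(1) few C_def]
  have "H = {\<one>\<^bsub>unit_group R\<^esub>}" using M.indecomposable_imp_trivial_factor[OF ind H(1) Csub H(2)] H(3) C1 by blast
  then have all: "\<exists>k. y [^] (p ^ k) = \<one>" if "y \<in> carrier R - {\<zero>}" for y
  proof -
    from H(3) that \<open>H = _\<close> obtain c where "c \<in> C" "y = \<one> \<otimes> c" by auto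
    then show ?thesis by (auto simp: C_def)
  qed
  have p0: "p > 0" using p prime_gt_0_nat by blast
  have "infinite (carrier R - {\<zero>} - {x\<in>carrier R. x [^] p = \<one>})"
    using inf finite_card_unity_roots(1)[OF p0] by (simp add: Diff_infinite_finite)
  then obtain y where y: "y \<in> carrier R" "y \<noteq> \<zero>" "y [^] p \<noteq> \<one>" using infinite_imp_nonempty by blast
  obtain k where k: "y [^] (p ^ k) = \<one>" using all y by blast
  note P = prime_field
  have alg: "(algebraic over {\<zero>, \<one>}) y"
    using algebraic_if_power_mem[OF subfieldE(1)[OF P] y(1), of "p ^ k"] k p0 by simp
  define E where "E = simple_extension {\<zero>, \<one>} y"
  have E: "subfield E R" unfolding E_def using simple_extension_is_subfield[OF P y(1)] alg by simp
  have "finite_dimension {\<zero>, \<one>} E" unfolding E_def using finite_dimension_simple_extension[OF P y(1)] alg by simp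
  then have finE: "finite E" using finite_if_finite_dimension[OF P] by simp
  have yE: "y \<in> E" unfolding E_def by (rule simple_extension_mem[OF subfieldE(1)[OF P] y(1)])
  interpret E: field "R\<lparr>carrier := E\<rparr>" using subfield_iff(2)[OF E] .
  have Ec: "E \<subseteq> carrier R" using subfieldE(3)[OF E] .
  have "\<exists>n. order (add_monoid (R\<lparr>carrier := E\<rparr>)) = 2 ^ n"
  proof (rule group.order_is_prime_power[OF E.add.is_group two_is_prime_nat])
    fix x assume "x \<in> carrier (add_monoid (R\<lparr>carrier := E\<rparr>))"
    then have "x \<oplus> x = \<zero>" "x \<in> carrier R" using Ec add_self by auto
    then show "\<exists>k. x [^]\<^bsub>add_monoid (R\<lparr>carrier := E\<rparr>)\<^esub> ((2::nat) ^ k) = \<one>\<^bsub>add_monoid (R\<lparr>carrier := E\<rparr>)\<^esub>"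
      by (intro exI[of _ 1]) (simp add: numeral_2_eq_2)
  qed (use finE in auto)
  then obtain n where n: "card E = 2 ^ n" by (auto simp: order_def)
  interpret Em: group "unit_group (R\<lparr>carrier := E\<rparr>)" by (rule E.field_mult_group)
  have nat_pow_E: "x [^]\<^bsub>R\<lparr>carrier := E\<rparr>\<^esub> (m::nat) = x [^] m" for x m by (simp add: nat_pow_def)
  have "\<exists>l. order (unit_group (R\<lparr>carrier := E\<rparr>)) = p ^ l"
  proof (rule Em.order_is_prime_power[OF p(1)])
    fix x assume "x \<in> carrier (unit_group (R\<lparr>carrier := E\<rparr>))"
    then have "x \<in> carrier R - {\<zero>}" using Ec by auto
    then show "\<exists>k. x [^]\<^bsub>unit_group (R\<lparr>carrier := E\<rparr>)\<^esub> (p ^ k) = \<one>\<^bsub>unit_group (R\<lparr>carrier := E\<rparr>)\<^esub>"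
      using all by (simp add: nat_pow_E)
  qed (use finE in auto)
  then obtain l where "card (E - {\<zero>}) = p ^ l" by (auto simp: order_def)
  then have eq: "p ^ l + 1 = 2 ^ n" using n finE subringE(2)[OF subfieldE(1)[OF E]]
    by (metis Suc_eq_plus1 card_Suc_Diff1)
  have "y [^]\<^bsub>unit_group (R\<lparr>carrier := E\<rparr>)\<^esub> order (unit_group (R\<lparr>carrier := E\<rparr>)) = \<one>"
    using Em.pow_order_eq_1[of y] yE y by simp
  then have "y [^] (p ^ l) = \<one>" using \<open>card (E - {\<zero>}) = p ^ l\<close> by (simp add: nat_pow_E order_def)
  then have "l \<noteq> 0" using y(1,3) by (intro notI) simp
  moreover have "l \<noteq> 1" using y(3) \<open>y [^] (p ^ l) = \<one>\<close> by (intro notI) simp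
  ultimately have "l \<ge> 2" by simp
  then show False using prime_power_plus_one_not_power_of_2[OF p2 prime_gt_1_nat[OF p(1)] _ eq] by blast
qed

section \<open>Valuation rings\<close>

lemma (in field) nonzero_simps:
  "x \<in> carrier R \<Longrightarrow> x \<noteq> \<zero> \<Longrightarrow> inv x \<in> carrier R"
  "x \<in> carrier R \<Longrightarrow> x \<noteq> \<zero> \<Longrightarrow> inv x \<noteq> \<zero>"
  "x \<in> carrier R \<Longrightarrow> x \<noteq> \<zero> \<Longrightarrow> x \<otimes> inv x = \<one>"
  "x \<in> carrier R \<Longrightarrow> x \<noteq> \<zero> \<Longrightarrow> inv x \<otimes> x = \<one>"
  "x \<in> carrier R \<Longrightarrow> x \<noteq> \<zero> \<Longrightarrow> inv (inv x) = x"
  using field_Units by (auto simp: Units_inv_Units)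

lemma (in field) inv_mult:
  assumes "x \<in> carrier R" "x \<noteq> \<zero>" "y \<in> carrier R" "y \<noteq> \<zero>"
  shows "inv (x \<otimes> y) = inv x \<otimes> inv y"
proof (rule comm_inv_char)
  have "x \<otimes> y \<otimes> (inv x \<otimes> inv y) = (x \<otimes> inv x) \<otimes> (y \<otimes> inv y)"
    using assms nonzero_simps(1) by (simp add: m_ac)
  then show "x \<otimes> y \<otimes> (inv x \<otimes> inv y) = \<one>" using assms nonzero_simps(3) by simp
qed (use assms nonzero_simps(1) in auto)

text \<open>
  The values at \<open>y\<close> of the polynomials with at most \<open>n\<close> coefficients, all from \<open>V\<close>. The bound on the
  number of coefficients is what the minimality argument for valuation rings decreases.
\<close>

primrec (in ring) poly_values :: "'a set \<Rightarrow> 'a \<Rightarrow> nat \<Rightarrow> 'a set" where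
  "poly_values V y 0 = {\<zero>}"
| "poly_values V y (Suc n) = {a \<oplus> y \<otimes> b | a b. a \<in> V \<and> b \<in> poly_values V y n}"

lemma (in ring) poly_values_SucI:
  "a \<in> V \<Longrightarrow> b \<in> poly_values V y n \<Longrightarrow> a \<oplus> y \<otimes> b \<in> poly_values V y (Suc n)"
  by auto

lemma (in ring) poly_values_SucE:
  assumes "b \<in> poly_values V y (Suc n)"
  obtains a c where "b = a \<oplus> y \<otimes> c" "a \<in> V" "c \<in> poly_values V y n"
  using assms by auto

context domain
begin

context
  fixes V y assumes V: "subring V R" and y: "y \<in> carrier R"
begin

lemma poly_values_carrier: "b \<in> poly_values V y n \<Longrightarrow> b \<in> carrier R"
  using subringE(1)[OF V] y by (induction n arbitrary: b) auto

lemma poly_values_add: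
  "b \<in> poly_values V y n \<Longrightarrow> c \<in> poly_values V y n \<Longrightarrow> b \<oplus> c \<in> poly_values V y n"
proof (induction n arbitrary: b c)
  case (Suc n)
  then obtain a b' a' c' where *: "b = a \<oplus> y \<otimes> b'" "c = a' \<oplus> y \<otimes> c'" "a \<in> V" "a' \<in> V"
    "b' \<in> poly_values V y n" "c' \<in> poly_values V y n" by auto
  then have "b \<oplus> c = (a \<oplus> a') \<oplus> y \<otimes> (b' \<oplus> c')"
    using subringE(1)[OF V] y poly_values_carrier by (simp add: subset_iff r_distr a_ac)
  then show ?case
    using poly_values_SucI[OF subringE(7)[OF V *(3,4)] Suc.IH[OF *(5,6)]] by (simp del: poly_values.simps)
qed auto

lemma poly_values_smult: "v \<in> V \<Longrightarrow> b \<in> poly_values V y n \<Longrightarrow> v \<otimes> b \<in> poly_values V y n"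
proof (induction n arbitrary: b)
  case (Suc n)
  then obtain a b' where *: "b = a \<oplus> y \<otimes> b'" "a \<in> V" "b' \<in> poly_values V y n" by auto
  then have "v \<otimes> b = (v \<otimes> a) \<oplus> y \<otimes> (v \<otimes> b')"
    using subringE(1)[OF V] y poly_values_carrier Suc.prems by (simp add: subset_iff r_distr m_ac)
  then show ?case
    using poly_values_SucI[OF subringE(6)[OF V Suc.prems(1) *(2)] Suc.IH[OF Suc.prems(1) *(3)]]
    by (simp del: poly_values.simps)
qed (use subringE(1)[OF V] in auto)

lemma poly_values_Suc_mono: "b \<in> poly_values V y n \<Longrightarrow> b \<in> poly_values V y (Suc n)"
proof (induction n arbitrary: b)
  case 0
  then have "b = \<zero> \<oplus> y \<otimes> \<zero>" using y by simp
  then show ?case using subringE(2)[OF V] by auto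
qed auto

lemma poly_values_mult_var:
  assumes "b \<in> poly_values V y n" shows "y \<otimes> b \<in> poly_values V y (Suc n)"
proof -
  have "y \<otimes> b = \<zero> \<oplus> y \<otimes> b" using y assms poly_values_carrier by simp
  then show ?thesis using assms subringE(2)[OF V] by auto
qed

lemma poly_values_mult_var_pow:
  "b \<in> poly_values V y n \<Longrightarrow> b \<otimes> y [^] k \<in> poly_values V y (n + k)"
proof (induction k)
  case 0 then show ?case using poly_values_carrier by simp
next
  case (Suc k)
  have "b \<otimes> y [^] Suc k = y \<otimes> (b \<otimes> y [^] k)" using Suc.prems poly_values_carrier y by (simp add: m_ac)
  then show ?case using poly_values_mult_var[OF Suc.IH[OF Suc.prems]] by (simp del: poly_values.simps)
qed

lemma poly_values_const: "v \<in> V \<Longrightarrow> v \<in> poly_values V y 1"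
  using subringE(1)[OF V] y by (auto intro!: exI[of _ v])

lemma poly_values_monom: "v \<in> V \<Longrightarrow> v \<otimes> y [^] n \<in> poly_values V y (Suc n)"
  using poly_values_mult_var_pow[OF poly_values_const, of v n] by simp

lemma poly_values_leading:
  "b \<in> poly_values V y (Suc n) \<Longrightarrow> \<exists>b'\<in>poly_values V y n. \<exists>v\<in>V. b = b' \<oplus> v \<otimes> y [^] n"
proof (induction n arbitrary: b)
  case 0
  then obtain a where "a \<in> V" "b = a \<oplus> y \<otimes> \<zero>" by auto
  then show ?case using subringE(1)[OF V] y by (auto intro!: bexI[of _ a])
next
  case (Suc n)
  from poly_values_SucE[OF Suc.prems]
  obtain a c where ac: "b = a \<oplus> y \<otimes> c" "a \<in> V" "c \<in> poly_values V y (Suc n)" .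
  from Suc.IH[OF ac(3)] obtain c' v where c': "c' \<in> poly_values V y n" "v \<in> V" "c = c' \<oplus> v \<otimes> y [^] n" by blast
  have "a \<in> carrier R" "v \<in> carrier R" "c' \<in> carrier R"
    using ac c' subringE(1)[OF V] poly_values_carrier by auto
  then have "b = (a \<oplus> y \<otimes> c') \<oplus> v \<otimes> y [^] Suc n"
    using ac(1) c'(3) y by (simp add: r_distr a_ac m_ac)
  moreover have "a \<oplus> y \<otimes> c' \<in> poly_values V y (Suc n)" using ac c' by auto
  ultimately show ?case using c'(2) by blast
qed

lemma simple_extension_poly_values:
  "b \<in> simple_extension V y \<Longrightarrow> \<exists>n. b \<in> poly_values V y n"
proof (induction rule: simple_extension.induct)
  case zero then show ?case by (intro exI[of _ 0]) simp
next
  case (lin k1 k2)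
  then obtain n where n: "k1 \<in> poly_values V y n" by blast
  have "(k1 \<otimes> y) \<oplus> k2 = k2 \<oplus> y \<otimes> k1"
    using lin subringE(1)[OF V] y poly_values_carrier[OF n] by (simp add: subset_iff a_comm m_comm)
  then show ?case using lin n by (intro exI[of _ "Suc n"]) auto
qed

end
end

lemma (in field) poly_values_inverse:
  assumes V: "subring V R" and y: "y \<in> carrier R" "y \<noteq> \<zero>"
  shows "b \<in> poly_values V (inv y) (Suc m) \<Longrightarrow> b \<otimes> y [^] m \<in> poly_values V y (Suc m)"
proof (induction m arbitrary: b)
  case 0
  then obtain a where "a \<in> V" "b = a \<oplus> inv y \<otimes> \<zero>" by auto
  then have "b \<in> V" using subringE(1)[OF V] y nonzero_simps by auto
  then show ?case using poly_values_monom[OF V y(1), of b 0] by simp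
next
  case (Suc m)
  from poly_values_SucE[OF Suc.prems]
  obtain a c where ac: "b = a \<oplus> inv y \<otimes> c" "a \<in> V" "c \<in> poly_values V (inv y) (Suc m)" .
  have c: "a \<in> carrier R" "c \<in> carrier R" "inv y \<in> carrier R"
    using ac(2) subringE(1)[OF V] poly_values_carrier[OF V nonzero_simps(1)[OF y] ac(3)] nonzero_simps(1)[OF y]
    by blast+
  have "b \<otimes> y [^] Suc m = a \<otimes> y [^] Suc m \<oplus> (inv y \<otimes> y) \<otimes> (c \<otimes> y [^] m)"
    unfolding ac(1) using c y by (simp add: l_distr r_distr m_ac)
  also have "\<dots> = a \<otimes> y [^] Suc m \<oplus> c \<otimes> y [^] m" using c y nonzero_simps by simp
  finally show ?case
    using poly_values_add[OF V y(1) poly_values_monom[OF V y(1) ac(2)] poly_values_Suc_mono[OF V y(1) Suc.IH[OF ac(3)]]]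
    by (simp del: poly_values.simps)
qed

text \<open>
  A valuation ring of the field whose maximal ideal contains \<open>f\<close>. The value of a nonzero element is
  its class modulo the units of \<open>V\<close>; no ordered value group is introduced.
\<close>

definition (in ring) valuation_ring_at :: "'a \<Rightarrow> 'a set \<Rightarrow> bool"
  where "valuation_ring_at f V \<longleftrightarrow> subring V R \<and> f \<in> V \<and> f \<noteq> \<zero> \<and> inv f \<notin> V \<and>
    (\<forall>y\<in>carrier R - {\<zero>}. y \<in> V \<or> inv y \<in> V)"

definition (in ring) val_units :: "'a set \<Rightarrow> 'a set"
  where "val_units V = {u\<in>V. u \<noteq> \<zero> \<and> inv u \<in> V}"

text \<open>
  Chevalley's extension theorem. A ring \<open>V\<close> that is maximal among the rings that contain \<open>A\<close> but not
  \<open>inv f\<close> is a valuation ring: for \<open>y\<close> outside \<open>V\<close> the ring generated by \<open>V\<close> and \<open>y\<close> contains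
  \<open>inv f\<close>, so \<open>inv f\<close> is the value at \<open>y\<close> of a polynomial over \<open>V\<close>. If neither \<open>y\<close> nor \<open>inv y\<close>
  belonged to \<open>V\<close>, two polynomials of least degree with this property, one in \<open>y\<close> and one in
  \<open>inv y\<close>, could be played off against each other: the one of smaller degree lowers the degree of
  the other.
\<close>

lemma (in field) exists_valuation_ring:
  assumes A: "subring A R" and f: "f \<in> A" "f \<noteq> \<zero>" "inv f \<notin> A"
  shows "\<exists>V. valuation_ring_at f V \<and> A \<subseteq> V"
proof -
  define Fam where "Fam = {V. subring V R \<and> A \<subseteq> V \<and> inv f \<notin> V}"
  have "\<exists>V\<in>Fam. \<forall>W\<in>Fam. V \<subseteq> W \<longrightarrow> W = V"
  proof (rule subset_Zorn_nonempty)
    show "Fam \<noteq> {}" using A f by (auto simp: Fam_def)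
    fix Ch assume ne: "Ch \<noteq> {}" and ch: "subset.chain Fam Ch"
    have sr: "subring V R" "A \<subseteq> V" "inv f \<notin> V" if "V \<in> Ch" for V
      using ch that by (auto simp: subset.chain_def Fam_def)
    have two: "\<exists>V\<in>Ch. x \<in> V \<and> y \<in> V" if "x \<in> \<Union>Ch" "y \<in> \<Union>Ch" for x y
    proof -
      from that obtain V W where VW: "V \<in> Ch" "x \<in> V" "W \<in> Ch" "y \<in> W" by blast
      then have "V \<subseteq> W \<or> W \<subseteq> V" using ch by (auto simp: subset_chain_def)
      then show ?thesis using VW by blast
    qed
    have "subring (\<Union>Ch) R"
    proof (rule subringI)
      show "\<Union>Ch \<subseteq> carrier R" using subringE(1)[OF sr(1)] by blast
      show "\<one> \<in> \<Union>Ch" using ne subringE(3)[OF sr(1)] by blast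
      show "\<ominus> h \<in> \<Union>Ch" if "h \<in> \<Union>Ch" for h using that subringE(5)[OF sr(1)] by blast
      show "h1 \<otimes> h2 \<in> \<Union>Ch" if "h1 \<in> \<Union>Ch" "h2 \<in> \<Union>Ch" for h1 h2
        using two[OF that] subringE(6)[OF sr(1)] by blast
      show "h1 \<oplus> h2 \<in> \<Union>Ch" if "h1 \<in> \<Union>Ch" "h2 \<in> \<Union>Ch" for h1 h2
        using two[OF that] subringE(7)[OF sr(1)] by blast
    qed
    then show "\<Union>Ch \<in> Fam" using ne sr(2,3) by (auto simp: Fam_def)
  qed
  then obtain V where VF: "V \<in> Fam" and max: "\<And>W. W \<in> Fam \<Longrightarrow> V \<subseteq> W \<Longrightarrow> W = V" by blast
  then have V: "subring V R" and AV: "A \<subseteq> V" and nf: "inv f \<notin> V" by (auto simp: Fam_def)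
  note Vs = subringE[OF V]
  have fV: "f \<in> V" using f AV by blast
  have fc: "f \<in> carrier R" using fV Vs by blast
  have grow: "\<exists>n. inv f \<in> poly_values V y n" if y: "y \<in> carrier R" "y \<notin> V" for y
  proof -
    have sub: "subring (simple_extension V y) R" using simple_extension_is_subring[OF V y(1)] .
    have VE: "V \<subseteq> simple_extension V y" using simple_extension_incl[OF Vs(1) y(1)] .
    moreover have "y \<in> simple_extension V y" using simple_extension_mem[OF V y(1)] .
    ultimately have "simple_extension V y \<notin> Fam" using max[of "simple_extension V y"] y by blast
    then have "inv f \<in> simple_extension V y" using sub AV VE by (auto simp: Fam_def)
    then show ?thesis using simple_extension_poly_values[OF V y(1)] by blast
  qed
  \<comment> \<open>If \<open>u = \<one> \<ominus> f \<otimes> a\<close> were not a unit, \<open>inv f\<close> would be a polynomial in \<open>inv u\<close>. Multiplication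
      by a power of \<open>u\<close>, which is congruent to \<open>\<one>\<close> modulo \<open>f\<close>, would then put \<open>inv f\<close> into \<open>V\<close>.\<close>
  have unit: "\<one> \<ominus> f \<otimes> a \<noteq> \<zero> \<and> inv (\<one> \<ominus> f \<otimes> a) \<in> V" if a: "a \<in> V" for a
  proof -
    have ac: "a \<in> carrier R" using a Vs by blast
    define u where "u = \<one> \<ominus> f \<otimes> a"
    have uV: "u \<in> V" using a fV Vs by (simp add: u_def a_minus_def)
    have uc: "u \<in> carrier R" using uV Vs by blast
    have u0: "u \<noteq> \<zero>"
    proof
      assume "u = \<zero>"
      then have "f \<otimes> a = \<one>" using fc ac unfolding u_def by (metis m_closed one_closed r_right_minus_eq)
      then have "a = inv f" using fc ac comm_inv_char by metis
      then show False using a nf by blast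
    qed
    have "inv u \<in> V"
    proof (rule ccontr)
      assume nu: "inv u \<notin> V"
      then obtain n where n: "inv f \<in> poly_values V (inv u) n" using grow nonzero_simps(1)[OF uc u0] by blast
      have clear: "b \<otimes> u [^] n \<in> V" if "b \<in> poly_values V (inv u) n" for b n
        using that
      proof (induction n arbitrary: b)
        case 0 then show ?case using Vs by simp
      next
        case (Suc n)
        then obtain c b' where cb: "b = c \<oplus> inv u \<otimes> b'" "c \<in> V" "b' \<in> poly_values V (inv u) n" by auto
        have cc: "c \<in> carrier R" "b' \<in> carrier R"
          using cb Vs poly_values_carrier[OF V nonzero_simps(1)[OF uc u0]] by auto
        have pw: "u [^] m \<in> V" for m :: nat using uV Vs by (induction m) auto
        have "b \<otimes> u [^] Suc n = c \<otimes> u [^] Suc n \<oplus> (inv u \<otimes> u) \<otimes> (b' \<otimes> u [^] n)"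
          unfolding cb(1) using cc uc nonzero_simps(1)[OF uc u0] by (simp add: l_distr r_distr m_ac)
        also have "\<dots> = c \<otimes> u [^] Suc n \<oplus> b' \<otimes> u [^] n" using cc uc nonzero_simps(4)[OF uc u0] by simp
        also have "\<dots> \<in> V" using Vs(7)[OF Vs(6)[OF cb(2) pw[of "Suc n"]] Suc.IH[OF cb(3)]] .
        finally show ?case .
      qed
      have "\<exists>w\<in>V. u [^] n = \<one> \<oplus> f \<otimes> w"
      proof (induction n)
        case 0 show ?case using Vs fc by (intro bexI[of _ \<zero>]) auto
      next
        case (Suc n)
        then obtain w where w: "w \<in> V" "u [^] n = \<one> \<oplus> f \<otimes> w" by blast
        have wc: "w \<in> carrier R" using w Vs by blast
        have "u [^] Suc n = \<one> \<oplus> f \<otimes> (w \<ominus> a \<ominus> f \<otimes> w \<otimes> a)"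
          using w wc ac fc by (simp add: u_def) algebra
        moreover have "w \<ominus> a \<ominus> f \<otimes> w \<otimes> a \<in> V" using w a fV Vs by (simp add: a_minus_def)
        ultimately show ?case by blast
      qed
      then obtain w where w: "w \<in> V" "u [^] n = \<one> \<oplus> f \<otimes> w" by blast
      have wc: "w \<in> carrier R" using w Vs by blast
      have "inv f \<otimes> u [^] n = inv f \<oplus> (inv f \<otimes> f) \<otimes> w"
        using w(2) wc fc nonzero_simps(1)[OF fc f(2)] by (simp add: r_distr m_assoc)
      also have "\<dots> = inv f \<oplus> w" using nonzero_simps(4)[OF fc f(2)] wc by simp
      finally have "inv f \<oplus> w \<in> V" using clear[OF n] by simp
      then have "(inv f \<oplus> w) \<oplus> \<ominus> w \<in> V" using Vs(7)[OF _ Vs(5)[OF w(1)]] by blast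
      moreover have "(inv f \<oplus> w) \<oplus> \<ominus> w = inv f" using wc nonzero_simps(1)[OF fc f(2)] by (simp add: a_assoc r_neg)
      ultimately show False using nf by simp
    qed
    then show ?thesis using u0 by (simp add: u_def)
  qed
  \<comment> \<open>In the relation for \<open>inv y\<close> the constant term can be absorbed into the unit \<open>\<one> \<ominus> f \<otimes> a\<close>. After
      multiplication by \<open>y [^] n\<close> it expresses \<open>y [^] n\<close> as \<open>f\<close> times a polynomial of lower degree, which
      replaces the leading term of the relation for \<open>y\<close>.\<close>
  have reduce: "inv f \<in> poly_values V y n"
    if y: "y \<in> carrier R" "y \<noteq> \<zero>" and n: "inv f \<in> poly_values V y (Suc n)"
      and m: "inv f \<in> poly_values V (inv y) (Suc (Suc m))" and mn: "Suc m \<le> n" for y m n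
  proof -
    have yc: "inv y \<in> carrier R" using nonzero_simps(1)[OF y] .
    note ifc = nonzero_simps(1)[OF fc f(2)]
    from poly_values_SucE[OF m]
    obtain a b where ab: "inv f = a \<oplus> inv y \<otimes> b" "a \<in> V" "b \<in> poly_values V (inv y) (Suc m)" .
    have c: "a \<in> carrier R" "b \<in> carrier R" using ab(2) Vs(1) poly_values_carrier[OF V yc ab(3)] by blast+
    define u where "u = inv (\<one> \<ominus> f \<otimes> a)"
    have uV: "u \<in> V" and uc: "u \<in> carrier R" using unit[OF ab(2)] Vs by (auto simp: u_def)
    have "\<one> = f \<otimes> (a \<oplus> inv y \<otimes> b)" using ab(1) nonzero_simps(3)[OF fc f(2)] by simp
    also have "\<dots> = f \<otimes> a \<oplus> f \<otimes> (inv y \<otimes> b)" using c yc fc by (simp add: r_distr)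
    finally have "\<one> \<ominus> f \<otimes> a = f \<otimes> (inv y \<otimes> b)" using c yc fc by algebra
    moreover have "u \<otimes> (\<one> \<ominus> f \<otimes> a) = \<one>"
      unfolding u_def using unit[OF ab(2)] c fc by (intro nonzero_simps(4)) auto
    ultimately have one: "\<one> = u \<otimes> (f \<otimes> (inv y \<otimes> b))" by simp
    obtain j where j: "n = Suc m + j" using mn le_Suc_ex by blast
    have "b \<otimes> y [^] m \<otimes> y [^] j \<in> poly_values V y (Suc m + j)"
      using poly_values_mult_var_pow[OF V y(1) poly_values_inverse[OF V y ab(3)]] .
    then have w: "u \<otimes> (b \<otimes> y [^] m \<otimes> y [^] j) \<in> poly_values V y n" (is "?w \<in> _")
      unfolding j by (rule poly_values_smult[OF V y(1) uV])
    have "y [^] n = \<one> \<otimes> (y \<otimes> (y [^] m \<otimes> y [^] j))"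
      using j y by (simp add: nat_pow_mult m_comm add.commute)
    also have "\<dots> = u \<otimes> (f \<otimes> (inv y \<otimes> b)) \<otimes> (y \<otimes> (y [^] m \<otimes> y [^] j))"
      by (rule arg_cong[OF one])
    also have "\<dots> = (inv y \<otimes> y) \<otimes> (f \<otimes> ?w)" using uc fc c y yc by (simp add: m_ac)
    also have "\<dots> = f \<otimes> ?w" using nonzero_simps(4)[OF y] uc fc c y by simp
    finally have yn: "y [^] n = f \<otimes> ?w" .
    obtain b' v where bv: "b' \<in> poly_values V y n" "v \<in> V" "inv f = b' \<oplus> v \<otimes> y [^] n"
      using poly_values_leading[OF V y(1) n] by blast
    have "inv f = b' \<oplus> (v \<otimes> f) \<otimes> ?w"
      using bv yn Vs(1) fc uc c y by (simp add: m_assoc subset_iff)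
    then show ?thesis
      using poly_values_add[OF V y(1) bv(1) poly_values_smult[OF V y(1) _ w, of "v \<otimes> f"]] bv(2) fV Vs by simp
  qed
  have val: "y \<in> V \<or> inv y \<in> V" if y: "y \<in> carrier R" "y \<noteq> \<zero>" for y
  proof (rule ccontr)
    assume no: "\<not> ?thesis"
    have least: "\<exists>n. inv f \<in> poly_values V x (Suc (Suc n)) \<and> inv f \<notin> poly_values V x (Suc n)"
      if x: "x \<in> carrier R" "x \<notin> V" for x
    proof -
      define n where "n = (LEAST n. inv f \<in> poly_values V x n)"
      have n: "inv f \<in> poly_values V x n" unfolding n_def by (rule LeastI_ex[OF grow[OF x]])
      have lt: "inv f \<notin> poly_values V x i" if "i < n" for i
        using not_less_Least that unfolding n_def by blast
      have "n \<noteq> 0" using n nonzero_simps(2)[OF fc f(2)] by (intro notI) auto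
      moreover have "n \<noteq> 1"
      proof
        assume "n = 1"
        then obtain a where "a \<in> V" "inv f = a \<oplus> x \<otimes> \<zero>" using n by auto
        then show False using nf Vs(1) x by auto
      qed
      ultimately obtain i where "n = Suc (Suc i)" by (metis One_nat_def not0_implies_Suc)
      then show ?thesis using n lt[of "Suc i"] by blast
    qed
    obtain n where n: "inv f \<in> poly_values V y (Suc (Suc n))" "inv f \<notin> poly_values V y (Suc n)"
      using least[of y] y no by blast
    obtain m where m: "inv f \<in> poly_values V (inv y) (Suc (Suc m))" "inv f \<notin> poly_values V (inv y) (Suc m)"
      using least[of "inv y"] nonzero_simps(1)[OF y] no by blast
    show False
    proof (cases "m \<le> n")
      case True then show False using reduce[OF y n(1) m(1)] n(2) by simp
    next
      case False
      then show False
        using reduce[OF nonzero_simps(1,2)[OF y] m(1), of n] n(1) m(2) nonzero_simps(5)[OF y] by simp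
    qed
  qed
  have "valuation_ring_at f V" unfolding valuation_ring_at_def using V fV f(2) nf val by auto
  then show ?thesis using AV by blast
qed

lemma (in field) inv_unit_group:
  assumes "x \<in> carrier R" "x \<noteq> \<zero>" shows "inv\<^bsub>unit_group R\<^esub> x = inv x"
proof -
  interpret M: comm_group "unit_group R" by (rule comm_group_mult_of)
  show ?thesis using assms nonzero_simps[OF assms] by (intro M.inv_equality) auto
qed

context field
begin

context
  fixes f V assumes V: "valuation_ring_at f V"
begin

lemma val_subring: "subring V R" using V by (simp add: valuation_ring_at_def)

lemma val_carrier: "x \<in> V \<Longrightarrow> x \<in> carrier R" using subringE(1)[OF val_subring] by blast

lemma val_total: "x \<in> carrier R \<Longrightarrow> x \<noteq> \<zero> \<Longrightarrow> x \<in> V \<or> inv x \<in> V"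
  using V by (auto simp: valuation_ring_at_def)

lemma subgroup_val_units: "subgroup (val_units V) (unit_group R)"
proof -
  interpret M: comm_group "unit_group R" by (rule comm_group_mult_of)
  show ?thesis
  proof (rule M.subgroupI)
    show "val_units V \<subseteq> carrier (unit_group R)" using val_carrier by (auto simp: val_units_def)
    show "val_units V \<noteq> {}" using subringE(3)[OF val_subring] by (auto simp: val_units_def)
    show "inv\<^bsub>unit_group R\<^esub> a \<in> val_units V" if "a \<in> val_units V" for a
      using that val_carrier nonzero_simps[of a] by (auto simp: val_units_def inv_unit_group)
    show "a \<otimes>\<^bsub>unit_group R\<^esub> b \<in> val_units V" if "a \<in> val_units V" "b \<in> val_units V" for a b
      using that val_carrier subringE(6)[OF val_subring]
      by (auto simp: val_units_def integral_iff inv_mult)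
  qed
qed

lemma val_units_mult_cancel:
  assumes "x \<in> V" "y \<in> V" "x \<otimes> y \<in> val_units V" shows "x \<in> val_units V"
proof -
  have c: "x \<in> carrier R" "y \<in> carrier R" "x \<noteq> \<zero>" "y \<noteq> \<zero>"
    using assms val_carrier by (auto simp: val_units_def)
  have "y \<otimes> inv (x \<otimes> y) \<in> V" using assms subringE(6)[OF val_subring] by (auto simp: val_units_def)
  also have "y \<otimes> inv (x \<otimes> y) = inv x"
    using c nonzero_simps[of x] nonzero_simps[of y] by (simp add: inv_mult m_lcomm[of y "inv x"])
  finally show ?thesis using assms c by (simp add: val_units_def)
qed

text \<open>
  One of the two quotients of \<open>x\<close> and \<open>y\<close> lies in \<open>V\<close>, so the sum is a multiple of \<open>x\<close> or of \<open>y\<close>.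
\<close>

lemma val_nonunit_add:
  assumes x: "x \<in> V" "x \<notin> val_units V" and y: "y \<in> V" "y \<notin> val_units V"
  shows "x \<oplus> y \<notin> val_units V"
proof
  note Vs = subringE[OF val_subring]
  assume xy: "x \<oplus> y \<in> val_units V"
  have *: False if x: "x \<in> V" "x \<notin> val_units V" and y: "y \<in> V" "y \<noteq> \<zero>" "x \<otimes> inv y \<in> V" "y \<notin> val_units V"
      and xy: "x \<oplus> y \<in> val_units V" for x y
  proof -
    have c: "x \<in> carrier R" "y \<in> carrier R" using x y val_carrier by auto
    have "y \<otimes> (x \<otimes> inv y \<oplus> \<one>) = x \<oplus> y" using c y(2) nonzero_simps[of y] by (simp add: r_distr m_lcomm)
    then show False using val_units_mult_cancel[of y "x \<otimes> inv y \<oplus> \<one>"] y xy Vs(3,7) by auto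
  qed
  have c: "x \<in> carrier R" "y \<in> carrier R" using x y val_carrier by auto
  show False
  proof (cases "x = \<zero> \<or> y = \<zero>")
    case True then show False using x y xy c by auto
  next
    case False
    then have nz: "x \<noteq> \<zero>" "y \<noteq> \<zero>" by auto
    have "x \<otimes> inv y \<in> V \<or> inv (x \<otimes> inv y) \<in> V"
      using val_total[of "x \<otimes> inv y"] c nz nonzero_simps[of y] by (simp add: integral_iff)
    moreover have "inv (x \<otimes> inv y) = y \<otimes> inv x"
      using c nz nonzero_simps[of y] nonzero_simps[of x] by (simp add: inv_mult m_comm)
    ultimately show False using *[OF x y(1) nz(2) _ y(2) xy] *[OF y x(1) nz(1) _ x(2)] xy c by (auto simp: a_comm)
  qed
qed

lemma one_plus_val_nonunit:
  assumes r: "r \<in> V" "r \<notin> val_units V" shows "\<one> \<oplus> r \<in> val_units V"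
proof (rule ccontr)
  note Vs = subringE[OF val_subring]
  assume "\<not> ?thesis"
  moreover have "\<one> \<oplus> r \<in> V" using r Vs(3,7) by blast
  moreover have "\<ominus> r \<notin> val_units V"
  proof
    assume "\<ominus> r \<in> val_units V"
    moreover have "\<ominus> r = r \<otimes> \<ominus> \<one>" using r val_carrier by (simp add: r_minus)
    ultimately have "r \<in> val_units V" using val_units_mult_cancel[of r "\<ominus> \<one>"] r Vs(3,5) by simp
    then show False using r by simp
  qed
  ultimately have "(\<one> \<oplus> r) \<oplus> \<ominus> r \<notin> val_units V" using val_nonunit_add r Vs(5) by blast
  moreover have "(\<one> \<oplus> r) \<oplus> \<ominus> r = \<one>" using r val_carrier by (simp add: a_assoc r_neg)
  ultimately show False using Vs(3) by (simp add: val_units_def)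
qed

text \<open>
  The sum of two elements of different value has the value of one of them.
\<close>

lemma val_add_dominant:
  assumes c: "a \<in> carrier R" "a \<noteq> \<zero>" "b \<in> carrier R" "b \<noteq> \<zero>" and n: "a \<otimes> inv b \<notin> val_units V"
  shows "(a \<oplus> b) \<otimes> inv a \<in> val_units V \<or> (a \<oplus> b) \<otimes> inv b \<in> val_units V"
proof -
  have e1: "(a \<oplus> b) \<otimes> inv b = \<one> \<oplus> a \<otimes> inv b" "(a \<oplus> b) \<otimes> inv a = \<one> \<oplus> b \<otimes> inv a"
    using c nonzero_simps[of a] nonzero_simps[of b] by (simp_all add: l_distr a_comm)
  have e2: "inv (a \<otimes> inv b) = b \<otimes> inv a"
    using c nonzero_simps[of a] nonzero_simps[of b] by (simp add: inv_mult m_comm)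
  have e3: "inv (b \<otimes> inv a) = a \<otimes> inv b"
    using c nonzero_simps[of a] nonzero_simps[of b] by (simp add: inv_mult m_comm)
  have "a \<otimes> inv b \<in> V \<or> b \<otimes> inv a \<in> V"
    using val_total[of "a \<otimes> inv b"] c nonzero_simps[of b] e2 by (simp add: integral_iff)
  then show ?thesis
  proof
    assume "a \<otimes> inv b \<in> V"
    then show ?thesis using one_plus_val_nonunit[OF _ n] e1 by simp
  next
    assume *: "b \<otimes> inv a \<in> V"
    have "b \<otimes> inv a \<notin> val_units V"
      using n c nonzero_simps[of a] nonzero_simps[of b] by (auto simp: val_units_def e2 e3 integral_iff)
    then show ?thesis using one_plus_val_nonunit[OF *] e1 by simp
  qed
qed

lemma val_maximal_ideal:
  "f \<in> carrier R" "f \<noteq> \<zero>" "f \<in> V" "f \<notin> val_units V"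
  using V val_carrier by (auto simp: valuation_ring_at_def val_units_def)

end

text \<open>
  If no power \<open>y [^] i\<close> with small positive \<open>i\<close> lay in \<open>Q\<close>, the nonzero terms of \<open>p\<close> at \<open>y\<close> would
  lie in different classes modulo \<open>Q\<close> and hence have different values. The sum of such terms has the
  value of one of them and cannot vanish. The induction runs over the final segments of the
  coefficient list.
\<close>

lemma power_mem_if_algebraic:
  assumes V: "valuation_ring_at f V"
    and Q: "subgroup Q (unit_group R)" "val_units V \<subseteq> Q"
    and K: "subfield K R" "K - {\<zero>} \<subseteq> Q"
    and y: "y \<in> carrier R" "y \<noteq> \<zero>"
    and p: "set p \<subseteq> K" "\<exists>a\<in>set p. a \<noteq> \<zero>" "eval p y = \<zero>"
  shows "\<exists>i. 0 < i \<and> i < length p \<and> y [^] (i::nat) \<in> Q"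
proof (rule ccontr)
  assume no: "\<not> ?thesis"
  interpret M: comm_group "unit_group R" by (rule comm_group_mult_of)
  note [simp] = Multiplicative_Group.nat_pow_mult_of
  have Qm: "a \<otimes> b \<in> Q" if "a \<in> Q" "b \<in> Q" for a b using subgroup.m_closed[OF Q(1)] that by simp
  have Qc: "a \<in> carrier R" "a \<noteq> \<zero>" if "a \<in> Q" for a using subgroup.subset[OF Q(1)] that by auto
  have Qi: "inv a \<in> Q" if "a \<in> Q" for a
    using subgroup.m_inv_closed[OF Q(1) that] Qc[OF that] by (simp add: inv_unit_group)
  have pw: "y [^] i \<in> carrier R" "y [^] i \<noteq> \<zero>" for i :: nat using y nat_pow_eq_zeroD by auto
  have "(\<forall>a\<in>set q. a = \<zero>) \<and> eval q y = \<zero> \<or> (\<exists>i<length q. eval q y \<otimes> inv (y [^] i) \<in> Q)"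
    if "set q \<subseteq> K" "length q \<le> length p" for q
    using that
  proof (induction q)
    case Nil then show ?case by simp
  next
    case (Cons a q)
    define l where "l = length q"
    define e where "e = eval q y"
    have ac: "a \<in> K" "a \<in> carrier R" using Cons.prems subfieldE(3)[OF K(1)] by auto
    have ec: "e \<in> carrier R" unfolding e_def
      using Cons.prems subfieldE(3)[OF K(1)] by (intro eval_in_carrier y) auto
    have ev: "eval (a # q) y = a \<otimes> y [^] l \<oplus> e" by (simp add: l_def e_def)
    have IH: "(\<forall>a\<in>set q. a = \<zero>) \<and> e = \<zero> \<or> (\<exists>i<l. e \<otimes> inv (y [^] i) \<in> Q)"
      using Cons by (simp add: l_def e_def)
    show ?case
    proof (cases "a = \<zero>")
      case True
      then have "eval (a # q) y = e" using ev ec pw by simp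
      then show ?thesis using IH True by (auto simp: l_def)
    next
      case a0: False
      have aQ: "a \<in> Q" using K ac a0 by blast
      from IH show ?thesis
      proof
        assume "(\<forall>a\<in>set q. a = \<zero>) \<and> e = \<zero>"
        then have "eval (a # q) y \<otimes> inv (y [^] l) = a"
          using ev ac pw nonzero_simps[OF pw] by (simp add: m_assoc)
        then show ?thesis using aQ by (auto simp: l_def)
      next
        assume "\<exists>i<l. e \<otimes> inv (y [^] i) \<in> Q"
        then obtain i where i: "i < l" "e \<otimes> inv (y [^] i) \<in> Q" by blast
        note yi = nonzero_simps[OF pw, of i] and yl = nonzero_simps[OF pw, of l]
        have e0: "e \<noteq> \<zero>" using Qc(2)[OF i(2)] yi by auto
        note ei = nonzero_simps[OF ec e0]
        have al: "a \<otimes> y [^] l \<noteq> \<zero>" "a \<otimes> y [^] l \<in> carrier R" using a0 ac pw by (auto simp: integral_iff)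
        have "(a \<otimes> y [^] l) \<otimes> inv e \<notin> val_units V"
        proof
          assume "(a \<otimes> y [^] l) \<otimes> inv e \<in> val_units V"
          then have "(a \<otimes> y [^] l) \<otimes> inv e \<otimes> (e \<otimes> inv (y [^] i)) \<otimes> inv a \<in> Q"
            using i Q Qm Qi aQ by blast
          also have "(a \<otimes> y [^] l) \<otimes> inv e \<otimes> (e \<otimes> inv (y [^] i)) \<otimes> inv a
              = (a \<otimes> inv a) \<otimes> (inv e \<otimes> e) \<otimes> (y [^] l \<otimes> inv (y [^] i))"
            using ac(2) ec ei(1) yi(1) pw nonzero_simps(1)[OF ac(2) a0] by (simp add: m_ac)
          also have "\<dots> = y [^] l \<otimes> inv (y [^] i)"
            using ei(4) nonzero_simps(3)[OF ac(2) a0] yi(1) pw by simp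
          also have "y [^] l = y [^] (l - i) \<otimes> y [^] i" using i y by (simp add: nat_pow_mult)
          also have "\<dots> \<otimes> inv (y [^] i) = y [^] (l - i)" using pw yi by (simp add: m_assoc)
          finally have "y [^] (l - i) \<in> Q" .
          moreover have "0 < l - i" "l - i < length p" using i Cons.prems by (auto simp: l_def)
          ultimately show False using no by blast
        qed
        from val_add_dominant[OF V al(2,1) ec e0 this]
        consider "(a \<otimes> y [^] l \<oplus> e) \<otimes> inv (a \<otimes> y [^] l) \<in> Q" | "(a \<otimes> y [^] l \<oplus> e) \<otimes> inv e \<in> Q"
          using Q by blast
        then show ?thesis
        proof cases
          case 1
          let ?s = "a \<otimes> y [^] l \<oplus> e"
          have sc: "?s \<in> carrier R" using al ec by simp
          have "?s \<otimes> inv (a \<otimes> y [^] l) \<otimes> a \<in> Q" using 1 aQ Qm by blast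
          also have "inv (a \<otimes> y [^] l) = inv a \<otimes> inv (y [^] l)" using ac a0 pw by (simp add: inv_mult)
          also have "?s \<otimes> (inv a \<otimes> inv (y [^] l)) \<otimes> a = (?s \<otimes> inv (y [^] l)) \<otimes> (inv a \<otimes> a)"
            using sc yl(1) ac(2) nonzero_simps(1)[OF ac(2) a0] by (simp add: m_ac)
          also have "\<dots> = ?s \<otimes> inv (y [^] l)" using sc yl(1) nonzero_simps(4)[OF ac(2) a0] by simp
          finally show ?thesis unfolding ev by (auto simp: l_def)
        next
          case 2
          let ?s = "a \<otimes> y [^] l \<oplus> e"
          have sc: "?s \<in> carrier R" using al ec by simp
          have "(?s \<otimes> inv e) \<otimes> (e \<otimes> inv (y [^] i)) \<in> Q" using 2 i Qm by blast
          also have "(?s \<otimes> inv e) \<otimes> (e \<otimes> inv (y [^] i)) = (?s \<otimes> inv (y [^] i)) \<otimes> (inv e \<otimes> e)"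
            using sc ei(1) ec yi(1) by (simp add: m_ac)
          also have "\<dots> = ?s \<otimes> inv (y [^] i)" using sc ei(4) yi(1) by simp
          finally show ?thesis unfolding ev using i by (auto simp: l_def intro!: exI[of _ i])
        qed
      qed
    qed
  qed
  from this[OF p(1)] p show False using Qc nonzero_simps[OF pw] by fastforce
qed

lemma fractions_of_subring:
  assumes S: "subring S R" and H: "H \<subseteq> S" and z: "z \<in> generate_field R H"
  shows "\<exists>a\<in>S. \<exists>b\<in>S. b \<noteq> \<zero> \<and> z = a \<otimes> inv b"
proof -
  note Ss = subringE[OF S]
  have Sc: "x \<in> carrier R" if "x \<in> S" for x using Ss that by blast
  show ?thesis using z
  proof (induction rule: generate_field.induct)
    case one
    show ?case using Ss(3) by (intro bexI[of _ \<one>]) auto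
  next
    case (incl h)
    then have "h \<in> S" using H by blast
    then show ?case using Ss(3) Sc by (intro bexI[of _ h] bexI[of _ \<one>]) auto
  next
    case (a_inv h)
    then obtain a b where ab: "a \<in> S" "b \<in> S" "b \<noteq> \<zero>" "h = a \<otimes> inv b" by blast
    then have "\<ominus> h = (\<ominus> a) \<otimes> inv b" using Sc nonzero_simps(1)[OF Sc] by (simp add: l_minus)
    then show ?case using ab Ss(5) by blast
  next
    case (m_inv h)
    then obtain a b where ab: "a \<in> S" "b \<in> S" "b \<noteq> \<zero>" "h = a \<otimes> inv b" by blast
    have c: "a \<in> carrier R" "b \<in> carrier R" using ab Sc by auto
    note ib = nonzero_simps[OF c(2) ab(3)]
    have a0: "a \<noteq> \<zero>" using m_inv ab ib by auto
    have "inv h = b \<otimes> inv a"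
      unfolding ab(4) using c a0 ib(1,2,5) nonzero_simps(1)[OF c(1) a0] by (simp add: inv_mult m_comm)
    then show ?case using ab a0 by blast
  next
    case (eng_add h1 h2)
    then obtain a b a' b' where ab: "a \<in> S" "b \<in> S" "b \<noteq> \<zero>" "h1 = a \<otimes> inv b"
      "a' \<in> S" "b' \<in> S" "b' \<noteq> \<zero>" "h2 = a' \<otimes> inv b'" by blast
    have c: "a \<in> carrier R" "b \<in> carrier R" "a' \<in> carrier R" "b' \<in> carrier R" using ab Sc by auto
    note ib = nonzero_simps[OF c(2) ab(3)] and ib' = nonzero_simps[OF c(4) ab(7)]
    have bb: "b \<otimes> b' \<in> carrier R" "b \<otimes> b' \<noteq> \<zero>" using c ab by (auto simp: integral_iff)
    note ibb = nonzero_simps[OF bb]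
    have "(h1 \<oplus> h2) \<otimes> (b \<otimes> b') = a \<otimes> b' \<otimes> (inv b \<otimes> b) \<oplus> a' \<otimes> b \<otimes> (inv b' \<otimes> b')"
      unfolding ab(4,8) using c ib(1) ib'(1) by (simp add: l_distr r_distr m_ac)
    also have "\<dots> = a \<otimes> b' \<oplus> a' \<otimes> b" using c ib(4) ib'(4) by simp
    finally have e: "(h1 \<oplus> h2) \<otimes> (b \<otimes> b') = a \<otimes> b' \<oplus> a' \<otimes> b" .
    have "h1 \<oplus> h2 = ((h1 \<oplus> h2) \<otimes> (b \<otimes> b')) \<otimes> inv (b \<otimes> b')"
      unfolding ab(4,8) using c bb(1) ib(1) ib'(1) ibb(1,3) by (simp add: m_assoc[of _ "b \<otimes> b'" "inv (b \<otimes> b')"])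
    then have "h1 \<oplus> h2 = (a \<otimes> b' \<oplus> a' \<otimes> b) \<otimes> inv (b \<otimes> b')" unfolding e .
    moreover have "a \<otimes> b' \<oplus> a' \<otimes> b \<in> S" "b \<otimes> b' \<in> S" using ab Ss(6,7) by auto
    ultimately show ?case using bb by blast
  next
    case (eng_mult h1 h2)
    then obtain a b a' b' where ab: "a \<in> S" "b \<in> S" "b \<noteq> \<zero>" "h1 = a \<otimes> inv b"
      "a' \<in> S" "b' \<in> S" "b' \<noteq> \<zero>" "h2 = a' \<otimes> inv b'" by blast
    have c: "a \<in> carrier R" "b \<in> carrier R" "a' \<in> carrier R" "b' \<in> carrier R" using ab Sc by auto
    note ib = nonzero_simps[OF c(2) ab(3)] and ib' = nonzero_simps[OF c(4) ab(7)]
    have bb: "b \<otimes> b' \<in> carrier R" "b \<otimes> b' \<noteq> \<zero>" using c ab by (auto simp: integral_iff)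
    have "inv (b \<otimes> b') = inv b \<otimes> inv b'"
      using c ab(3,7) by (simp add: inv_mult)
    then have "h1 \<otimes> h2 = (a \<otimes> a') \<otimes> inv (b \<otimes> b')" unfolding ab(4,8) using c ib(1) ib'(1) by (simp add: m_ac)
    moreover have "a \<otimes> a' \<in> S" "b \<otimes> b' \<in> S" using ab Ss(6) by auto
    ultimately show ?case using bb by blast
  qed
qed

end

lemma (in field) power_not_val_unit:
  assumes V: "valuation_ring_at f V" and m: "f [^]\<^bsub>unit_group R\<^esub> (m::int) \<in> val_units V"
  shows "m = 0"
proof -
  interpret M: comm_group "unit_group R" by (rule comm_group_mult_of)
  note f = val_maximal_ideal[OF V]
  have fm: "f \<in> carrier (unit_group R)" using f by simp
  note Vs = subringE[OF val_subring[OF V]]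
  have posU: "f [^]\<^bsub>unit_group R\<^esub> int (Suc j) \<notin> val_units V" for j
  proof
    assume a: "f [^]\<^bsub>unit_group R\<^esub> int (Suc j) \<in> val_units V"
    have "f [^]\<^bsub>unit_group R\<^esub> int (Suc j) = f [^] Suc j"
      by (simp only: int_pow_int Multiplicative_Group.nat_pow_mult_of)
    then have "f \<otimes> f [^] j \<in> val_units V" using a f by (simp add: m_comm)
    moreover have "f [^] j \<in> V" using f Vs(3,6) by (induction j) auto
    ultimately show False using val_units_mult_cancel[OF V f(3)] f(4) by blast
  qed
  show ?thesis
  proof (cases m rule: int_cases3)
    case (pos n)
    then show ?thesis using m posU[of "n - 1"] by simp
  next
    case (neg n)
    have "f [^]\<^bsub>unit_group R\<^esub> (- m) \<in> val_units V"
      using subgroup.m_inv_closed[OF subgroup_val_units[OF V] m] M.int_pow_neg[OF fm, of m] by simp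
    then show ?thesis using neg posU[of "n - 1"] by simp
  qed simp
qed

section \<open>Valuations of function fields\<close>

lemma (in field) transcendental_inverse_not_mem:
  assumes K: "subfield K R" and y: "y \<in> carrier R" "(transcendental over K) y"
  shows "y \<noteq> \<zero>" "inv y \<notin> simple_extension K y"
proof -
  show y0: "y \<noteq> \<zero>" using zero_is_algebraic[OF subfieldE(1)[OF K]] y(2) by (auto simp: over_def)
  show "inv y \<notin> simple_extension K y"
  proof
    assume "inv y \<in> simple_extension K y"
    then obtain p where p: "p \<in> carrier (K[X])" "inv y = eval p y"
      using simple_extension_as_eval_img[OF subfieldE(3)[OF K] y(1)] by auto
    have pc: "set p \<subseteq> carrier R" and pp: "polynomial K p"
      using p(1) subfieldE(3)[OF K] by (auto simp: univ_poly_carrier[symmetric] polynomial_def)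
    have "p \<noteq> []" using p(2) nonzero_simps(2)[OF y(1) y0] by auto
    then have "p @ [\<ominus> \<one>] \<in> carrier (K[X])"
      using pp subringE[OF subfieldE(1)[OF K]] by (auto simp: univ_poly_carrier[symmetric] polynomial_def)
    moreover have "eval (p @ [\<ominus> \<one>]) y = \<zero>"
      using eval_append_aux[OF pc _ y(1), of "\<ominus> \<one>"] p(2) nonzero_simps(4)[OF y(1) y0] by (simp add: r_neg)
    ultimately have "p @ [\<ominus> \<one>] = []" using eval_transcendental[OF y(2)] by blast
    then show False by simp
  qed
qed

text \<open>
  The powers of \<open>z\<close> below the degree of its minimal polynomial are independent elements of \<open>M\<close>.
\<close>

lemma (in field) algebraic_bounded_relation:
  assumes K: "subfield K R" and M: "dimension n K M" "subring M R" "K \<subseteq> M" and z: "z \<in> M"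
  shows "(algebraic over K) z" "degree (Irr K z) \<le> n"
proof -
  have zc: "z \<in> carrier R" using z subringE(1)[OF M(2)] by blast
  show alg: "(algebraic over K) z"
    using finite_dimension_imp_algebraic[OF K M(2) _ z] M(1) by (auto simp: finite_dimension_def)
  have ind: "independent K (exp_base z (degree (Irr K z)))"
    using exp_base_independent[OF K zc alg] .
  have "set (exp_base z (degree (Irr K z))) \<subseteq> M"
  proof -
    have "z [^] i \<in> M" for i :: nat using z subringE(3,6)[OF M(2)] by (induction i) auto
    then show ?thesis by (auto simp: exp_base_def)
  qed
  from independent_length_le_dimension[OF K M(1) ind this]
  show "degree (Irr K z) \<le> n" by (simp add: exp_base_def)
qed

text \<open>
  The \<open>y\<close>-adic valuation of \<open>k(y)\<close>, extended to \<open>M\<close>. Let \<open>V\<close> be a valuation ring that contains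
  \<open>k[y]\<close> and has \<open>y\<close> in its maximal ideal. The nonzero elements of \<open>k\<close> are units of \<open>V\<close>, and every
  nonzero element of \<open>k(y)\<close> is a unit times a power of \<open>y\<close>: after division by a power of \<open>y\<close> a
  polynomial has a nonzero constant term. If \<open>M\<close> has degree \<open>n\<close> over \<open>k(y)\<close>, a nonzero element of
  \<open>M\<close> is of this form after raising it to a power between \<open>1\<close> and \<open>n\<close>, hence after raising it to the
  power \<open>fact n\<close>. The function \<open>v\<close> is the exponent of \<open>y\<close> in that power.
\<close>

lemma (in field) exists_additive_valuation:
  assumes k: "subfield k R" and y: "y \<in> carrier R" "(transcendental over k) y"
    and M: "subring M R" "generate_field R (k \<union> {y}) \<subseteq> M" "finite_dimension (generate_field R (k \<union> {y})) M"
  shows "\<exists>v. monoid.additive_on (unit_group R) (M - {\<zero>}) v \<and> v y \<noteq> 0 \<and> (\<forall>c\<in>k - {\<zero>}. v c = 0)"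
proof -
  interpret M: comm_group "unit_group R" by (rule comm_group_mult_of)
  note [simp] = Multiplicative_Group.nat_pow_mult_of
  define K where "K = generate_field R (k \<union> {y})"
  have K: "subfield K R" unfolding K_def
    using y subfieldE(3)[OF k] by (intro generate_field_is_subfield) auto
  obtain n where n: "dimension n K M" using M(3) by (auto simp: finite_dimension_def K_def)
  note ty = transcendental_inverse_not_mem[OF k y]
  have S: "subring (simple_extension k y) R" using simple_extension_is_subring[OF subfieldE(1)[OF k] y(1)] .
  obtain V where V: "valuation_ring_at y V" and kV: "simple_extension k y \<subseteq> V"
    using exists_valuation_ring[OF S simple_extension_mem[OF subfieldE(1)[OF k] y(1)] ty] by blast
  note U = subgroup_val_units[OF V]
  note Vs = subringE[OF val_subring[OF V]]
  have kU: "c \<in> val_units V" if "c \<in> k" "c \<noteq> \<zero>" for c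
  proof -
    have "inv c \<in> k" using subfield_m_inv(1)[OF k] that by auto
    then show ?thesis using that kV simple_extension_incl[OF subfieldE(3)[OF k] y(1)] by (auto simp: val_units_def)
  qed
  let ?y = "\<lambda>m::int. y [^]\<^bsub>unit_group R\<^esub> m"
  have ym: "y \<in> carrier (unit_group R)" using y ty by simp
  have Uc: "u \<in> carrier (unit_group R)" if "u \<in> val_units V" for u using subgroup.mem_carrier[OF U that] .
  define Q where "Q = {u \<otimes>\<^bsub>unit_group R\<^esub> ?y m | u m. u \<in> val_units V}"
  have Q: "subgroup Q (unit_group R)" "insert y (val_units V) \<subseteq> Q"
    unfolding Q_def by (rule M.subgroup_mult_powers[OF U ym])+
  then have UQ: "val_units V \<subseteq> Q" and yQ: "y \<in> Q" by auto
  have SQ: "a \<noteq> \<zero> \<Longrightarrow> a \<in> Q" if "a \<in> simple_extension k y" for a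
    using that
  proof (induction rule: simple_extension.induct)
    case zero then show ?case by simp
  next
    case (lin k1 k2)
    have k1V: "k1 \<in> V" using lin kV by blast
    have c: "k1 \<in> carrier R" "k2 \<in> carrier R" using k1V val_carrier[OF V] lin subfieldE(3)[OF k] by auto
    show ?case
    proof (cases "k2 = \<zero>")
      case True
      then have "k1 \<noteq> \<zero>" "(k1 \<otimes> y) \<oplus> k2 = k1 \<otimes> y" using lin c y by auto
      then show ?thesis using lin subgroup.m_closed[OF Q(1)] yQ by auto
    next
      case False
      note i2 = nonzero_simps[OF c(2) False]
      have i2V: "inv k2 \<in> V" using kU[OF lin.hyps(2) False] by (simp add: val_units_def)
      have k2V: "k2 \<in> V" using kU[OF lin.hyps(2) False] by (simp add: val_units_def)
      define r where "r = k1 \<otimes> y \<otimes> inv k2"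
      have "y \<in> V" using val_maximal_ideal[OF V] by simp
      then have rV: "r \<in> V" using k1V i2V Vs(6) by (simp add: r_def)
      have "r \<notin> val_units V"
      proof
        assume "r \<in> val_units V"
        moreover have "r = y \<otimes> (k1 \<otimes> inv k2)" using c y i2 by (simp add: r_def m_ac)
        ultimately have "y \<in> val_units V"
          using val_units_mult_cancel[OF V \<open>y \<in> V\<close>, of "k1 \<otimes> inv k2"] k1V i2V Vs(6) by simp
        then show False using val_maximal_ideal[OF V] by simp
      qed
      from one_plus_val_nonunit[OF V rV this] have "k2 \<otimes> (\<one> \<oplus> r) \<in> val_units V"
        using subgroup.m_closed[OF U kU[OF lin.hyps(2) False]] by simp
      also have "k2 \<otimes> (\<one> \<oplus> r) = k2 \<oplus> (k1 \<otimes> y) \<otimes> (inv k2 \<otimes> k2)"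
        unfolding r_def using c y i2(1) by (simp add: r_distr m_ac)
      also have "\<dots> = (k1 \<otimes> y) \<oplus> k2" using c y i2(4) by (simp add: a_comm)
      finally show ?thesis using UQ by blast
    qed
  qed
  have kyS: "k \<union> {y} \<subseteq> simple_extension k y"
    using simple_extension_incl[OF subfieldE(3)[OF k] y(1)] simple_extension_mem[OF subfieldE(1)[OF k] y(1)] by blast
  have KQ: "K - {\<zero>} \<subseteq> Q"
  proof
    fix z assume z: "z \<in> K - {\<zero>}"
    then obtain a b where ab: "a \<in> simple_extension k y" "b \<in> simple_extension k y" "b \<noteq> \<zero>" "z = a \<otimes> inv b"
      using fractions_of_subring[OF S kyS] unfolding K_def by blast
    have c: "a \<in> carrier R" "b \<in> carrier R" using ab subringE(1)[OF S] by auto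
    have "a \<noteq> \<zero>" using ab z nonzero_simps(1)[OF c(2) ab(3)] by auto
    then show "z \<in> Q" using SQ ab subgroup.m_closed[OF Q(1)] subgroup.m_inv_closed[OF Q(1) SQ[OF ab(2,3)]]
        inv_unit_group[OF c(2) ab(3)] by simp
  qed
  have Qpow: "a [^] (i::nat) \<in> Q" if "a \<in> Q" for a i
    using that subgroup.one_closed[OF Q(1)] subgroup.m_closed[OF Q(1)] by (induction i) auto
  define N :: nat where "N = fact n"
  have MQ: "z [^] N \<in> Q" if z: "z \<in> M" "z \<noteq> \<zero>" for z
  proof -
    have zc: "z \<in> carrier R" using z subringE(1)[OF M(1)] by blast
    note rel = algebraic_bounded_relation[OF K n M(1) M(2)[folded K_def] z(1)]
    note I = IrrE[OF K zc rel(1)]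
    have "Irr K z \<noteq> []" using I(3) pirreducibleE(1)[OF subfieldE(1)[OF K] I(1,2)] by simp
    then have "\<exists>a\<in>set (Irr K z). a \<noteq> \<zero>" using I(3) hd_in_set[of "Irr K z"] by force
    moreover have "set (Irr K z) \<subseteq> K" using I(1) by (auto simp: univ_poly_carrier[symmetric] polynomial_def)
    ultimately obtain i where i: "0 < i" "i < length (Irr K z)" "z [^] i \<in> Q"
      using power_mem_if_algebraic[OF V Q(1) UQ K KQ zc z(2)] I(4) by blast
    have "i dvd N" unfolding N_def using i rel(2) by (intro dvd_fact) auto
    then obtain j where "N = i * j" by blast
    then have "z [^] N = (z [^] i) [^] j" using zc by (simp add: nat_pow_pow)
    then show ?thesis using Qpow[OF i(3)] by simp
  qed
  have uniq: "m = l" if e: "u \<otimes>\<^bsub>unit_group R\<^esub> ?y m = w \<otimes>\<^bsub>unit_group R\<^esub> ?y l"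
    and u: "u \<in> val_units V" and w: "w \<in> val_units V" for m l u w
  proof -
    have "?y m = inv\<^bsub>unit_group R\<^esub> u \<otimes>\<^bsub>unit_group R\<^esub> (w \<otimes>\<^bsub>unit_group R\<^esub> ?y l)"
      using e Uc[OF u] Uc[OF w] M.int_pow_closed[OF ym] M.inv_solve_left by (metis M.m_closed)
    then have "?y (m - l) = inv\<^bsub>unit_group R\<^esub> u \<otimes>\<^bsub>unit_group R\<^esub> w"
      using Uc[OF u] Uc[OF w] M.int_pow_closed[OF ym]
      by (metis M.int_pow_diff[OF ym] M.inv_closed M.inv_solve_right' M.m_assoc M.m_closed)
    then have "?y (m - l) \<in> val_units V"
      using subgroup.m_closed[OF U subgroup.m_inv_closed[OF U u] w] by simp
    then show "m = l" using power_not_val_unit[OF V] by fastforce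
  qed
  define v where "v z = (THE m. \<exists>u\<in>val_units V. z [^] N = u \<otimes>\<^bsub>unit_group R\<^esub> ?y m)" for z
  have vI: "v z = m" if "z [^] N = u \<otimes>\<^bsub>unit_group R\<^esub> ?y m" "u \<in> val_units V" for z m u
    unfolding v_def using that uniq by (intro the_equality) auto
  have "M.additive_on (M - {\<zero>}) v"
    unfolding M.additive_on_def
  proof (intro ballI)
    fix z w assume zw: "z \<in> M - {\<zero>}" "w \<in> M - {\<zero>}"
    obtain m u where mu: "z [^] N = u \<otimes>\<^bsub>unit_group R\<^esub> ?y m" "u \<in> val_units V"
      using MQ zw unfolding Q_def by blast
    obtain l u' where lu: "w [^] N = u' \<otimes>\<^bsub>unit_group R\<^esub> ?y l" "u' \<in> val_units V"
      using MQ zw unfolding Q_def by blast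
    have zwc: "z \<in> carrier R" "w \<in> carrier R" using zw subringE(1)[OF M(1)] by auto
    have "(z \<otimes> w) [^] N = (u \<otimes>\<^bsub>unit_group R\<^esub> ?y m) \<otimes>\<^bsub>unit_group R\<^esub> (u' \<otimes>\<^bsub>unit_group R\<^esub> ?y l)"
      using zwc mu(1) lu(1) by (simp add: nat_pow_distrib)
    also have "\<dots> = (u \<otimes>\<^bsub>unit_group R\<^esub> u') \<otimes>\<^bsub>unit_group R\<^esub> (?y m \<otimes>\<^bsub>unit_group R\<^esub> ?y l)"
      using M.int_pow_closed[OF ym] Uc[OF mu(2)] Uc[OF lu(2)] by (simp only: M.m_ac M.m_closed)
    also have "\<dots> = (u \<otimes>\<^bsub>unit_group R\<^esub> u') \<otimes>\<^bsub>unit_group R\<^esub> ?y (m + l)"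
      by (simp only: M.int_pow_mult[OF ym])
    finally have "v (z \<otimes> w) = m + l" using vI subgroup.m_closed[OF U mu(2) lu(2)] by blast
    then show "v (z \<otimes>\<^bsub>unit_group R\<^esub> w) = v z + v w" using vI[OF mu] vI[OF lu] by simp
  qed
  moreover have "v y = int N"
  proof (rule vI)
    show "y [^] N = \<one>\<^bsub>unit_group R\<^esub> \<otimes>\<^bsub>unit_group R\<^esub> ?y (int N)" using y by (simp only: int_pow_int) simp
  qed (rule subgroup.one_closed[OF U])
  moreover have "v c = 0" if c: "c \<in> k - {\<zero>}" for c
  proof (rule vI)
    have "c \<in> carrier R" using c subfieldE(3)[OF k] by auto
    then show "c [^] N = c [^] N \<otimes>\<^bsub>unit_group R\<^esub> ?y 0" by simp
    show "c [^] N \<in> val_units V"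
      using kU[of c] c subgroup.one_closed[OF U] subgroup.m_closed[OF U] by (induction N) auto
  qed
  ultimately show ?thesis by (intro exI[of _ v]) (auto simp: N_def)
qed

section \<open>Infinite rank\<close>

text \<open>
  Gaussian elimination of one equation at a time, with cross-multiplication in place of division.
\<close>

lemma homogeneous_int_system:
  fixes a :: "'i \<Rightarrow> 'j \<Rightarrow> int"
  assumes "finite J" "finite I" "card J < card I"
  shows "\<exists>c. (\<exists>i\<in>I. c i \<noteq> 0) \<and> (\<forall>j\<in>J. (\<Sum>i\<in>I. c i * a i j) = 0)"
  using assms
proof (induction J arbitrary: I a rule: finite_induct)
  case empty
  then have "I \<noteq> {}" by auto
  then show ?case by (intro exI[of _ "\<lambda>_. 1"]) auto
next
  case (insert j J)
  show ?case
  proof (cases "\<forall>i\<in>I. a i j = 0")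
    case True
    have "card J < card I" using insert by simp
    from insert.IH[OF insert.prems(1) this, of a]
    obtain c where "\<exists>i\<in>I. c i \<noteq> 0" "\<forall>j\<in>J. (\<Sum>i\<in>I. c i * a i j) = 0" by blast
    then show ?thesis using True by (intro exI[of _ c]) auto
  next
    case False
    then obtain i0 where i0: "i0 \<in> I" "a i0 j \<noteq> 0" by blast
    define I' where "I' = I - {i0}"
    have I': "finite I'" "card J < card I'" "I = insert i0 I'" "i0 \<notin> I'"
      using insert i0 by (auto simp: I'_def)
    obtain c where c: "\<exists>i\<in>I'. c i \<noteq> 0"
      "\<forall>j'\<in>J. (\<Sum>i\<in>I'. c i * (a i0 j * a i j' - a i j * a i0 j')) = 0"
      using insert.IH[OF I'(1,2), of "\<lambda>i j'. a i0 j * a i j' - a i j * a i0 j'"] by blast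
    define d where "d i = (if i = i0 then - (\<Sum>i\<in>I'. c i * a i j) else a i0 j * c i)" for i
    have sum: "(\<Sum>i\<in>I. d i * a i j') = (\<Sum>i\<in>I'. c i * (a i0 j * a i j' - a i j * a i0 j'))" for j'
    proof -
      have "(\<Sum>i\<in>I'. d i * a i j') = (\<Sum>i\<in>I'. a i0 j * c i * a i j')"
        using I'(4) by (intro sum.cong) (auto simp: d_def)
      then have "(\<Sum>i\<in>I. d i * a i j') = - (\<Sum>i\<in>I'. c i * a i j) * a i0 j' + (\<Sum>i\<in>I'. a i0 j * c i * a i j')"
        unfolding I'(3) using I'(1,4) by (simp add: d_def[of i0])
      then show ?thesis by (simp add: right_diff_distrib sum_subtractf sum_distrib_left mult_ac)
    qed
    show ?thesis
    proof (intro exI[of _ d] conjI ballI)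
      obtain i where "i \<in> I'" "c i \<noteq> 0" using c(1) by blast
      then show "\<exists>i\<in>I. d i \<noteq> 0" using I' i0 by (intro bexI[of _ i]) (auto simp: d_def)
      fix j' assume "j' \<in> insert j J"
      then show "(\<Sum>i\<in>I. d i * a i j') = 0" unfolding sum using c(2) by (auto simp: mult.commute)
    qed
  qed
qed

context comm_group
begin

lemma finprod_mem_subgroup:
  assumes H: "subgroup H G" and g: "\<And>i. i \<in> I \<Longrightarrow> g i \<in> H"
  shows "finprod G g I \<in> H"
proof (cases "finite I")
  case True
  then show ?thesis using g
  proof (induction I rule: finite_induct)
    case (insert i I)
    have "g \<in> I \<rightarrow> carrier G" "g i \<in> carrier G" using insert.prems subgroup.mem_carrier[OF H] by auto
    then show ?case using insert subgroup.m_closed[OF H] by simp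
  qed (simp add: subgroup.one_closed[OF H])
qed (simp add: subgroup.one_closed[OF H])

lemma finprod_int_pow:
  assumes B: "finite B" "B \<subseteq> carrier G"
  shows "(\<Otimes>b\<in>B. b [^] (x b :: int)) [^] (c :: int) = (\<Otimes>b\<in>B. b [^] (c * x b))"
  using B
proof (induction B rule: finite_induct)
  case (insert b B)
  have "(\<lambda>b. b [^] x b) \<in> B \<rightarrow> carrier G" "b [^] x b \<in> carrier G"
    "(\<lambda>b. b [^] (c * x b)) \<in> B \<rightarrow> carrier G" "b [^] (c * x b) \<in> carrier G" using insert.prems by auto
  then show ?case using insert by (simp add: int_pow_mult_distrib m_comm int_pow_pow mult.commute)
qed simp

lemma finprod_finprod_int_pow:
  assumes B: "finite B" "B \<subseteq> carrier G" and I: "finite I"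
  shows "(\<Otimes>i\<in>I. (\<Otimes>b\<in>B. b [^] (a i b :: int)) [^] (c i :: int)) = (\<Otimes>b\<in>B. b [^] (\<Sum>i\<in>I. c i * a i b))"
  using I
proof (induction I rule: finite_induct)
  case empty
  then show ?case by simp
next
  case (insert i I)
  have cl: "(\<Otimes>b\<in>B. b [^] (x b :: int)) \<in> carrier G" for x using B by (intro finprod_closed) auto
  have "(\<Otimes>i\<in>insert i I. (\<Otimes>b\<in>B. b [^] a i b) [^] c i)
      = (\<Otimes>b\<in>B. b [^] (c i * a i b)) \<otimes> (\<Otimes>b\<in>B. b [^] (\<Sum>i\<in>I. c i * a i b))"
    using insert cl by (simp add: finprod_int_pow[OF B])
  also have "\<dots> = (\<Otimes>b\<in>B. b [^] (c i * a i b) \<otimes> b [^] (\<Sum>i\<in>I. c i * a i b))"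
    using B by (intro finprod_multf[symmetric]) auto
  also have "\<dots> = (\<Otimes>b\<in>B. b [^] (\<Sum>i\<in>insert i I. c i * a i b))"
    using B insert by (intro finprod_cong') (auto simp: int_pow_mult)
  finally show ?case .
qed

text \<open>
  If \<open>g\<close> is not in \<open>B\<close>, a nontrivial relation in \<open>insert g B\<close> involves \<open>g\<close> with a nonzero exponent.
\<close>

lemma maximal_int_independent_spans:
  assumes B: "maximal_int_independent G B" "finite B" and g: "g \<in> carrier G"
  shows "\<exists>(n::int) a. n \<noteq> 0 \<and> g [^] n = (\<Otimes>b\<in>B. b [^] (a b :: int))"
proof -
  have ind: "B \<subseteq> carrier G" "\<And>A (c :: 'a \<Rightarrow> int). finite A \<Longrightarrow> A \<subseteq> B \<Longrightarrow> (\<Otimes>b\<in>A. b [^] c b) = \<one> \<Longrightarrow> \<forall>b\<in>A. c b = 0"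
    using B(1) unfolding maximal_int_independent_def int_independent_def by blast+
  show ?thesis
  proof (cases "g \<in> B")
    case True
    have "(\<Otimes>b\<in>B. b [^] (if b = g then 1 else 0 :: int)) = (\<Otimes>b\<in>B. if g = b then b else \<one>)"
      using ind(1) by (intro finprod_cong') auto
    also have "\<dots> = g" using True B(2) ind(1) by (intro finprod_singleton) auto
    finally show ?thesis using g by (intro exI[of _ 1] exI[of _ "\<lambda>b. if b = g then 1 else 0"]) auto
  next
    case False
    then have "\<not> int_independent G (insert g B)"
      using B(1) unfolding maximal_int_independent_def by blast
    then obtain A and c :: "'a \<Rightarrow> int" where A: "finite A" "A \<subseteq> insert g B" "(\<Otimes>b\<in>A. b [^] c b) = \<one>"
      and nz: "\<exists>b\<in>A. c b \<noteq> 0" using ind(1) g unfolding int_independent_def by blast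
    define A' where "A' = A - {g}"
    have A': "finite A'" "A' \<subseteq> B" "g \<notin> A'" using A by (auto simp: A'_def)
    have gA: "g \<in> A" using ind(2)[OF A(1) _ A(3)] A(2) nz by blast
    then have AA: "A = insert g A'" by (auto simp: A'_def)
    have fA': "(\<lambda>b. b [^] c b) \<in> A' \<rightarrow> carrier G" using A' ind(1) by auto
    have rel: "g [^] c g \<otimes> (\<Otimes>b\<in>A'. b [^] c b) = \<one>"
      using A(3) A' g fA' unfolding AA by simp
    have "c g \<noteq> 0"
    proof
      assume "c g = 0"
      then have "(\<Otimes>b\<in>A'. b [^] c b) = \<one>" using rel finprod_closed[OF fA'] by simp
      then show False using ind(2)[OF A'(1,2)] nz \<open>c g = 0\<close> unfolding AA by auto
    qed
    moreover have "g [^] c g = (\<Otimes>b\<in>B. b [^] (if b \<in> A' then - c b else 0))"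
    proof -
      have "g [^] c g = inv (\<Otimes>b\<in>A'. b [^] c b)"
        using rel finprod_closed[OF fA'] g by (intro inv_equality[symmetric]) auto
      also have "\<dots> = (\<Otimes>b\<in>A'. b [^] c b) [^] (-1 :: int)"
        using finprod_closed[OF fA'] by (simp add: int_pow_neg)
      also have "\<dots> = (\<Otimes>b\<in>A'. b [^] (- c b))" using A' ind(1) by (subst finprod_int_pow) auto
      also have "\<dots> = (\<Otimes>b\<in>A'. b [^] (if b \<in> A' then - c b else 0))"
        using A' ind(1) by (intro finprod_cong') auto
      also have "\<dots> = (\<Otimes>b\<in>B. b [^] (if b \<in> A' then - c b else 0))"
        using A' ind(1) B(2) by (intro finprod_mono_neutral_cong_left) auto
      finally show ?thesis .
    qed
    ultimately show ?thesis by (intro exI[of _ "c g"] exI[of _ "\<lambda>b. if b \<in> A' then - c b else 0"]) simp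
  qed
qed

text \<open>
  Up to nonzero powers the elements \<open>f 0\<close>, \<dots>, \<open>f (card B)\<close> are products of powers of the \<open>card B\<close>
  elements of \<open>B\<close>, so the exponents of a relation between them solve a system with fewer equations
  than unknowns.
\<close>

lemma exceeding_card_imp_dependent:
  assumes B: "maximal_int_independent G B" "finite B" and f: "\<And>i::nat. f i \<in> carrier G"
  shows "\<exists>c. (\<exists>i\<le>card B. c i \<noteq> 0) \<and> (\<Otimes>i\<in>{..card B}. f i [^] (c i :: int)) = \<one>"
proof -
  have Bc: "B \<subseteq> carrier G" using B unfolding maximal_int_independent_def int_independent_def by blast
  have "\<forall>i. \<exists>n a. n \<noteq> 0 \<and> f i [^] (n::int) = (\<Otimes>b\<in>B. b [^] (a b :: int))"
    using maximal_int_independent_spans[OF B f] by blast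
  then obtain n a where na: "\<And>i. n i \<noteq> 0" "\<And>i. f i [^] (n i :: int) = (\<Otimes>b\<in>B. b [^] (a i b :: int))" by metis
  obtain c where c: "\<exists>i\<in>{..card B}. c i \<noteq> 0" "\<forall>b\<in>B. (\<Sum>i\<in>{..card B}. c i * a i b) = 0"
    using homogeneous_int_system[OF B(2), of "{..card B}" a] by auto
  have "(\<Otimes>i\<in>{..card B}. f i [^] (n i * c i)) = (\<Otimes>i\<in>{..card B}. (\<Otimes>b\<in>B. b [^] a i b) [^] c i)"
    using f Bc by (intro finprod_cong') (auto simp flip: na(2) simp: int_pow_pow)
  also have "\<dots> = (\<Otimes>b\<in>B. b [^] (\<Sum>i\<in>{..card B}. c i * a i b))"
    by (rule finprod_finprod_int_pow[OF B(2) Bc]) simp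
  also have "\<dots> = (\<Otimes>b\<in>B. \<one>)" using c(2) by (intro finprod_cong') auto
  also have "\<dots> = \<one>" by simp
  finally show ?thesis using c(1) na(1) by (intro exI[of _ "\<lambda>i. n i * c i"]) auto
qed

lemma exists_maximal_int_independent: "\<exists>B. maximal_int_independent G B"
proof -
  have "\<exists>B\<in>Collect (int_independent G). \<forall>C\<in>Collect (int_independent G). B \<subseteq> C \<longrightarrow> C = B"
  proof (rule subset_Zorn_nonempty)
    have "int_independent G {}" by (auto simp: int_independent_def)
    then show "Collect (int_independent G) \<noteq> {}" by blast
    fix Ch assume ne: "Ch \<noteq> {}" and ch: "subset.chain (Collect (int_independent G)) Ch"
    have "int_independent G (\<Union>Ch)"
      unfolding int_independent_def
    proof (intro conjI allI impI)
      have "int_independent G B" if "B \<in> Ch" for B using ch that by (auto simp: subset.chain_def)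
      then have "B \<subseteq> carrier G" if "B \<in> Ch" for B using that unfolding int_independent_def by blast
      then show "\<Union>Ch \<subseteq> carrier G" by blast
      fix A and c :: "'a \<Rightarrow> int"
      assume A: "finite A" "A \<subseteq> \<Union>Ch" "(\<Otimes>b\<in>A. b [^] c b) = \<one>"
      obtain B where "B \<in> Ch" "A \<subseteq> B" using finite_subset_Union_chain[OF A(1,2) ne ch] .
      then show "\<forall>b\<in>A. c b = 0" using A ch by (auto simp: subset.chain_def int_independent_def)
    qed
    then show "\<Union>Ch \<in> Collect (int_independent G)" by simp
  qed
  then show ?thesis unfolding maximal_int_independent_def by blast
qed

lemma infinite_rankI:
  assumes f: "\<And>i::nat. f i \<in> carrier G"
    and ind: "\<And>n (c :: nat \<Rightarrow> int) j. (\<Otimes>i\<in>{..n}. f i [^] c i) = \<one> \<Longrightarrow> j \<le> n \<Longrightarrow> c j = 0"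
  shows "infinite_rank G"
  unfolding infinite_rank_def
proof (intro conjI allI impI exists_maximal_int_independent)
  fix B assume B: "maximal_int_independent G B"
  show "infinite B"
  proof
    assume "finite B"
    from exceeding_card_imp_dependent[OF B this, of f, OF f]
    obtain c :: "nat \<Rightarrow> int" where c: "(\<exists>i\<le>card B. c i \<noteq> 0) \<and> (\<Otimes>i\<in>{..card B}. f i [^] c i) = \<one>"
      by (rule exE)
    then show False using ind[OF conjunct2[OF c]] by blast
  qed
qed

end

lemma torsion_freeD:
  assumes "torsion_free_group (unit_group R)" "x \<in> carrier R" "x \<noteq> \<zero>\<^bsub>R\<^esub>" "n > 0" "x [^]\<^bsub>R\<^esub> (n::nat) = \<one>\<^bsub>R\<^esub>"
  shows "x = \<one>\<^bsub>R\<^esub>"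
  using assms unfolding torsion_free_group_def by (auto simp: Multiplicative_Group.nat_pow_mult_of)

context char2_field
begin

lemma algebraic_over_prime_field_imp_torsion:
  assumes x: "x \<in> carrier R" "x \<noteq> \<zero>" "(algebraic over {\<zero>, \<one>}) x"
  shows "\<exists>n>0. x [^] (n::nat) = \<one>"
proof -
  define E where "E = simple_extension {\<zero>, \<one>} x"
  note P = prime_field
  have S: "subring E R" unfolding E_def using simple_extension_is_subring[OF subfieldE(1)[OF P] x(1)] .
  have "finite_dimension {\<zero>, \<one>} E" unfolding E_def using finite_dimension_simple_extension[OF P x(1)] x(3) by simp
  then have fin: "finite E" using finite_if_finite_dimension[OF P] by simp
  have "x [^] (n::nat) \<in> E" for n
    using simple_extension_mem[OF subfieldE(1)[OF P] x(1)] subringE(3,6)[OF S] by (induction n) (auto simp: E_def)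
  then have "range (\<lambda>n::nat. x [^] n) \<subseteq> E" by auto
  then have "finite (range (\<lambda>n::nat. x [^] n))" using fin by (rule finite_subset)
  then have "\<not> inj (\<lambda>n::nat. x [^] n)" using finite_imageD by blast
  then obtain i j :: nat where "x [^] i = x [^] j" "i \<noteq> j" by (auto simp: inj_def)
  then obtain i j :: nat where ij: "x [^] i = x [^] j" "i < j" by (metis linorder_neqE_nat)
  have c: "x [^] i \<in> carrier R" "x [^] i \<noteq> \<zero>" using x nat_pow_eq_zeroD by auto
  have "x [^] i \<otimes> x [^] (j - i) = x [^] j" using ij(2) x(1) by (simp add: nat_pow_mult)
  then have "x [^] i \<otimes> x [^] (j - i) = x [^] i \<otimes> \<one>" using ij(1) c by simp
  then have "x [^] (j - i) = \<one>" using iffD1[OF m_lcancel[OF c(2,1) _ one_closed]] x by simp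
  then show ?thesis using ij by (intro exI[of _ "j - i"]) auto
qed

lemma exists_valuation_ring_at:
  assumes tf: "torsion_free_group (unit_group R)" and f: "f \<in> carrier R" "f \<noteq> \<zero>" "f \<noteq> \<one>"
  shows "\<exists>V. valuation_ring_at f V"
proof -
  note P = prime_field
  have "(transcendental over {\<zero>, \<one>}) f"
  proof (rule ccontr)
    assume "\<not> ?thesis"
    then have "(algebraic over {\<zero>, \<one>}) f" by (simp add: over_def)
    then obtain n where "n > 0" "f [^] (n::nat) = \<one>" using algebraic_over_prime_field_imp_torsion f by blast
    then show False using torsion_freeD[OF tf] f by blast
  qed
  note t = transcendental_inverse_not_mem[OF P f(1) this]
  show ?thesis
    using exists_valuation_ring[OF simple_extension_is_subring[OF subfieldE(1)[OF P] f(1)]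
        simple_extension_mem[OF subfieldE(1)[OF P] f(1)] t] by blast
qed

text \<open>
  The recursion of Sylvester's sequence. The element \<open>\<one> \<oplus> sylvester t n\<close> divides all later terms of
  the sequence; therefore elements of this form with different indices generate the unit ideal in
  every ring that contains \<open>t\<close>.
\<close>

fun sylvester :: "'a \<Rightarrow> nat \<Rightarrow> 'a" where
  "sylvester t 0 = t"
| "sylvester t (Suc n) = sylvester t n \<otimes> (\<one> \<oplus> sylvester t n)"

text \<open>
  The elements \<open>f n = \<one> \<oplus> sylvester t n\<close> are independent. Take a valuation ring \<open>V\<close> with \<open>f j\<close> in
  its maximal ideal; it exists because \<open>f j\<close>, not being a root of unity, is transcendental over the
  prime field. All other \<open>f i\<close> are units of \<open>V\<close>, so the exponent of \<open>f j\<close> in a relation has to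
  vanish.
\<close>

lemma infinite_rank_unit_group:
  assumes tf: "torsion_free_group (unit_group R)" and t: "t \<in> carrier R" "t \<noteq> \<zero>" "t \<noteq> \<one>"
  shows "infinite_rank (unit_group R)"
proof -
  interpret M: comm_group "unit_group R" by (rule comm_group_mult_of)
  define P where "P n = sylvester t n" for n
  define f where "f n = \<one> \<oplus> P n" for n
  have PS: "P (Suc n) = P n \<otimes> f n" for n by (simp add: P_def f_def)
  have P: "P n \<in> carrier R \<and> P n \<noteq> \<zero> \<and> P n \<noteq> \<one>" for n
  proof (induction n)
    case 0 then show ?case using t by (simp add: P_def)
  next
    case (Suc n)
    let ?p = "P n"
    have fn: "f n \<in> carrier R" "f n \<noteq> \<zero>" using Suc add_eq_zero_iff[of \<one> ?p] by (auto simp: f_def)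
    have "P (Suc n) \<noteq> \<one>"
    proof
      assume "P (Suc n) = \<one>"
      then have *: "?p \<otimes> (\<one> \<oplus> ?p) = \<one>" by (simp add: PS f_def)
      have "?p \<otimes> ?p = ?p \<otimes> (\<one> \<oplus> ?p) \<oplus> ?p"
        using Suc add_self[of ?p] by (simp add: r_distr a_ac) (simp add: a_assoc[symmetric])
      then have sq: "?p \<otimes> ?p = \<one> \<oplus> ?p" using * by simp
      \<comment> \<open>Thus \<open>P n\<close> would be a root of unity of order \<open>3\<close>.\<close>
      have "?p [^] (3::nat) = \<one>" using Suc * by (simp add: numeral_3_eq_3 sq m_comm)
      then show False using torsion_freeD[OF tf] Suc by (metis zero_less_numeral)
    qed
    then show ?case using Suc fn by (simp add: PS integral_iff)
  qed
  have f: "f n \<in> carrier R" "f n \<noteq> \<zero>" "f n \<noteq> \<one>" for n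
  proof -
    show "f n \<in> carrier R" using P by (simp add: f_def)
    show "f n \<noteq> \<zero>" using P[of n] add_eq_zero_iff[of \<one> "P n"] by (auto simp: f_def)
    show "f n \<noteq> \<one>"
    proof
      assume "f n = \<one>"
      then have "\<one> \<oplus> P n = \<one> \<oplus> \<zero>" by (simp add: f_def)
      then show False using P[of n] by (metis add.l_cancel one_closed zero_closed)
    qed
  qed
  show ?thesis
  proof (rule M.infinite_rankI[of f])
    show "f i \<in> carrier (unit_group R)" for i using f by simp
    fix n j and c :: "nat \<Rightarrow> int"
    assume rel: "(\<Otimes>\<^bsub>unit_group R\<^esub>i\<in>{..n}. f i [^]\<^bsub>unit_group R\<^esub> c i) = \<one>\<^bsub>unit_group R\<^esub>" and j: "j \<le> n"
    obtain V where V: "valuation_ring_at (f j) V" using exists_valuation_ring_at[OF tf f] by blast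
    note Vs = subringE[OF val_subring[OF V]]
    note fj = val_maximal_ideal[OF V]
    have Pj: "P j = \<one> \<oplus> f j" using P[of j] by (simp add: f_def a_assoc[symmetric] one_plus_one)
    have PjV: "P j \<in> V" using Pj Vs(3,7) fj(3) by simp
    \<comment> \<open>If \<open>P i\<close> had negative value, then so would \<open>P (Suc i) = P i \<otimes> (\<one> \<oplus> P i)\<close>.\<close>
    have down: "P i \<in> V" if "P (Suc i) \<in> V" for i
    proof (rule ccontr)
      assume "P i \<notin> V"
      then have iV: "inv (P i) \<in> V" using val_total[OF V, of "P i"] P by blast
      then have "inv (P i) \<otimes> P (Suc i) \<in> V" using that Vs(6) by blast
      also have "inv (P i) \<otimes> P (Suc i) = f i"
        using P[of i] f(1)[of i] nonzero_simps[of "P i"] by (simp add: PS m_assoc[symmetric])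
      finally have "\<one> \<oplus> f i \<in> V" using Vs(3,7) by simp
      then show False using \<open>P i \<notin> V\<close> P[of i] by (simp add: f_def a_assoc[symmetric] one_plus_one)
    qed
    have PV: "P i \<in> V" for i
    proof (cases "i \<le> j")
      case True
      then show ?thesis
        by (induction rule: inc_induct) (auto intro: down PjV)
    next
      case False
      then have "j \<le> i" by simp
      then show ?thesis
      proof (induction rule: dec_induct)
        case (step k)
        then show ?case using Vs(3,6,7) by (simp add: PS f_def)
      qed (rule PjV)
    qed
    have fV: "f i \<in> V" for i using PV Vs(3,7) by (simp add: f_def)
    have dvd: "\<exists>w\<in>V. P k = f i \<otimes> w" if "i < k" for i k
      using Suc_leI[OF that]
    proof (induction rule: dec_induct)
      case base
      show ?case using PV[of i] P[of i] f(1)[of i] by (intro bexI[of _ "P i"]) (auto simp: PS m_comm)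
    next
      case (step k)
      then obtain w where w: "w \<in> V" "P k = f i \<otimes> w" by blast
      then show ?case using fV[of k] Vs(6) f(1) val_carrier[OF V]
        by (intro bexI[of _ "w \<otimes> f k"]) (auto simp: PS m_assoc)
    qed
    \<comment> \<open>An earlier \<open>f i\<close> divides \<open>P j = \<one> \<oplus> f j\<close>, which is a unit. A later \<open>f i\<close> is \<open>\<one>\<close> plus a multiple of
        \<open>f j\<close>.\<close>
    have unit: "f i \<in> val_units V" if "i \<noteq> j" for i
    proof (cases "i < j")
      case True
      then obtain w where w: "w \<in> V" "P j = f i \<otimes> w" using dvd by blast
      have "\<one> \<oplus> f j \<in> val_units V" using one_plus_val_nonunit[OF V fj(3,4)] .
      then show ?thesis using val_units_mult_cancel[OF V fV w(1)] w(2) Pj by simp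
    next
      case False
      then have "j < i" using that by simp
      then obtain w where w: "w \<in> V" "P i = f j \<otimes> w" using dvd by blast
      have "f j \<otimes> w \<notin> val_units V" using val_units_mult_cancel[OF V fj(3) w(1)] fj(4) by blast
      moreover have "f j \<otimes> w \<in> V" using w fj Vs(6) by blast
      ultimately show ?thesis using one_plus_val_nonunit[OF V] w(2) by (simp add: f_def)
    qed
    have fm: "f i \<in> carrier (unit_group R)" for i using f by simp
    let ?rest = "\<Otimes>\<^bsub>unit_group R\<^esub>i\<in>{..n} - {j}. f i [^]\<^bsub>unit_group R\<^esub> c i"
    have cl: "(\<lambda>i. f i [^]\<^bsub>unit_group R\<^esub> c i) \<in> A \<rightarrow> carrier (unit_group R)" for A
      using M.int_pow_closed[OF fm] by blast
    have rest: "?rest \<in> val_units V"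
      using M.subgroup_int_pow_closed[OF subgroup_val_units[OF V] unit]
      by (intro M.finprod_mem_subgroup[OF subgroup_val_units[OF V]]) auto
    have "{..n} = insert j ({..n} - {j})" using j by auto
    then have "f j [^]\<^bsub>unit_group R\<^esub> c j \<otimes>\<^bsub>unit_group R\<^esub> ?rest = \<one>\<^bsub>unit_group R\<^esub>"
      using rel M.finprod_insert[of "{..n} - {j}" j "\<lambda>i. f i [^]\<^bsub>unit_group R\<^esub> c i"] cl M.int_pow_closed[OF fm] by simp
    then have "f j [^]\<^bsub>unit_group R\<^esub> c j = inv\<^bsub>unit_group R\<^esub> ?rest"
      using M.int_pow_closed[OF fm] M.finprod_closed[OF cl] by (intro M.inv_equality[symmetric])
    then have "f j [^]\<^bsub>unit_group R\<^esub> c j \<in> val_units V"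
      using subgroup.m_inv_closed[OF subgroup_val_units[OF V] rest] by simp
    then show "c j = 0" by (rule power_not_val_unit[OF V])
  qed
qed

end

section \<open>Embeddings into algebraically closed fields\<close>

lemma (in field) algebraic_trans:
  assumes K: "subfield K R" and M: "subfield M R" "\<And>m. m \<in> M \<Longrightarrow> (algebraic over K) m" "K \<subseteq> M"
    and z: "z \<in> carrier R" "(algebraic over M) z"
  shows "(algebraic over K) z"
proof -
  obtain p where p: "p \<in> carrier (M[X])" "p \<noteq> []" "eval p z = \<zero>"
    using algebraicE[OF subfieldE(1)[OF M(1)] z] .
  have pM: "set p \<subseteq> M" "hd p \<noteq> \<zero>" using p by (auto simp: univ_poly_carrier[symmetric] polynomial_def)
  then have pc: "set p \<subseteq> carrier R" using subfieldE(3)[OF M(1)] by blast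
  have alg: "\<And>x. x \<in> set p \<Longrightarrow> (algebraic over K) x" using pM M(2) by blast
  define N where "N = finite_extension K p"
  have N: "subfield N R" unfolding N_def by (rule finite_extension_is_subfield[OF K pc alg])
  have KN: "finite_dimension K N" unfolding N_def by (rule finite_extension_finite_dimension(1)[OF K pc alg])
  have "set p \<subseteq> N" unfolding N_def by (rule finite_extension_mem[OF subfieldE(1)[OF K] pc])
  then have "p \<in> carrier (N[X])" using p pM by (auto simp: univ_poly_carrier[symmetric] polynomial_def)
  then have zN: "(algebraic over N) z" using p by (intro algebraicI)
  define E where "E = simple_extension N z"
  have "finite_dimension N E" unfolding E_def using finite_dimension_simple_extension[OF N z(1)] zN by simp
  then have "finite_dimension K E" by (rule telescopic_base_dim(1)[OF K N KN])
  then show ?thesis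
    using finite_dimension_imp_algebraic[OF K simple_extension_is_subring[OF subfieldE(1)[OF N] z(1)]]
      simple_extension_mem[OF subfieldE(1)[OF N] z(1)] unfolding E_def by blast
qed

text \<open>
  The cycles of \<open>f\<close> on \<open>A\<close> have length at most \<open>d\<close>, so their lengths divide \<open>fact d\<close>.
\<close>

lemma funpow_fact_fixes:
  assumes A: "finite A" "card A \<le> d" and f: "f ` A \<subseteq> A" "inj_on f A" and a: "a \<in> A"
  shows "(f ^^ fact d) a = a"
proof -
  have in_A: "(f ^^ i) x \<in> A" if "x \<in> A" for i x using that f(1) by (induction i) auto
  have "\<not> inj_on (\<lambda>i. (f ^^ i) a) {0..card A}"
  proof
    assume "inj_on (\<lambda>i. (f ^^ i) a) {0..card A}"
    then have "card {0..card A} \<le> card A"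
      using in_A[OF a] A(1) by (intro card_inj_on_le[where f = "\<lambda>i. (f ^^ i) a"]) auto
    then show False by simp
  qed
  then obtain i j where "i \<in> {0..card A}" "j \<in> {0..card A}" "(f ^^ i) a = (f ^^ j) a" "i \<noteq> j"
    unfolding inj_on_def by blast
  then obtain i j where ij: "(f ^^ i) a = (f ^^ j) a" "i < j" "j \<le> card A"
    by (metis atLeastAtMost_iff linorder_neqE_nat)
  have inj: "x = y" if "(f ^^ i) x = (f ^^ i) y" "x \<in> A" "y \<in> A" for x y i
    using that
  proof (induction i)
    case (Suc i)
    then have "(f ^^ i) x = (f ^^ i) y" using inj_onD[OF f(2)] in_A by simp
    then show ?case using Suc by blast
  qed simp
  define n where "n = j - i"
  have "j = i + n" using ij by (simp add: n_def)
  then have "(f ^^ i) a = (f ^^ i) ((f ^^ n) a)" using ij(1) by (simp add: funpow_add)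
  then have per: "(f ^^ n) a = a" using inj[of i] a in_A[OF a] by metis
  have "n dvd fact d" using ij A(2) by (intro dvd_fact) (auto simp: n_def)
  then obtain k where k: "fact d = k * n" by (metis dvdE mult.commute)
  have "(f ^^ (k * n)) a = a" by (induction k) (auto simp: funpow_add per)
  then show ?thesis by (simp add: k)
qed

definition (in ring) embedding_on :: "'a set \<Rightarrow> ('a \<Rightarrow> 'a) \<Rightarrow> bool"
  where "embedding_on E h \<longleftrightarrow> (\<forall>x\<in>E. h x \<in> carrier R) \<and> h \<one> = \<one> \<and>
    (\<forall>x\<in>E. \<forall>y\<in>E. h (x \<oplus> y) = h x \<oplus> h y \<and> h (x \<otimes> y) = h x \<otimes> h y)"

context field
begin

context
  fixes E h assumes E: "subfield E R" and h: "embedding_on E h"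
begin

lemma embedding_closed: "x \<in> E \<Longrightarrow> h x \<in> carrier R"
  and embedding_add: "x \<in> E \<Longrightarrow> y \<in> E \<Longrightarrow> h (x \<oplus> y) = h x \<oplus> h y"
  and embedding_mult: "x \<in> E \<Longrightarrow> y \<in> E \<Longrightarrow> h (x \<otimes> y) = h x \<otimes> h y"
  and embedding_one: "h \<one> = \<one>"
  using h by (auto simp: embedding_on_def)

lemma embedding_zero: "h \<zero> = \<zero>"
proof -
  have z: "\<zero> \<in> E" using subringE(2)[OF subfieldE(1)[OF E]] .
  have "h \<zero> \<oplus> h \<zero> = h \<zero> \<oplus> \<zero>" using embedding_add[OF z z] embedding_closed[OF z] by simp
  then show ?thesis using embedding_closed[OF z] by (metis add.l_cancel zero_closed)
qed

lemma embedding_nonzero: "x \<in> E \<Longrightarrow> x \<noteq> \<zero> \<Longrightarrow> h x \<noteq> \<zero>"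
proof
  assume x: "x \<in> E" "x \<noteq> \<zero>" "h x = \<zero>"
  have xc: "x \<in> carrier R" using x subfieldE(3)[OF E] by blast
  have ix: "inv x \<in> E" using subfield_m_inv(1)[OF E] x by auto
  have "\<one> = h (x \<otimes> inv x)" using nonzero_simps(3)[OF xc x(2)] embedding_one by simp
  also have "\<dots> = \<zero>" using embedding_mult[OF x(1) ix] x(3) embedding_closed[OF ix] by simp
  finally show False by simp
qed

lemma embedding_uminus: assumes "x \<in> E" shows "h (\<ominus> x) = \<ominus> h x"
proof -
  have mx: "\<ominus> x \<in> E" using subringE(5)[OF subfieldE(1)[OF E]] assms .
  have xc: "x \<in> carrier R" using assms subfieldE(3)[OF E] by blast
  have "h (\<ominus> x) \<oplus> h x = \<zero>"
    using embedding_add[OF mx assms] embedding_zero xc by (simp add: l_neg)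
  then show ?thesis using embedding_closed mx assms by (simp add: minus_equality)
qed

lemma embedding_inj: "x \<in> E \<Longrightarrow> y \<in> E \<Longrightarrow> h x = h y \<Longrightarrow> x = y"
proof (rule ccontr)
  assume xy: "x \<in> E" "y \<in> E" "h x = h y" "x \<noteq> y"
  note Es = subringE[OF subfieldE(1)[OF E]]
  have "x \<ominus> y \<in> E" using xy Es(5,7) by (simp add: a_minus_def)
  moreover have "x \<in> carrier R" "y \<in> carrier R" using xy subfieldE(3)[OF E] by auto
  then have "x \<ominus> y \<noteq> \<zero>" using xy r_right_minus_eq by blast
  ultimately have "h (x \<ominus> y) \<noteq> \<zero>" by (rule embedding_nonzero)
  moreover have "h (x \<ominus> y) = h x \<oplus> \<ominus> h y"
    using embedding_add[of x "\<ominus> y"] embedding_uminus xy Es(5) by (simp add: a_minus_def)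
  ultimately show False using xy embedding_closed by (simp add: r_neg)
qed

lemma embedding_pow: "x \<in> E \<Longrightarrow> x [^] (n::nat) \<in> E \<and> h (x [^] n) = h x [^] n"
  using subringE(3,6)[OF subfieldE(1)[OF E]] embedding_one embedding_mult by (induction n) auto

lemma embedding_finsum:
  assumes "finite A" "\<And>i. i \<in> A \<Longrightarrow> g i \<in> E"
  shows "finsum R g A \<in> E \<and> h (finsum R g A) = finsum R (\<lambda>i. h (g i)) A"
  using assms
proof (induction A rule: finite_induct)
  case empty then show ?case using embedding_zero subringE(2)[OF subfieldE(1)[OF E]] by simp
next
  case (insert a A)
  have "g \<in> A \<rightarrow> carrier R" "g a \<in> carrier R" "(\<lambda>i. h (g i)) \<in> A \<rightarrow> carrier R" "h (g a) \<in> carrier R"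
    using insert.prems embedding_closed subfieldE(3)[OF E] by auto
  then show ?case using insert subringE(7)[OF subfieldE(1)[OF E]] embedding_add by simp
qed

lemma embedding_coeff: "set p \<subseteq> E \<Longrightarrow> coeff p i \<in> E \<and> coeff (map h p) i = h (coeff p i)"
  using embedding_zero subringE(2)[OF subfieldE(1)[OF E]] by (induction p) auto

lemma embedding_poly:
  assumes "p \<in> carrier (E[X])" shows "map h p \<in> carrier (poly_ring R)"
proof (cases p)
  case (Cons a q)
  then show ?thesis using assms embedding_closed embedding_nonzero[of a]
    by (auto simp: univ_poly_carrier[symmetric] polynomial_def)
qed (simp add: univ_poly_carrier[symmetric] polynomial_def)

lemma embedding_poly_hom:
  assumes p: "p \<in> carrier (E[X])" and q: "q \<in> carrier (E[X])"
  shows "map h (poly_add p q) = poly_add (map h p) (map h q)"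
    "map h (poly_mult p q) = poly_mult (map h p) (map h q)"
proof -
  have pE: "set p \<subseteq> E" "set q \<subseteq> E" using p q by (auto simp: univ_poly_carrier[symmetric] polynomial_def)
  then have pc: "set p \<subseteq> carrier R" "set q \<subseteq> carrier R" using subfieldE(3)[OF E] by auto
  have hc: "set (map h p) \<subseteq> carrier R" "set (map h q) \<subseteq> carrier R" using pE embedding_closed by auto
  have pq: "polynomial E p" "polynomial E q" using p q by (simp_all add: univ_poly_carrier)
  have pp: "poly_add p q \<in> carrier (E[X])" "poly_mult p q \<in> carrier (E[X])"
    using poly_add_closed[OF subfieldE(1)[OF E] pq] poly_mult_closed[OF subfieldE(1)[OF E] pq]
    by (simp_all add: univ_poly_carrier)
  then have ppE: "set (poly_add p q) \<subseteq> E" "set (poly_mult p q) \<subseteq> E"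
    by (auto simp: univ_poly_carrier[symmetric] polynomial_def)
  have hp: "polynomial (carrier R) (map h p)" "polynomial (carrier R) (map h q)"
    using embedding_poly p q by (auto simp: univ_poly_carrier)
  note cs = carrier_is_subring
  show "map h (poly_add p q) = poly_add (map h p) (map h q)"
  proof (subst coeff_iff_polynomial_cond)
    show "polynomial (carrier R) (map h (poly_add p q))" using embedding_poly[OF pp(1)] by (simp add: univ_poly_carrier)
    show "polynomial (carrier R) (poly_add (map h p) (map h q))" using poly_add_closed[OF cs] hp by blast
    show "coeff (map h (poly_add p q)) = coeff (poly_add (map h p) (map h q))"
    proof
      fix i
      have "coeff (map h (poly_add p q)) i = h (coeff p i \<oplus> coeff q i)"
        using embedding_coeff[OF ppE(1)] poly_add_coeff[OF pc] by simp
      also have "\<dots> = coeff (poly_add (map h p) (map h q)) i"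
        using embedding_coeff[OF pE(1)] embedding_coeff[OF pE(2)] embedding_add poly_add_coeff[OF hc] by simp
      finally show "coeff (map h (poly_add p q)) i = coeff (poly_add (map h p) (map h q)) i" .
    qed
  qed
  show "map h (poly_mult p q) = poly_mult (map h p) (map h q)"
  proof (subst coeff_iff_polynomial_cond)
    show "polynomial (carrier R) (map h (poly_mult p q))" using embedding_poly[OF pp(2)] by (simp add: univ_poly_carrier)
    show "polynomial (carrier R) (poly_mult (map h p) (map h q))" using poly_mult_closed[OF cs] hp by blast
    show "coeff (map h (poly_mult p q)) = coeff (poly_mult (map h p) (map h q))"
    proof
      fix i
      have m: "coeff p k \<otimes> coeff q (i - k) \<in> E" for k
        using embedding_coeff[OF pE(1)] embedding_coeff[OF pE(2)] subringE(6)[OF subfieldE(1)[OF E]] by blast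
      have "coeff (map h (poly_mult p q)) i = h (\<Oplus>k\<in>{..i}. coeff p k \<otimes> coeff q (i - k))"
        using embedding_coeff[OF ppE(2)] poly_mult_coeff[OF pc] by simp
      also have "\<dots> = (\<Oplus>k\<in>{..i}. h (coeff p k \<otimes> coeff q (i - k)))"
        using embedding_finsum[of "{..i}" "\<lambda>k. coeff p k \<otimes> coeff q (i - k)"] m by simp
      also have "\<dots> = (\<Oplus>k\<in>{..i}. coeff (map h p) k \<otimes> coeff (map h q) (i - k))"
        using embedding_coeff[OF pE(1)] embedding_coeff[OF pE(2)] embedding_mult by simp
      also have "\<dots> = coeff (poly_mult (map h p) (map h q)) i" using poly_mult_coeff[OF hc] by simp
      finally show "coeff (map h (poly_mult p q)) i = coeff (poly_mult (map h p) (map h q)) i" .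
    qed
  qed
qed

lemma embedding_eval:
  assumes "set p \<subseteq> E" "x \<in> E" shows "eval p x \<in> E \<and> h (eval p x) = eval (map h p) (h x)"
  using assms(1)
proof (induction p)
  case Nil then show ?case using embedding_zero subringE(2)[OF subfieldE(1)[OF E]] by simp
next
  case (Cons a p)
  then show ?case using assms(2) embedding_pow[OF assms(2)] embedding_mult embedding_add
      subringE(6,7)[OF subfieldE(1)[OF E]] by simp
qed

text \<open>
  An element \<open>eval p a\<close> is sent to the value at \<open>a'\<close> of the image of \<open>p\<close>. This does not depend on
  \<open>p\<close>, since the polynomials that vanish at \<open>a\<close> are multiples of \<open>Irr E a\<close>.
\<close>

lemma extend_embedding_simple:
  assumes a: "a \<in> carrier R" "(algebraic over E) a"
    and a': "a' \<in> carrier R" "eval (map h (Irr E a)) a' = \<zero>"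
  shows "\<exists>h'. embedding_on (simple_extension E a) h' \<and> (\<forall>x\<in>E. h' x = h x) \<and> h' a = a'"
proof -
  note Es = subfieldE(1)[OF E]
  define \<psi> where "\<psi> p = eval (map h p) a'" for p
  have hc: "set (map h p) \<subseteq> carrier R" if "p \<in> carrier (E[X])" for p
    using embedding_poly[OF that] by (auto simp: univ_poly_carrier[symmetric] polynomial_def)
  have closed: "\<psi> p \<in> carrier R" if "p \<in> carrier (E[X])" for p
    unfolding \<psi>_def using eval_in_carrier[OF hc[OF that] a'(1)] .
  have add: "\<psi> (p \<oplus>\<^bsub>E[X]\<^esub> q) = \<psi> p \<oplus> \<psi> q" if "p \<in> carrier (E[X])" "q \<in> carrier (E[X])" for p q
    using that embedding_poly_hom(1)[OF that] eval_poly_add[OF hc hc a'(1)] by (simp add: \<psi>_def univ_poly_add)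
  have mult: "\<psi> (p \<otimes>\<^bsub>E[X]\<^esub> q) = \<psi> p \<otimes> \<psi> q" if "p \<in> carrier (E[X])" "q \<in> carrier (E[X])" for p q
    using that embedding_poly_hom(2)[OF that] eval_poly_mult[OF hc hc a'(1)] by (simp add: \<psi>_def univ_poly_mult)
  interpret UP: domain "E[X]" by (rule univ_poly_is_domain[OF Es])
  note ev = ring_hom_memE[OF eval_is_hom[OF Es a(1)]]
  have wd: "\<psi> p = \<psi> q" if pq: "p \<in> carrier (E[X])" "q \<in> carrier (E[X])" and eq: "eval p a = eval q a" for p q
  proof -
    define d where "d = p \<ominus>\<^bsub>E[X]\<^esub> q"
    have dc: "d \<in> carrier (E[X])" using pq by (simp add: d_def)
    have pd: "p = d \<oplus>\<^bsub>E[X]\<^esub> q" using pq by (simp add: d_def a_minus_def UP.a_assoc UP.l_neg)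
    have "eval p a = eval d a \<oplus> eval q a" using ev(3)[OF dc pq(2)] pd by simp
    then have "eval d a \<oplus> eval q a = \<zero> \<oplus> eval q a" using eq ev(1)[OF pq(2)] by simp
    then have "eval d a = \<zero>" using ev(1)[OF dc] ev(1)[OF pq(2)] by (metis add.r_cancel zero_closed)
    then have "Irr E a pdivides d" using Irr_minimal[OF E a dc] by blast
    then have "Irr E a divides\<^bsub>E[X]\<^esub> d"
      using pdivides_iff[OF E, of "Irr E a" d] IrrE(1)[OF E a] dc by (simp add: univ_poly_carrier)
    then obtain r where r: "r \<in> carrier (E[X])" "d = Irr E a \<otimes>\<^bsub>E[X]\<^esub> r" by (auto simp: factor_def)
    then have "\<psi> d = \<zero>" using mult[OF IrrE(1)[OF E a] r(1)] a'(2) closed[OF r(1)] by (simp add: \<psi>_def)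
    then show ?thesis using pd add[OF dc pq(2)] closed[OF pq(2)] by simp
  qed
  define h' where "h' y = \<psi> (SOME p. p \<in> carrier (E[X]) \<and> eval p a = y)" for y
  have h': "h' (eval p a) = \<psi> p" if "p \<in> carrier (E[X])" for p
  proof -
    have "(SOME q. q \<in> carrier (E[X]) \<and> eval q a = eval p a) \<in> carrier (E[X]) \<and>
        eval (SOME q. q \<in> carrier (E[X]) \<and> eval q a = eval p a) a = eval p a"
      by (rule someI[of _ p]) (use that in simp)
    then show ?thesis unfolding h'_def using wd that by blast
  qed
  have img: "\<exists>p\<in>carrier (E[X]). y = eval p a" if "y \<in> simple_extension E a" for y
    using that simple_extension_as_eval_img[OF subfieldE(3)[OF E] a(1)] by auto
  have const: "h' c = h c" if "c \<in> E" for c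
  proof (cases "c = \<zero>")
    case True
    then show ?thesis
      using h'[of "[]"] embedding_zero by (simp add: \<psi>_def univ_poly_carrier[symmetric] polynomial_def)
  next
    case False
    then have p: "[c] \<in> carrier (E[X])" using that by (auto simp: univ_poly_carrier[symmetric] polynomial_def)
    have "c \<in> carrier R" "h c \<in> carrier R" using that subfieldE(3)[OF E] embedding_closed by auto
    then show ?thesis using h'[OF p] by (simp add: \<psi>_def)
  qed
  have "embedding_on (simple_extension E a) h'"
    unfolding embedding_on_def
  proof (intro conjI ballI)
    show "h' x \<in> carrier R" if "x \<in> simple_extension E a" for x using img[OF that] h' closed by auto
    show "h' \<one> = \<one>" using const[OF subringE(3)[OF Es]] embedding_one by simp
    fix x y assume xy: "x \<in> simple_extension E a" "y \<in> simple_extension E a"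
    obtain p q where pq: "p \<in> carrier (E[X])" "x = eval p a" "q \<in> carrier (E[X])" "y = eval q a"
      using img[OF xy(1)] img[OF xy(2)] by blast
    show "h' (x \<oplus> y) = h' x \<oplus> h' y"
      using h'[of "p \<oplus>\<^bsub>E[X]\<^esub> q"] ev(3)[OF pq(1,3)] add[OF pq(1,3)] h' pq by simp
    show "h' (x \<otimes> y) = h' x \<otimes> h' y"
      using h'[of "p \<otimes>\<^bsub>E[X]\<^esub> q"] ev(2)[OF pq(1,3)] mult[OF pq(1,3)] h' pq by simp
  qed
  moreover have "h' a = a'"
  proof -
    have p: "[\<one>, \<zero>] \<in> carrier (E[X])" using subringE(2,3)[OF Es] by (auto simp: univ_poly_carrier[symmetric] polynomial_def)
    have "eval [\<one>, \<zero>] a = a" "\<psi> [\<one>, \<zero>] = a'"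
      using a a' embedding_one embedding_zero by (auto simp: \<psi>_def)
    then show ?thesis using h'[OF p] by simp
  qed
  ultimately show ?thesis using const by blast
qed

end
end

context algebraically_closed
begin

lemma exists_root_if_degree_pos:
  assumes p: "p \<in> carrier (poly_ring L)" "degree p > 0"
  shows "\<exists>x\<in>carrier L. eval p x = \<zero>"
proof -
  have "size (roots p) > 0" using roots_over_carrier[OF p(1)] p(2) by (simp add: splitted_def)
  then obtain x where "x \<in># roots p" by (metis less_irrefl multiset_nonemptyE size_empty)
  then show ?thesis using roots_mem_iff_is_root[OF p(1)] by (auto simp: is_root_def)
qed

text \<open>
  By Zorn's lemma there is a maximal extension; partial extensions are ordered by inclusion of their
  graphs. The domain of a maximal one is everything, because a minimal polynomial over a smaller
  domain has an image with a root in \<open>L\<close>.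
\<close>

lemma extend_embedding:
  assumes E: "subfield E L" and h: "embedding_on E h" and alg: "\<And>x. x \<in> carrier L \<Longrightarrow> (algebraic over E) x"
  shows "\<exists>\<tau>. embedding_on (carrier L) \<tau> \<and> (\<forall>x\<in>E. \<tau> x = h x)"
proof -
  define graph where "graph D g = (\<lambda>x. (x, g x)) ` D" for D and g :: "'a \<Rightarrow> 'a"
  define ok where "ok D g \<longleftrightarrow> subfield D L \<and> E \<subseteq> D \<and> embedding_on D g \<and> (\<forall>x\<in>E. g x = h x)" for D g
  define Fam where "Fam = {graph D g | D g. ok D g}"
  have "\<exists>M\<in>Fam. \<forall>N\<in>Fam. M \<subseteq> N \<longrightarrow> N = M"
  proof (rule subset_Zorn_nonempty)
    have "ok E h" using E h by (auto simp: ok_def)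
    then show "Fam \<noteq> {}" by (auto simp: Fam_def)
    fix Ch assume ne: "Ch \<noteq> {}" and ch: "subset.chain Fam Ch"
    define D where "D = fst ` \<Union>Ch"
    define g where "g x = (THE y. (x, y) \<in> \<Union>Ch)" for x
    have mem: "\<exists>D g. ok D g \<and> G = graph D g" if "G \<in> Ch" for G
      using ch that by (auto simp: subset.chain_def Fam_def)
    have two: "\<exists>G\<in>Ch. p \<in> G \<and> q \<in> G" if "p \<in> \<Union>Ch" "q \<in> \<Union>Ch" for p q
    proof -
      from that obtain A B where AB: "A \<in> Ch" "p \<in> A" "B \<in> Ch" "q \<in> B" by blast
      then have "A \<subseteq> B \<or> B \<subseteq> A" using ch by (auto simp: subset_chain_def)
      then show ?thesis using AB by blast
    qed
    have g: "g x = y" if xy: "(x, y) \<in> \<Union>Ch" for x y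
      unfolding g_def
    proof (rule the_equality)
      show "(x, y) \<in> \<Union>Ch" by (rule xy)
      fix y' assume "(x, y') \<in> \<Union>Ch"
      from two[OF xy this] obtain G where G: "G \<in> Ch" "(x, y) \<in> G" "(x, y') \<in> G" by blast
      obtain D' g' where "G = graph D' g'" using mem[OF G(1)] by blast
      then show "y' = y" using G by (auto simp: graph_def)
    qed
    have sub: "D' \<subseteq> D \<and> (\<forall>x\<in>D'. g x = g' x)" if "graph D' g' \<subseteq> \<Union>Ch" for D' g'
    proof -
      have "(x, g' x) \<in> \<Union>Ch" if "x \<in> D'" for x
        using \<open>graph D' g' \<subseteq> \<Union>Ch\<close> that unfolding graph_def by blast
      then show ?thesis using g unfolding D_def by force
    qed
    have pts: "\<exists>D' g'. ok D' g' \<and> x \<in> D' \<and> y \<in> D' \<and> D' \<subseteq> D \<and> (\<forall>x\<in>D'. g x = g' x)"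
      if xy: "x \<in> D" "y \<in> D" for x y
    proof -
      have "\<exists>u'. (u, u') \<in> \<Union>Ch" if "u \<in> D" for u using that by (force simp: D_def)
      then obtain x' y' where "(x, x') \<in> \<Union>Ch" "(y, y') \<in> \<Union>Ch" using xy by meson
      from two[OF this] obtain G where G: "G \<in> Ch" "(x, x') \<in> G" "(y, y') \<in> G" by blast
      obtain D' g' where D': "ok D' g'" "G = graph D' g'" using mem[OF G(1)] by blast
      have "x \<in> D'" "y \<in> D'" using G D' by (auto simp: graph_def)
      then show ?thesis using D' sub[of D' g'] G(1) by blast
    qed
    have oks: "subfield D' L" "E \<subseteq> D'" "embedding_on D' g'" "\<forall>x\<in>E. g' x = h x" if "ok D' g'" for D' g'
      using that by (auto simp: ok_def)
    have ED: "E \<subseteq> D \<and> (\<forall>x\<in>E. g x = h x)"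
    proof -
      obtain G where "G \<in> Ch" using ne by blast
      then obtain D' g' where D': "ok D' g'" "G = graph D' g'" using mem by blast
      then have "D' \<subseteq> D \<and> (\<forall>x\<in>D'. g x = g' x)" using sub[of D' g'] \<open>G \<in> Ch\<close> by blast
      then show ?thesis using oks(2,4)[OF D'(1)] by auto
    qed
    have "subfield D L"
    proof (rule subfieldI')
      show "subring D L"
      proof (rule subringI)
        show "D \<subseteq> carrier L"
        proof
          fix x assume x: "x \<in> D"
          from pts[OF x x] obtain D' g' where D': "ok D' g'" "x \<in> D'" by blast
          show "x \<in> carrier L" using subfieldE(3)[OF oks(1)[OF D'(1)]] D'(2) by blast
        qed
        show "\<one> \<in> D" using ED subringE(3)[OF subfieldE(1)[OF E]] by blast
        show "\<ominus> x \<in> D" if x: "x \<in> D" for x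
        proof -
          from pts[OF x x] obtain D' g' where D': "ok D' g'" "x \<in> D'" "D' \<subseteq> D" by blast
          show ?thesis using subringE(5)[OF subfieldE(1)[OF oks(1)[OF D'(1)]] D'(2)] D'(3) by blast
        qed
        fix x y assume xy: "x \<in> D" "y \<in> D"
        from pts[OF xy] obtain D' g' where D': "ok D' g'" "x \<in> D'" "y \<in> D'" "D' \<subseteq> D" by blast
        show "x \<otimes> y \<in> D" using subringE(6)[OF subfieldE(1)[OF oks(1)[OF D'(1)]] D'(2,3)] D'(4) by blast
        show "x \<oplus> y \<in> D" using subringE(7)[OF subfieldE(1)[OF oks(1)[OF D'(1)]] D'(2,3)] D'(4) by blast
      qed
      fix x assume x: "x \<in> D - {\<zero>}"
      then obtain D' g' where D': "ok D' g'" "x \<in> D'" "D' \<subseteq> D" using pts[of x x] by blast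
      then show "inv x \<in> D" using subfield_m_inv(1)[OF oks(1)[OF D'(1)], of x] x by blast
    qed
    moreover have "embedding_on D g"
      unfolding embedding_on_def
    proof (intro conjI ballI)
      show "g x \<in> carrier L" if x: "x \<in> D" for x
      proof -
        from pts[OF x x] obtain D' g' where "ok D' g'" "x \<in> D'" "g x = g' x" by blast
        then show ?thesis using oks(3) by (auto simp: embedding_on_def)
      qed
      have "\<one> \<in> E" using subringE(3)[OF subfieldE(1)[OF E]] .
      then show "g \<one> = \<one>" using ED h by (auto simp: embedding_on_def)
      fix x y assume xy: "x \<in> D" "y \<in> D"
      from pts[OF xy] obtain D' g' where D': "ok D' g'" "x \<in> D'" "y \<in> D'" "\<forall>x\<in>D'. g x = g' x" by blast
      note s = subringE(6,7)[OF subfieldE(1)[OF oks(1)[OF D'(1)]] D'(2,3)]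
      show "g (x \<oplus> y) = g x \<oplus> g y" "g (x \<otimes> y) = g x \<otimes> g y"
        using oks(3)[OF D'(1)] D' s by (auto simp: embedding_on_def)
    qed
    ultimately have "ok D g" using ED by (auto simp: ok_def)
    moreover have "\<Union>Ch = graph D g"
    proof (intro subset_antisym subsetI)
      fix p assume p: "p \<in> \<Union>Ch"
      then have "(fst p, snd p) \<in> \<Union>Ch" by simp
      from g[OF this] have "p = (fst p, g (fst p))" by simp
      moreover have "fst p \<in> D" unfolding D_def using p by (rule imageI)
      ultimately show "p \<in> graph D g" unfolding graph_def by (rule image_eqI)
    next
      fix p assume "p \<in> graph D g"
      then obtain x where x: "x \<in> D" "p = (x, g x)" by (auto simp: graph_def)
      from x(1) obtain q where q: "q \<in> \<Union>Ch" "x = fst q" unfolding D_def by blast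
      then have "(x, snd q) \<in> \<Union>Ch" by simp
      from g[OF this] this show "p \<in> \<Union>Ch" using x by simp
    qed
    ultimately show "\<Union>Ch \<in> Fam" by (auto simp: Fam_def)
  qed
  then obtain M where M: "M \<in> Fam" "\<And>N. N \<in> Fam \<Longrightarrow> M \<subseteq> N \<Longrightarrow> N = M" by blast
  from M(1) obtain D g where D: "ok D g" and MD: "M = graph D g" unfolding Fam_def by blast
  have max: "graph D' g' = graph D g" if "ok D' g'" "graph D g \<subseteq> graph D' g'" for D' g'
  proof -
    have "graph D' g' \<in> Fam" using that(1) unfolding Fam_def by blast
    then show ?thesis using M(2) that(2) unfolding MD by blast
  qed
  have D': "subfield D L" "E \<subseteq> D" "embedding_on D g" "\<forall>x\<in>E. g x = h x" using D by (auto simp: ok_def)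
  have "D = carrier L"
  proof (rule ccontr)
    assume "D \<noteq> carrier L"
    then obtain a where a: "a \<in> carrier L" "a \<notin> D" using subfieldE(3)[OF D'(1)] by blast
    have aD: "(algebraic over D) a" using algebraic_mono[OF D'(2) alg[OF a(1)]] .
    note I = IrrE[OF D'(1) a(1) aD]
    have mp: "map g (Irr D a) \<in> carrier (poly_ring L)" using embedding_poly[OF D'(1,3) I(1)] .
    have "degree (map g (Irr D a)) > 0" using pirreducible_degree[OF D'(1) I(1,2)] by simp
    then obtain a' where a': "a' \<in> carrier L" "eval (map g (Irr D a)) a' = \<zero>"
      using exists_root_if_degree_pos[OF mp] by blast
    obtain g' where g': "embedding_on (simple_extension D a) g'" "\<forall>x\<in>D. g' x = g x"
      using extend_embedding_simple[OF D'(1,3) a(1) aD a'] by blast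
    have sub: "D \<subseteq> simple_extension D a" using simple_extension_incl[OF subfieldE(3)[OF D'(1)] a(1)] .
    have "ok (simple_extension D a) g'"
      using g' D' sub simple_extension_is_subfield[OF D'(1) a(1)] aD by (auto simp: ok_def)
    moreover have "graph D g \<subseteq> graph (simple_extension D a) g'" using sub g' by (force simp: graph_def)
    ultimately have "graph (simple_extension D a) g' = graph D g" by (rule max)
    moreover have "a \<in> simple_extension D a" using simple_extension_mem[OF subfieldE(1)[OF D'(1)] a(1)] .
    ultimately show False using a(2) by (force simp: graph_def)
  qed
  then show ?thesis using D' by blast
qed

end

section \<open>Conjugates and roots of odd exponent\<close>

text \<open>
  In characteristic \<open>2\<close> the monic polynomial with constant term \<open>z [^] n\<close> and no intermediate terms
  is \<open>X ^ n - z ^ n\<close>. Its quotient by \<open>X - z\<close> takes the value \<open>n * z ^ (n - 1)\<close> at \<open>z\<close>, which for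
  odd \<open>n\<close> is \<open>z ^ (n - 1)\<close>.
\<close>

lemma (in char2_field) simple_root_of_odd_power:
  assumes z: "z \<in> carrier R" "z \<noteq> \<zero>" and n: "odd n"
  shows "\<exists>u\<in>carrier (poly_ring R). [\<one>, \<ominus> z] \<otimes>\<^bsub>poly_ring R\<^esub> u = poly_add (monom \<one> n) [z [^] n] \<and> eval u z \<noteq> \<zero>"
proof -
  interpret UP: domain "poly_ring R" by (rule univ_poly_is_domain[OF carrier_is_subring])
  define D where "D = [\<one>, \<ominus> z]"
  define Z where "Z = [z]"
  define V where "V = [\<one>, \<zero>]"
  have c: "D \<in> carrier (poly_ring R)" "Z \<in> carrier (poly_ring R)" "V \<in> carrier (poly_ring R)"
    using z by (auto simp: D_def Z_def V_def univ_poly_carrier[symmetric] polynomial_def)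
  have V: "V = D \<oplus>\<^bsub>poly_ring R\<^esub> Z" using z by (simp add: V_def D_def Z_def univ_poly_add l_neg)
  have zn: "z [^] m \<noteq> \<zero>" for m :: nat using nat_pow_eq_zeroD z by blast
  have Zn: "Z [^]\<^bsub>poly_ring R\<^esub> m = [z [^] m]" for m :: nat
  proof (induction m)
    case 0 show ?case by (simp add: univ_poly_one)
  next
    case (Suc m)
    have "poly_mult [z [^] m] [z] = [z [^] m \<otimes> z]"
      using poly_mult_const(1)[OF carrier_is_subring, of "[z]" "z [^] m"] z zn by (simp add: polynomial_def)
    then show ?case using Suc by (simp add: Z_def univ_poly_mult)
  qed
  have Vn: "V [^]\<^bsub>poly_ring R\<^esub> m = monom \<one> m" for m :: nat
    using unitary_monom_eq_var_pow[OF carrier_is_subring, of m] by (simp add: V_def var_def)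
  define u where "u = rec_nat [] (\<lambda>m v. v \<otimes>\<^bsub>poly_ring R\<^esub> V \<oplus>\<^bsub>poly_ring R\<^esub> Z [^]\<^bsub>poly_ring R\<^esub> m)"
  have u0: "u 0 = \<zero>\<^bsub>poly_ring R\<^esub>" and uS: "u (Suc m) = u m \<otimes>\<^bsub>poly_ring R\<^esub> V \<oplus>\<^bsub>poly_ring R\<^esub> Z [^]\<^bsub>poly_ring R\<^esub> m" for m
    by (simp_all add: u_def univ_poly_zero)
  have uc: "u m \<in> carrier (poly_ring R)" for m using c by (induction m) (auto simp: u0 uS)
  have main: "V [^]\<^bsub>poly_ring R\<^esub> m = D \<otimes>\<^bsub>poly_ring R\<^esub> u m \<oplus>\<^bsub>poly_ring R\<^esub> Z [^]\<^bsub>poly_ring R\<^esub> m" for m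
  proof (induction m)
    case 0 then show ?case using c by (simp add: u0)
  next
    case (Suc m)
    have "V [^]\<^bsub>poly_ring R\<^esub> Suc m = (D \<otimes>\<^bsub>poly_ring R\<^esub> u m) \<otimes>\<^bsub>poly_ring R\<^esub> V \<oplus>\<^bsub>poly_ring R\<^esub> Z [^]\<^bsub>poly_ring R\<^esub> m \<otimes>\<^bsub>poly_ring R\<^esub> (D \<oplus>\<^bsub>poly_ring R\<^esub> Z)"
      using c uc by (simp add: Suc UP.l_distr flip: V)
    also have "\<dots> = D \<otimes>\<^bsub>poly_ring R\<^esub> u (Suc m) \<oplus>\<^bsub>poly_ring R\<^esub> Z [^]\<^bsub>poly_ring R\<^esub> Suc m"
      using c uc by (simp add: uS UP.r_distr UP.a_ac UP.m_ac)
    finally show ?case .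
  qed
  note ev = ring_hom_memE[OF eval_is_hom[OF carrier_is_subring z(1)]]
  have evV: "eval V z = z" using z by (simp add: V_def)
  have evZ: "eval (Z [^]\<^bsub>poly_ring R\<^esub> m) z = z [^] m" for m :: nat using z by (simp add: Zn)
  have evS: "eval (u (Suc m)) z = eval (u m) z \<otimes> z \<oplus> z [^] m" for m
    using c uc ev(2)[OF uc c(3)] ev(3)[of "u m \<otimes>\<^bsub>poly_ring R\<^esub> V" "Z [^]\<^bsub>poly_ring R\<^esub> m"]
    by (simp add: uS evV evZ)
  have even: "eval (u (2 * k)) z = \<zero>" for k
  proof (induction k)
    case 0 then show ?case by (simp add: u0 univ_poly_zero)
  next
    case (Suc k)
    have "eval (u (Suc (Suc (2 * k)))) z = (\<zero> \<otimes> z \<oplus> z [^] (2 * k)) \<otimes> z \<oplus> z [^] Suc (2 * k)"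
      by (simp only: evS Suc)
    then show ?case using z by (simp add: add_self)
  qed
  obtain k where k: "n = 2 * k + 1" using n by (rule oddE)
  have "eval (u n) z = z [^] (2 * k)" unfolding k using evS[of "2 * k"] even[of k] z by simp
  then have "eval (u n) z \<noteq> \<zero>" using zn by simp
  moreover have "D \<otimes>\<^bsub>poly_ring R\<^esub> u n = poly_add (monom \<one> n) [z [^] n]"
  proof -
    have zz: "[z [^] n] \<oplus>\<^bsub>poly_ring R\<^esub> [z [^] n] = \<zero>\<^bsub>poly_ring R\<^esub>"
      using z add_self[of "z [^] n"] by (simp add: univ_poly_add univ_poly_zero)
    have zc: "[z [^] n] \<in> carrier (poly_ring R)" using z zn by (auto simp: univ_poly_carrier[symmetric] polynomial_def)
    have Dc: "D \<otimes>\<^bsub>poly_ring R\<^esub> u n \<in> carrier (poly_ring R)" using c uc by simp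
    have "V [^]\<^bsub>poly_ring R\<^esub> n \<oplus>\<^bsub>poly_ring R\<^esub> [z [^] n]
        = D \<otimes>\<^bsub>poly_ring R\<^esub> u n \<oplus>\<^bsub>poly_ring R\<^esub> ([z [^] n] \<oplus>\<^bsub>poly_ring R\<^esub> [z [^] n])"
      unfolding main Zn using Dc zc by (simp only: UP.a_assoc)
    also have "\<dots> = D \<otimes>\<^bsub>poly_ring R\<^esub> u n" unfolding zz using Dc by simp
    finally show ?thesis by (simp add: Vn univ_poly_add)
  qed
  ultimately show ?thesis using uc by (auto simp: D_def)
qed

text \<open>
  The Frobenius power \<open>x \<mapsto> x [^] 2 ^ f\<close> fixes \<open>w\<close> and therefore, by uniqueness, the coefficients of
  its minimal polynomial. A nonzero coefficient is then a root of unity in \<open>K\<close>, that is, equal to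
  \<open>\<one>\<close>. So the minimal polynomial has coefficients in the prime field, and squaring permutes its
  roots.
\<close>

lemma (in char2_field) Irr_Frobenius_invariant:
  assumes K: "subfield K R" and tf: "\<And>c n. c \<in> K \<Longrightarrow> n > 0 \<Longrightarrow> c [^] (n::nat) = \<one> \<Longrightarrow> c = \<one>"
    and w: "w \<in> carrier R" "w [^] (2 ^ f :: nat) = w" "f > 0" and alg: "(algebraic over K) w"
  shows "eval (Irr K w) (w [^] (2::nat)) = \<zero>"
proof -
  note I = IrrE[OF K w(1) alg]
  define q where "q = Irr K w"
  have q: "q \<in> carrier (K[X])" "hd q = \<one>" "eval q w = \<zero>" "q \<noteq> []"
    using I pirreducibleE(1)[OF subfieldE(1)[OF K] I(1,2)] by (auto simp: q_def)
  have qK: "set q \<subseteq> K" using q(1) by (auto simp: univ_poly_carrier[symmetric] polynomial_def)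
  have qc: "set q \<subseteq> carrier R" using qK subfieldE(3)[OF K] by blast
  define \<phi> where "\<phi> x = x [^] (2 ^ f :: nat)" for x
  have \<phi>: "\<phi> \<in> ring_hom R R" unfolding \<phi>_def by (rule frobenius_hom)
  interpret \<Phi>: ring_hom_ring R R \<phi> by (rule ring_hom_ringI2[OF ring_axioms ring_axioms \<phi>])
  have pw: "c [^] (m::nat) \<in> K" if "c \<in> K" for c m
    using that subringE(3,6)[OF subfieldE(1)[OF K]] by (induction m) auto
  have hd: "hd (map \<phi> q) = \<one>" using q by (simp add: hd_map \<phi>_def)
  have mq: "map \<phi> q \<in> carrier (K[X])"
    using qK pw hd by (auto simp: univ_poly_carrier[symmetric] polynomial_def \<phi>_def)
  have "eval (map \<phi> q) w = \<phi> (eval q w)"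
    using \<Phi>.eval_hom'[OF w(1) qc] w(2) by (simp add: \<phi>_def)
  also have "\<dots> = \<zero>" using q(3) \<Phi>.hom_zero by simp
  finally have "q pdivides map \<phi> q" unfolding q_def using Irr_minimal[OF K w(1) alg] mq by (simp add: q_def)
  then have "q divides\<^bsub>K[X]\<^esub> map \<phi> q"
    using pdivides_iff[OF K, of q "map \<phi> q"] q(1) mq by (simp add: univ_poly_carrier)
  then obtain r where r: "r \<in> carrier (K[X])" "map \<phi> q = poly_mult q r" by (auto simp: factor_def univ_poly_mult)
  have pol: "polynomial K q" "polynomial K r" using q(1) r(1) by (auto simp: univ_poly_carrier)
  have r0: "r \<noteq> []" using r(2) q(4) poly_mult_zero(2)[OF qc] by auto
  have "degree (map \<phi> q) = degree q + degree r"
    using poly_mult_degree_eq[OF subfieldE(1)[OF K] pol] r r0 q(4) by simp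
  then have "length r = 1" using r0 by (cases r) auto
  then obtain a where a: "r = [a]" by (auto simp: length_Suc_conv)
  have "a \<in> carrier R" using pol(2) a subfieldE(3)[OF K] by (auto simp: polynomial_def)
  moreover have "hd (poly_mult q r) = hd q \<otimes> hd r" by (rule poly_mult_lead_coeff[OF subfieldE(1)[OF K] pol q(4) r0])
  ultimately have "a = \<one>" using hd r(2) q(2) a by simp
  then have fixed: "map \<phi> q = q" using r(2) a poly_mult_one(2)[OF subfieldE(1)[OF K] pol(1)] by simp
  have c01: "c [^] (2::nat) = c" if c: "c \<in> set q" for c
  proof -
    have cc: "c \<in> K" "c \<in> carrier R" using c qK qc by auto
    have "\<phi> c = c" using fixed c by (metis map_eq_conv map_ident)
    show ?thesis
    proof (cases "c = \<zero>")
      case True then show ?thesis by (simp add: numeral_2_eq_2)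
    next
      case False
      have "(2::nat) ^ f > 1" by (rule one_less_power) (use w(3) in auto)
      then obtain m where m: "2 ^ f = Suc m" "m > 0" by (metis Suc_lessD less_imp_Suc_add nat_neq_iff not0_implies_Suc not_less_eq One_nat_def gr0I)
      have "c [^] m \<otimes> c = \<one> \<otimes> c" using \<open>\<phi> c = c\<close> m cc by (simp add: \<phi>_def)
      then have "c [^] m = \<one>" using cc False m_rcancel[OF False cc(2), of "c [^] m" \<one>] by simp
      then have "c = \<one>" using tf[OF cc(1) m(2)] by blast
      then show ?thesis by simp
    qed
  qed
  interpret S: ring_hom_ring R R "\<lambda>x. x [^] (2 ^ 1 :: nat)"
    by (rule ring_hom_ringI2[OF ring_axioms ring_axioms frobenius_hom])
  have "map (\<lambda>x. x [^] (2 ^ 1 :: nat)) q = q" using c01 by (intro map_idI) simp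
  then have "eval q (w [^] (2::nat)) = (eval q w) [^] (2::nat)" using S.eval_hom'[OF w(1) qc] by simp
  then show ?thesis using q(3) by (simp add: q_def numeral_2_eq_2)
qed

locale char2_algebraically_closed = char2_field L + algebraically_closed L for L (structure)
begin

text \<open>
  For \<open>L\<close> algebraic over \<open>K\<close> these are the automorphisms of \<open>L\<close> over \<open>K\<close>.
\<close>

definition galois :: "'a set \<Rightarrow> ('a \<Rightarrow> 'a) set"
  where "galois K = {\<tau>. embedding_on (carrier L) \<tau> \<and> (\<forall>x\<in>K. \<tau> x = x)}"

lemma galois_props:
  assumes "\<tau> \<in> galois K"
  shows "x \<in> carrier L \<Longrightarrow> \<tau> x \<in> carrier L"
    "x \<in> carrier L \<Longrightarrow> y \<in> carrier L \<Longrightarrow> \<tau> (x \<oplus> y) = \<tau> x \<oplus> \<tau> y"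
    "x \<in> carrier L \<Longrightarrow> y \<in> carrier L \<Longrightarrow> \<tau> (x \<otimes> y) = \<tau> x \<otimes> \<tau> y"
    "x \<in> carrier L \<Longrightarrow> \<tau> (x [^] (n::nat)) = \<tau> x [^] n"
    "x \<in> carrier L \<Longrightarrow> y \<in> carrier L \<Longrightarrow> \<tau> x = \<tau> y \<Longrightarrow> x = y"
    "x \<in> carrier L \<Longrightarrow> x \<noteq> \<zero> \<Longrightarrow> \<tau> x \<noteq> \<zero>"
    "x \<in> carrier L \<Longrightarrow> x \<noteq> \<zero> \<Longrightarrow> \<tau> (inv x) = inv (\<tau> x)"
    "\<tau> \<one> = \<one>" "\<tau> \<zero> = \<zero>" "x \<in> carrier L \<Longrightarrow> \<tau> (\<ominus> x) = \<ominus> \<tau> x"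
proof -
  have h: "embedding_on (carrier L) \<tau>" using assms by (simp add: galois_def)
  note E = carrier_is_subfield
  show "x \<in> carrier L \<Longrightarrow> \<tau> x \<in> carrier L" for x using embedding_closed[OF E h] .
  show mult: "x \<in> carrier L \<Longrightarrow> y \<in> carrier L \<Longrightarrow> \<tau> (x \<otimes> y) = \<tau> x \<otimes> \<tau> y" for x y using embedding_mult[OF E h] .
  show "x \<in> carrier L \<Longrightarrow> y \<in> carrier L \<Longrightarrow> \<tau> (x \<oplus> y) = \<tau> x \<oplus> \<tau> y" using embedding_add[OF E h] .
  show "x \<in> carrier L \<Longrightarrow> \<tau> (x [^] (n::nat)) = \<tau> x [^] n" using embedding_pow[OF E h] by blast
  show "x \<in> carrier L \<Longrightarrow> y \<in> carrier L \<Longrightarrow> \<tau> x = \<tau> y \<Longrightarrow> x = y" using embedding_inj[OF E h] .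
  show nz: "x \<in> carrier L \<Longrightarrow> x \<noteq> \<zero> \<Longrightarrow> \<tau> x \<noteq> \<zero>" for x using embedding_nonzero[OF E h] .
  show one: "\<tau> \<one> = \<one>" using embedding_one[OF E h] .
  show "\<tau> \<zero> = \<zero>" using embedding_zero[OF E h] .
  show "x \<in> carrier L \<Longrightarrow> \<tau> (\<ominus> x) = \<ominus> \<tau> x" using embedding_uminus[OF E h] .
  show "\<tau> (inv x) = inv (\<tau> x)" if x: "x \<in> carrier L" "x \<noteq> \<zero>"
  proof -
    note ix = nonzero_simps[OF x]
    have "\<tau> x \<otimes> \<tau> (inv x) = \<one>" using mult[OF x(1) ix(1)] ix(3) one by simp
    then show ?thesis using comm_inv_char embedding_closed[OF E h] x(1) ix(1) by metis
  qed
qed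

lemma galois_fixes: "\<tau> \<in> galois K \<Longrightarrow> x \<in> K \<Longrightarrow> \<tau> x = x"
  by (simp add: galois_def)

lemma galois_comp: "\<tau> \<in> galois K \<Longrightarrow> \<rho> \<in> galois K \<Longrightarrow> (\<lambda>x. \<tau> (\<rho> x)) \<in> galois K"
  by (simp add: galois_def embedding_on_def)

lemma galois_funpow: "\<tau> \<in> galois K \<Longrightarrow> (\<tau> ^^ i) \<in> galois K"
proof (induction i)
  case 0 show ?case by (simp add: galois_def embedding_on_def)
next
  case (Suc i)
  then have "(\<lambda>x. \<tau> ((\<tau> ^^ i) x)) \<in> galois K" using galois_comp by blast
  then show ?case by (simp add: comp_def)
qed

lemma galois_agree:
  assumes \<tau>: "\<tau> \<in> galois K" and \<rho>: "\<rho> \<in> galois K" and S: "S \<subseteq> carrier L" "K \<subseteq> carrier L"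
    and eq: "\<And>s. s \<in> S \<Longrightarrow> \<tau> s = \<rho> s" and x: "x \<in> generate_field L (K \<union> S)"
  shows "\<tau> x = \<rho> x"
proof -
  have cl: "y \<in> carrier L" if "y \<in> generate_field L (K \<union> S)" for y
    using generate_field_in_carrier[OF _ that] S by blast
  show ?thesis using x
  proof (induction rule: generate_field.induct)
    case (incl h) then show ?case using eq galois_fixes[OF \<tau>] galois_fixes[OF \<rho>] by auto
  next
    case one
    show ?case by (simp only: galois_props(8)[OF \<tau>] galois_props(8)[OF \<rho>])
  next
    case (a_inv h)
    then show ?case by (simp only: galois_props(10)[OF \<tau> cl] galois_props(10)[OF \<rho> cl])
  next
    case (m_inv h)
    then show ?case using galois_props(7)[OF \<tau> cl] galois_props(7)[OF \<rho> cl] by simp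
  next
    case (eng_add h k)
    then show ?case by (simp only: galois_props(2)[OF \<tau> cl cl] galois_props(2)[OF \<rho> cl cl])
  next
    case (eng_mult h k)
    then show ?case by (simp only: galois_props(3)[OF \<tau> cl cl] galois_props(3)[OF \<rho> cl cl])
  qed
qed

lemma galois_conjugate:
  assumes K: "subfield K L" and alg: "\<And>x. x \<in> carrier L \<Longrightarrow> (algebraic over K) x"
    and z: "z \<in> carrier L" "z' \<in> carrier L" "eval (Irr K z) z' = \<zero>"
  shows "\<exists>\<tau>\<in>galois K. \<tau> z = z'"
proof -
  have h: "embedding_on K id" using subfieldE(3)[OF K] by (auto simp: embedding_on_def)
  obtain h' where h': "embedding_on (simple_extension K z) h'" "\<forall>x\<in>K. h' x = id x" "h' z = z'"
    using extend_embedding_simple[OF K h z(1) alg[OF z(1)] z(2)] z(3) by auto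
  have E: "subfield (simple_extension K z) L" using simple_extension_is_subfield[OF K z(1)] alg[OF z(1)] by simp
  have KE: "K \<subseteq> simple_extension K z" using simple_extension_incl[OF subfieldE(3)[OF K] z(1)] .
  obtain \<tau> where \<tau>: "embedding_on (carrier L) \<tau>" "\<forall>x\<in>simple_extension K z. \<tau> x = h' x"
    using extend_embedding[OF E h'(1)] algebraic_mono[OF KE alg] by blast
  have "\<tau> z = z'" using \<tau>(2) h'(3) simple_extension_mem[OF subfieldE(1)[OF K] z(1)] by simp
  moreover have "\<tau> \<in> galois K" using \<tau> h'(2) KE by (auto simp: galois_def)
  ultimately show ?thesis by blast
qed

text \<open>
  As \<open>n\<close> is odd, \<open>z\<close> is a simple root of \<open>X ^ n - z ^ n\<close> and hence of its minimal polynomial. Unless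
  the latter is linear, it has another root, and this root is the image of \<open>z\<close> under an element of
  \<open>galois K\<close>.
\<close>

lemma mem_if_galois_invariant:
  assumes K: "subfield K L" and alg: "\<And>x. x \<in> carrier L \<Longrightarrow> (algebraic over K) x"
    and z: "z \<in> carrier L" "odd n" "z [^] (n::nat) \<in> K" and inv: "\<And>\<tau>. \<tau> \<in> galois K \<Longrightarrow> \<tau> z = z"
  shows "z \<in> K"
proof (rule ccontr)
  assume zK: "z \<notin> K"
  have z0: "z \<noteq> \<zero>" using zK subringE(2)[OF subfieldE(1)[OF K]] by auto
  note I = IrrE[OF K z(1) alg[OF z(1)]]
  define p where "p = Irr K z"
  have pP: "p \<in> carrier (poly_ring L)"
    using I(1) subfieldE(3)[OF K] by (auto simp: p_def univ_poly_carrier[symmetric] polynomial_def)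
  have p0: "p \<noteq> []" using pirreducibleE(1)[OF subfieldE(1)[OF K] I(1,2)] by (simp add: p_def)
  have only: "z' = z" if "z' \<in> carrier L" "eval p z' = \<zero>" for z'
    using galois_conjugate[OF K alg z(1) that(1)] that(2) inv by (auto simp: p_def)
  have Dc: "[\<one>, \<ominus> z] \<in> carrier (poly_ring L)" using z by (auto simp: univ_poly_carrier[symmetric] polynomial_def)
  have "is_root p z" using z I(4) p0 by (simp add: is_root_def p_def)
  then have "[\<one>, \<ominus> z] pdivides p" using is_root_imp_pdivides[OF pP] by blast
  then obtain r where r: "r \<in> carrier (poly_ring L)" "p = [\<one>, \<ominus> z] \<otimes>\<^bsub>poly_ring L\<^esub> r"
    by (auto simp: pdivides_def factor_def)
  have rK: "r \<noteq> []"
    using r(2) p0 poly_mult_zero(2)[of "[\<one>, \<ominus> z]"] z by (auto simp: univ_poly_mult)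
  have dp: "degree p = 1 + degree r"
    using poly_mult_degree_eq[OF carrier_is_subring, of "[\<one>, \<ominus> z]" r] Dc r rK by (simp add: univ_poly_carrier univ_poly_mult)
  have "degree p \<noteq> 1"
  proof
    assume "degree p = 1"
    then obtain a b where "p = [a, b]" by (metis One_nat_def Suc_length_conv diff_Suc_1 length_0_conv length_greater_0_conv Suc_pred p0)
    then have ab: "p = [\<one>, b]" "b \<in> K" using I(1,3) by (auto simp: p_def univ_poly_carrier[symmetric] polynomial_def)
    then have "z \<oplus> b = \<zero>" using I(4) z subfieldE(3)[OF K] by (auto simp: p_def[symmetric])
    then have "z = b" using add_eq_zero_iff z ab subfieldE(3)[OF K] by auto
    then show False using ab zK by simp
  qed
  then have "degree r > 0" using dp by simp
  then obtain z' where z': "z' \<in> carrier L" "eval r z' = \<zero>" using exists_root_if_degree_pos[OF r(1)] by blast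
  note evm = ring_hom_memE(2)[OF eval_is_hom[OF carrier_is_subring]]
  note evc = ring_hom_memE(1)[OF eval_is_hom[OF carrier_is_subring]]
  have "eval p z' = \<zero>" using evm[OF z'(1) Dc r(1)] evc[OF z'(1) Dc] z'(2) r(2) by simp
  then have rz: "eval r z = \<zero>" using only[OF z'(1)] z'(2) by simp
  obtain u where u: "u \<in> carrier (poly_ring L)" "[\<one>, \<ominus> z] \<otimes>\<^bsub>poly_ring L\<^esub> u = poly_add (monom \<one> n) [z [^] n]" "eval u z \<noteq> \<zero>"
    using simple_root_of_odd_power[OF z(1) z0 z(2)] by blast
  have zn: "z [^] n \<noteq> \<zero>" using nat_pow_eq_zeroD z z0 by blast
  have "poly_add (monom \<one> n) [z [^] n] \<in> carrier (K[X])"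
    using poly_add_closed[OF subfieldE(1)[OF K] monom_is_polynomial[OF subfieldE(1)[OF K], of \<one> n] const_is_polynomial[of "z [^] n" K]]
      z(3) zn subringE(3)[OF subfieldE(1)[OF K]] by (simp add: univ_poly_carrier)
  moreover have "eval (poly_add (monom \<one> n) [z [^] n]) z = \<zero>"
    using z eval_poly_add[of "monom \<one> n" "[z [^] n]" z] eval_monom[OF one_closed z(1)] monom_in_carrier[OF one_closed, of n]
    by (simp add: add_self)
  ultimately have "p pdivides (poly_add (monom \<one> n) [z [^] n])"
    unfolding p_def using Irr_minimal[OF K z(1) alg[OF z(1)]] by blast
  then obtain s where s: "s \<in> carrier (poly_ring L)" "[\<one>, \<ominus> z] \<otimes>\<^bsub>poly_ring L\<^esub> u = p \<otimes>\<^bsub>poly_ring L\<^esub> s"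
    using u(2) by (auto simp: pdivides_def factor_def)
  interpret UP: domain "poly_ring L" by (rule univ_poly_is_domain[OF carrier_is_subring])
  have "[\<one>, \<ominus> z] \<otimes>\<^bsub>poly_ring L\<^esub> u = [\<one>, \<ominus> z] \<otimes>\<^bsub>poly_ring L\<^esub> (r \<otimes>\<^bsub>poly_ring L\<^esub> s)"
    unfolding s(2) r(2) using Dc r(1) s(1) by (simp add: UP.m_assoc)
  then have "u = r \<otimes>\<^bsub>poly_ring L\<^esub> s"
    using UP.m_lcancel[OF _ Dc u(1) UP.m_closed[OF r(1) s(1)]] by (simp add: univ_poly_zero)
  then have "eval u z = \<zero>" using evm[OF z(1) r(1) s(1)] rz evc[OF z(1) s(1)] by simp
  then show False using u(3) by simp
qed

text \<open>
  It suffices that the conjugates \<open>\<rho> w\<close> and \<open>w\<close> have the same power with exponent \<open>2 ^ fact d - 1\<close>.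
  Their quotient \<open>z\<close> is a root of unity of odd order. Since \<open>K\<close> contains no root of unity except
  \<open>\<one>\<close>, \<open>z [^] 2\<close> is a conjugate of \<open>z\<close>, say \<open>\<tau> z = z [^] 2\<close> with \<open>\<tau>\<close> in \<open>galois K\<close>. The elements of
  \<open>S\<close> and their conjugates have degree at most \<open>d\<close>, so \<open>T = \<tau> ^^ fact d\<close> fixes them. Therefore \<open>T\<close>
  fixes \<open>w\<close>, \<open>\<rho> w\<close> and \<open>z\<close>, which means that \<open>z [^] 2 ^ fact d = z\<close>.
\<close>

lemma odd_root_exponent_bound:
  assumes K: "subfield K L" and alg: "\<And>x. x \<in> carrier L \<Longrightarrow> (algebraic over K) x"
    and S: "S \<subseteq> carrier L" "\<And>s. s \<in> S \<Longrightarrow> \<exists>p\<in>carrier (K[X]). p \<noteq> [] \<and> degree p \<le> d \<and> eval p s = \<zero>"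
    and tf: "\<And>c n. c \<in> K \<Longrightarrow> n > 0 \<Longrightarrow> c [^] (n::nat) = \<one> \<Longrightarrow> c = \<one>"
    and w: "w \<in> generate_field L (K \<union> S)" "odd n" "w [^] (n::nat) \<in> K"
  shows "w [^] (2 ^ fact d - 1 :: nat) \<in> K"
proof (cases "w = \<zero>")
  case True
  have "(2::nat) ^ fact d - 1 \<noteq> 0" using one_less_power[of "2::nat" "fact d"] fact_gt_zero[of d, where ?'a = nat] by linarith
  then obtain m where "(2::nat) ^ fact d - 1 = Suc m" by (metis not0_implies_Suc)
  then show ?thesis using True subringE(2)[OF subfieldE(1)[OF K]] by (simp only: nat_pow_Suc) simp
next
  case w0: False
  note Kc = subfieldE(3)[OF K]
  have wc: "w \<in> carrier L" using generate_field_in_carrier[OF _ w(1)] S Kc by blast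
  note iw = nonzero_simps[OF wc w0]
  have n0: "n > 0" using w(2) by (intro Nat.gr0I) auto
  have root_perm: "(\<tau> ^^ fact d) x = x"
    if \<tau>: "\<tau> \<in> galois K" and p: "p \<in> carrier (K[X])" "p \<noteq> []" "degree p \<le> d" and x: "x \<in> carrier L" "eval p x = \<zero>" for \<tau> p x
  proof (rule funpow_fact_fixes)
    let ?A = "{x\<in>carrier L. eval p x = \<zero>}"
    have pK: "set p \<subseteq> K" using p(1) by (auto simp: univ_poly_carrier[symmetric] polynomial_def)
    have pP: "p \<in> carrier (poly_ring L)" using p(1) Kc by (auto simp: univ_poly_carrier[symmetric] polynomial_def)
    show "finite ?A" "card ?A \<le> d" using finite_card_roots[OF pP p(2)] p(3) by auto
    have "map \<tau> p = p" using pK galois_fixes[OF \<tau>] by (intro map_idI) auto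
    then have "eval p (\<tau> y) = \<tau> (eval p y)" if "y \<in> carrier L" for y
      using embedding_eval[OF carrier_is_subfield, of \<tau> p y] that pK Kc \<tau> by (auto simp: galois_def)
    then show "\<tau> ` ?A \<subseteq> ?A" using galois_props(1,9)[OF \<tau>] by auto
    show "inj_on \<tau> ?A" using galois_props(5)[OF \<tau>] by (intro inj_onI) auto
    show "x \<in> ?A" using x by simp
  qed
  have inv: "\<rho> (w [^] (2 ^ fact d - 1 :: nat)) = w [^] (2 ^ fact d - 1 :: nat)" if \<rho>: "\<rho> \<in> galois K" for \<rho>
  proof -
    define z where "z = \<rho> w \<otimes> inv w"
    have \<rho>w: "\<rho> w \<in> carrier L" using galois_props(1)[OF \<rho> wc] .
    have zc: "z \<in> carrier L" using \<rho>w iw by (simp add: z_def)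
    have z0: "z \<noteq> \<zero>" using \<rho>w iw galois_props(6)[OF \<rho> wc w0] by (simp add: z_def integral_iff)
    have "\<rho> w [^] n = w [^] n" using galois_props(4)[OF \<rho> wc, of n] galois_fixes[OF \<rho> w(3)] by simp
    then have "z [^] n = (w \<otimes> inv w) [^] n" unfolding z_def using \<rho>w wc iw(1) by (simp only: nat_pow_distrib)
    then have zn: "z [^] n = \<one>" using iw(3) by simp
    have "\<exists>f>0. z [^] (2 ^ f :: nat) = z"
    proof -
      let ?A = "{x\<in>carrier L. x [^] n = \<one>}" and ?sq = "\<lambda>x. x [^] (2::nat)"
      have it: "(?sq ^^ i) x = x [^] (2 ^ i :: nat)" if "x \<in> carrier L" for i x
        using that by (induction i) (auto simp: nat_pow_pow mult.commute)
      have "(?sq ^^ fact (card ?A)) z = z"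
      proof (rule funpow_fact_fixes[OF finite_card_unity_roots(1)[OF n0] order_refl])
        show "?sq ` ?A \<subseteq> ?A"
        proof clarify
          fix x assume x: "x \<in> carrier L" "x [^] n = \<one>"
          have "(x [^] (2::nat)) [^] n = (x [^] n) [^] (2::nat)" using x(1) by (simp add: nat_pow_pow mult.commute)
          then show "x [^] (2::nat) \<in> carrier L \<and> (x [^] (2::nat)) [^] n = \<one>" using x by simp
        qed
        show "inj_on ?sq ?A" using frobenius_inj[of _ _ 1] by (intro inj_onI) auto
        show "z \<in> ?A" using zc zn by simp
      qed
      then show ?thesis using it[OF zc] by (intro exI[of _ "fact (card ?A)"]) auto
    qed
    then obtain f where f: "f > 0" "z [^] (2 ^ f :: nat) = z" by blast
    have "eval (Irr K z) (z [^] (2::nat)) = \<zero>"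
      by (rule Irr_Frobenius_invariant[OF K tf zc f(2,1) alg[OF zc]])
    then obtain \<tau> where \<tau>: "\<tau> \<in> galois K" "\<tau> z = z [^] (2::nat)"
      using galois_conjugate[OF K alg zc] zc by blast
    define T where "T = \<tau> ^^ fact d"
    have T: "T \<in> galois K" unfolding T_def by (rule galois_funpow[OF \<tau>(1)])
    have "T s = s" if "s \<in> S" for s
      using S(2)[OF that] root_perm[OF \<tau>(1)] S(1) that unfolding T_def by blast
    moreover have idg: "(\<lambda>x. x) \<in> galois K" by (simp add: galois_def embedding_on_def)
    ultimately have Tw: "T w = w" using galois_agree[OF T idg S(1) Kc _ w(1)] by blast
    have "T (\<rho> s) = \<rho> s" if s: "s \<in> S" for s
    proof -
      obtain p where p: "p \<in> carrier (K[X])" "p \<noteq> []" "degree p \<le> d" "eval p s = \<zero>" using S(2)[OF s] by blast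
      have pK: "set p \<subseteq> K" using p(1) by (auto simp: univ_poly_carrier[symmetric] polynomial_def)
      have sc: "s \<in> carrier L" using s S by blast
      have "map \<rho> p = p" using pK galois_fixes[OF \<rho>] by (intro map_idI) auto
      then have "eval p (\<rho> s) = \<rho> (eval p s)"
        using embedding_eval[OF carrier_is_subfield, of \<rho> p s] sc pK Kc \<rho> by (auto simp: galois_def)
      then have "eval p (\<rho> s) = \<zero>" using p(4) galois_props(9)[OF \<rho>] by simp
      then show ?thesis unfolding T_def using root_perm[OF \<tau>(1) p(1-3)] galois_props(1)[OF \<rho> sc] by blast
    qed
    then have T\<rho>: "T (\<rho> w) = \<rho> w" using galois_agree[OF galois_comp[OF T \<rho>] \<rho> S(1) Kc _ w(1)] by blast
    have Tz: "T z = z"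
      unfolding z_def using galois_props(3)[OF T \<rho>w iw(1)] galois_props(7)[OF T wc w0] Tw T\<rho> by simp
    have "(\<tau> ^^ i) z = z [^] (2 ^ i :: nat)" for i
    proof (induction i)
      case (Suc i)
      then have "(\<tau> ^^ Suc i) z = (z [^] (2::nat)) [^] (2 ^ i :: nat)"
        using galois_props(4)[OF \<tau>(1) zc] \<tau>(2) by simp
      then show ?case using zc by (simp add: nat_pow_pow)
    qed (use zc in simp)
    then have "z [^] (2 ^ fact d :: nat) = z" using Tz by (simp add: T_def)
    moreover have "(2::nat) ^ fact d = Suc (2 ^ fact d - 1)" by simp
    ultimately have "z [^] (2 ^ fact d - 1 :: nat) \<otimes> z = \<one> \<otimes> z" using zc by (metis l_one nat_pow_Suc)
    then have zW: "z [^] (2 ^ fact d - 1 :: nat) = \<one>"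
      using m_rcancel[OF z0 zc nat_pow_closed[OF zc] one_closed] by blast
    have "\<rho> w = z \<otimes> w" unfolding z_def using \<rho>w wc iw by (simp add: m_assoc)
    then have "\<rho> w [^] (2 ^ fact d - 1 :: nat) = w [^] (2 ^ fact d - 1 :: nat)"
      using nat_pow_distrib[OF zc wc] zW wc by simp
    then show ?thesis using galois_props(4)[OF \<rho> wc] by simp
  qed
  have "w [^] (2 ^ fact d - 1 :: nat) \<in> carrier L" using wc by simp
  moreover have "(w [^] (2 ^ fact d - 1 :: nat)) [^] n \<in> K"
  proof -
    have "(w [^] (2 ^ fact d - 1 :: nat)) [^] n = (w [^] n) [^] (2 ^ fact d - 1 :: nat)"
      using wc by (simp add: nat_pow_pow mult.commute)
    moreover have "(w [^] n) [^] (m::nat) \<in> K" for m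
      using w(3) subringE(3,6)[OF subfieldE(1)[OF K]] by (induction m) auto
    ultimately show ?thesis by simp
  qed
  ultimately show ?thesis using mem_if_galois_invariant[OF K alg _ w(2)] inv by blast
qed

end

section \<open>Roots in extensions generated in bounded degree\<close>

lemma (in domain) finite_extension_mono_set:
  assumes K: "subring K R" and ys: "set ys \<subseteq> carrier R" "set xs \<subseteq> set ys"
  shows "finite_extension K xs \<subseteq> finite_extension K ys"
  using finite_extension_subring_incl[OF finite_extension_is_subring[OF K ys(1)]
      finite_extension_incl[OF subringE(1)[OF K] ys(1)]] finite_extension_mem[OF K ys(1)] ys(2) by blast

lemma (in field) generate_field_finitary:
  assumes K: "subfield K R" and S: "S \<subseteq> carrier R" "\<And>s. s \<in> S \<Longrightarrow> (algebraic over K) s"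
    and x: "x \<in> generate_field R (K \<union> S)"
  shows "\<exists>xs. set xs \<subseteq> S \<and> x \<in> finite_extension K xs"
proof -
  have sub: "subfield (finite_extension K xs) R" if "set xs \<subseteq> S" for xs
    using finite_extension_is_subfield[OF K, of xs] that S by blast
  have join: "\<exists>zs. set zs \<subseteq> S \<and> finite_extension K xs \<subseteq> finite_extension K zs \<and> finite_extension K ys \<subseteq> finite_extension K zs"
    if "set xs \<subseteq> S" "set ys \<subseteq> S" for xs ys
  proof (intro exI conjI)
    have c: "set (xs @ ys) \<subseteq> carrier R" using that S(1) by auto
    show "set (xs @ ys) \<subseteq> S" using that by simp
    show "finite_extension K xs \<subseteq> finite_extension K (xs @ ys)"
      by (rule finite_extension_mono_set[OF subfieldE(1)[OF K] c]) simp
    show "finite_extension K ys \<subseteq> finite_extension K (xs @ ys)"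
      by (rule finite_extension_mono_set[OF subfieldE(1)[OF K] c]) simp
  qed
  show ?thesis using x
  proof (induction rule: generate_field.induct)
    case one
    then show ?case using subringE(3)[OF subfieldE(1)[OF K]] by (intro exI[of _ "[]"]) simp
  next
    case (incl h)
    then show ?case
    proof
      assume "h \<in> K" then show ?case by (intro exI[of _ "[]"]) simp
    next
      assume "h \<in> S"
      then show ?case using finite_extension_mem[OF subfieldE(1)[OF K], of "[h]"] S(1) by (intro exI[of _ "[h]"]) auto
    qed
  next
    case (a_inv h)
    then obtain xs where xs: "set xs \<subseteq> S" "h \<in> finite_extension K xs" by blast
    then show ?case using subringE(5)[OF subfieldE(1)[OF sub[OF xs(1)]]] by blast
  next
    case (m_inv h)
    then obtain xs where xs: "set xs \<subseteq> S" "h \<in> finite_extension K xs" by blast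
    then show ?case using subfield_m_inv(1)[OF sub[OF xs(1)], of h] m_inv by blast
  next
    case (eng_add h1 h2)
    then obtain xs ys where "set xs \<subseteq> S" "h1 \<in> finite_extension K xs" "set ys \<subseteq> S" "h2 \<in> finite_extension K ys" by blast
    then obtain zs where zs: "set zs \<subseteq> S" "h1 \<in> finite_extension K zs" "h2 \<in> finite_extension K zs" using join by blast
    then show ?case using subringE(7)[OF subfieldE(1)[OF sub[OF zs(1)]]] by blast
  next
    case (eng_mult h1 h2)
    then obtain xs ys where "set xs \<subseteq> S" "h1 \<in> finite_extension K xs" "set ys \<subseteq> S" "h2 \<in> finite_extension K ys" by blast
    then obtain zs where zs: "set zs \<subseteq> S" "h1 \<in> finite_extension K zs" "h2 \<in> finite_extension K zs" using join by blast
    then show ?case using subringE(6)[OF subfieldE(1)[OF sub[OF zs(1)]]] by blast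
  qed
qed

lemma (in field) algebraic_if_generated_by_algebraic:
  assumes K: "subfield K R" and S: "S \<subseteq> carrier R" "\<And>s. s \<in> S \<Longrightarrow> (algebraic over K) s"
    and z: "z \<in> generate_field R (K \<union> S)"
  shows "(algebraic over K) z"
proof -
  obtain xs where "set xs \<subseteq> S" "z \<in> finite_extension K xs" using generate_field_finitary[OF K S z] by blast
  then show ?thesis using finite_extesion_mem_imp_algebraic[OF K, of xs z] S by blast
qed

lemma (in ring) combine_mem_Span:
  assumes K: "subfield K R" and Ws: "set Ws \<subseteq> carrier R"
  shows "set Ks \<subseteq> K \<Longrightarrow> set Us \<subseteq> Span K Ws \<Longrightarrow> combine Ks Us \<in> Span K Ws"
proof (induction Ks Us rule: combine.induct)
  case (1 k Ks u Us)
  then show ?case using Span_smult_closed[OF K Ws] Span_subgroup_props(3)[OF K Ws] by simp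
qed (use Span_subgroup_props(2)[OF K Ws] in simp_all)

lemma (in ring) dimension_Span_le:
  assumes K: "subfield K R"
  shows "set Us \<subseteq> carrier R \<Longrightarrow> \<exists>m\<le>length Us. dimension m K (Span K Us)"
proof (induction Us)
  case Nil then show ?case by auto
next
  case (Cons u Us)
  then have c: "u \<in> carrier R" "set Us \<subseteq> carrier R" by auto
  obtain m where m: "m \<le> length Us" "dimension m K (Span K Us)" using Cons by auto
  show ?case
  proof (cases "u \<in> Span K Us")
    case True
    have "Span K (u # Us) \<subseteq> Span K Us"
      using Span_smult_closed[OF K c(2)] Span_subgroup_props(3)[OF K c(2)] True by (auto simp: line_extension_mem_iff)
    then have "Span K (u # Us) = Span K Us" using mono_Span[OF K c(2,1)] by blast
    then show ?thesis using m by (intro exI[of _ m]) simp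
  next
    case False
    then have "dimension (Suc m) K (Span K (u # Us))" using Suc_dim[OF c(1) _ m(2)] by simp
    then show ?thesis using m(1) by (intro exI[of _ "Suc m"]) simp
  qed
qed

lemma (in ring) proper_subspace_dimension_less:
  assumes K: "subfield K R" and d: "dimension m K E" "dimension n K E'" and sub: "E \<subseteq> E'" "E \<noteq> E'"
  shows "m < n"
proof -
  obtain Us where Us: "independent K Us" "length Us = m" "Span K Us = E" "set Us \<subseteq> carrier R"
    using exists_base[OF K d(1)] by blast
  have "set Us \<subseteq> E'" using Span_base_incl[OF K Us(4)] Us(3) sub by blast
  then show ?thesis
    using independent_length_le_dimension[OF K d(2) Us(1)] independent_length_eq_dimension[OF K d(2) Us(1)] Us sub
    by (metis le_neq_implies_less)
qed

context char2_field
begin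

lemma frobenius_simple_extension:
  assumes K: "K \<subseteq> carrier R" "\<And>c. c \<in> K \<Longrightarrow> c [^] (2 ^ i :: nat) \<in> K'" and z: "z \<in> carrier R"
    and y: "y \<in> simple_extension K z"
  shows "y [^] (2 ^ i :: nat) \<in> simple_extension K' (z [^] (2 ^ i :: nat))"
  using y
proof (induction rule: simple_extension.induct)
  case zero
  have "\<zero> [^] (2 ^ i :: nat) = \<zero>" using nat_pow_zero[of "2 ^ i"] by simp
  then show ?case by simp
next
  case (lin k1 k2)
  have c: "k1 \<in> carrier R" "k2 \<in> carrier R" using lin simple_extension_in_carrier[OF K(1) z] K(1) by auto
  have "(k1 \<otimes> z \<oplus> k2) [^] (2 ^ i :: nat) = k1 [^] (2 ^ i :: nat) \<otimes> z [^] (2 ^ i :: nat) \<oplus> k2 [^] (2 ^ i :: nat)"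
    using ring_hom_add[OF frobenius_hom, of "k1 \<otimes> z" k2 i] c z by (simp add: nat_pow_distrib)
  then show ?case using lin K(2) by (simp add: simple_extension.lin)
qed

lemma frobenius_finite_extension:
  assumes K: "subfield K R"
  shows "set xs \<subseteq> carrier R \<Longrightarrow> y \<in> finite_extension K xs
    \<Longrightarrow> y [^] (2 ^ i :: nat) \<in> finite_extension K (map (\<lambda>x. x [^] (2 ^ i :: nat)) xs)"
proof (induction xs arbitrary: y)
  case Nil
  have "y [^] (m::nat) \<in> K" for m
    using Nil subringE(3,6)[OF subfieldE(1)[OF K]] by (induction m) auto
  then show ?case by simp
next
  case (Cons x xs)
  then show ?case
    using frobenius_simple_extension[of "finite_extension K xs" i "finite_extension K (map (\<lambda>x. x [^] (2 ^ i :: nat)) xs)" x y]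
      finite_extension_in_carrier[OF subfieldE(3)[OF K], of xs] by simp
qed

text \<open>
  The fields \<open>K(s [^] 2 ^ j)\<close> decrease with \<open>j\<close>, and their degrees over \<open>K\<close> lie between \<open>1\<close> and \<open>d\<close>.
  So two consecutive ones with \<open>j \<le> d\<close> are equal, and the Frobenius map carries the equality from
  \<open>j\<close> to \<open>d\<close>.
\<close>

lemma frobenius_stabilizes:
  assumes K: "subfield K R" and s: "s \<in> carrier R"
    and p: "p \<in> carrier (K[X])" "p \<noteq> []" "degree p \<le> d" "eval p s = \<zero>"
  shows "s [^] (2 ^ d :: nat) \<in> simple_extension K ((s [^] (2 ^ d :: nat)) [^] (2::nat))"
proof -
  define E where "E j = simple_extension K (s [^] (2 ^ j :: nat))" for j
  have sj: "s [^] (2 ^ j :: nat) \<in> carrier R" for j using s by simp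
  have alg: "(algebraic over K) s" using p by (intro algebraicI)
  have pow_mem: "s [^] (i::nat) \<in> simple_extension K s" for i
    using simple_extension_is_subring[OF subfieldE(1)[OF K] s] simple_extension_mem[OF subfieldE(1)[OF K] s]
    by (induction i) (auto dest: subringE(3,6))
  have algj: "(algebraic over K) (s [^] (2 ^ j :: nat))" for j
    using simple_extesion_mem_imp_algebraic[OF K s alg pow_mem] .
  have dimE: "dimension (degree (Irr K (s [^] (2 ^ j :: nat)))) K (E j)" for j
    unfolding E_def using dimension_simple_extension[OF K sj algj] .
  have "degree (Irr K s) \<le> d"
  proof -
    have "Irr K s pdivides p" using Irr_minimal[OF K s alg p(1,4)] .
    moreover have "polynomial (carrier R) p" "Irr K s \<in> carrier (poly_ring R)"
      using p(1) IrrE(1)[OF K s alg] subfieldE(3)[OF K] by (auto simp: univ_poly_carrier[symmetric] polynomial_def)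
    ultimately have "degree (Irr K s) \<le> degree p"
      using pdivides_imp_degree_le[OF carrier_is_subring _ _ p(2)] by (simp add: univ_poly_carrier)
    then show ?thesis using p(3) by simp
  qed
  then have d0: "degree (Irr K (s [^] (2 ^ 0 :: nat))) \<le> d" using s by simp
  have sq: "s [^] (2 ^ Suc j :: nat) = (s [^] (2 ^ j :: nat)) [^] (2::nat)" for j
    using s by (simp add: nat_pow_pow mult.commute)
  have sub: "E (Suc j) \<subseteq> E j" for j
  proof -
    have r: "subring (E j) R" unfolding E_def by (rule simple_extension_is_subring[OF subfieldE(1)[OF K] sj])
    have "s [^] (2 ^ j :: nat) \<in> E j" unfolding E_def by (rule simple_extension_mem[OF subfieldE(1)[OF K] sj])
    then have "s [^] (2 ^ Suc j :: nat) \<in> E j" unfolding sq using subringE(6)[OF r] s by (simp add: numeral_2_eq_2)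
    moreover have "K \<subseteq> E j" unfolding E_def by (rule simple_extension_incl[OF subfieldE(3)[OF K] sj])
    ultimately show ?thesis unfolding E_def[of "Suc j"] using simple_extension_subring_incl[OF r] by blast
  qed
  have "\<exists>j\<le>d. E j = E (Suc j)"
  proof (rule ccontr)
    assume no: "\<not> ?thesis"
    have "j \<le> Suc d \<Longrightarrow> degree (Irr K (s [^] (2 ^ j :: nat))) + j \<le> d" for j
    proof (induction j)
      case 0 then show ?case using d0 by simp
    next
      case (Suc j)
      then have "j \<le> d" by simp
      then have "E (Suc j) \<noteq> E j" using no by metis
      then have "degree (Irr K (s [^] (2 ^ Suc j :: nat))) < degree (Irr K (s [^] (2 ^ j :: nat)))"
        using proper_subspace_dimension_less[OF K dimE dimE sub] by blast
      then show ?case using Suc by simp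
    qed
    from this[of "Suc d"] show False by simp
  qed
  then obtain j where j: "j \<le> d" "E j = E (Suc j)" by blast
  have "s [^] (2 ^ j :: nat) \<in> E j" unfolding E_def by (rule simple_extension_mem[OF subfieldE(1)[OF K] sj])
  then have "s [^] (2 ^ j :: nat) \<in> E (Suc j)" using j(2) by simp
  moreover have "c [^] (2 ^ (d - j) :: nat) \<in> K" if "c \<in> K" for c
  proof -
    have "c [^] (m::nat) \<in> K" for m using that subringE(3,6)[OF subfieldE(1)[OF K]] by (induction m) auto
    then show ?thesis .
  qed
  ultimately have "(s [^] (2 ^ j :: nat)) [^] (2 ^ (d - j) :: nat)
      \<in> simple_extension K ((s [^] (2 ^ Suc j :: nat)) [^] (2 ^ (d - j) :: nat))"
    unfolding E_def using frobenius_simple_extension[OF subfieldE(3)[OF K] _ sj] by blast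
  moreover have "(2::nat) ^ j * 2 ^ (d - j) = 2 ^ d" "(2::nat) ^ Suc j * 2 ^ (d - j) = 2 ^ d * 2"
    using j(1) by (simp_all flip: power_add)
  ultimately show ?thesis using s by (simp only: nat_pow_pow)
qed

text \<open>
  The field \<open>E\<close> generated by \<open>us\<close> is separable over \<open>K\<close>: it is spanned over \<open>K\<close> by the squares of
  its elements, so the squares of a basis of \<open>E\<close> are again a basis. If \<open>y\<close> were not in \<open>K\<close>, there
  would be a basis containing \<open>y\<close> and \<open>\<one>\<close>, whose squares are both in \<open>K\<close> and thus dependent.
\<close>

lemma square_mem_imp_mem:
  assumes K: "subfield K R" and us: "set us \<subseteq> carrier R" "\<And>u. u \<in> set us \<Longrightarrow> (algebraic over K) u"
    "\<And>u. u \<in> set us \<Longrightarrow> u \<in> simple_extension K (u [^] (2::nat))"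
    and y: "y \<in> finite_extension K us" "y [^] (2::nat) \<in> K"
  shows "y \<in> K"
proof (rule ccontr)
  assume yK: "y \<notin> K"
  note Kc = subfieldE(3)[OF K] and Ks = subringE[OF subfieldE(1)[OF K]]
  define E where "E = finite_extension K us"
  have E: "subring E R" "K \<subseteq> E" unfolding E_def
    using finite_extension_is_subring[OF subfieldE(1)[OF K] us(1)] finite_extension_incl[OF Kc us(1)] by auto
  obtain n where n: "dimension n K E"
    using finite_extension_finite_dimension(1)[OF K us(1,2)] by (auto simp: E_def finite_dimension_def)
  have yE: "y \<in> E" using y by (simp add: E_def)
  have yc: "y \<in> carrier R" using yE subringE(1)[OF E(1)] by blast
  have one: "\<one> \<in> E" using subringE(3)[OF E(1)] .
  have "y \<notin> Span K [\<one>]"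
  proof
    assume "y \<in> Span K [\<one>]"
    then obtain k where "k \<in> K" "y = k \<otimes> \<one> \<oplus> \<zero>" by (auto simp: line_extension_mem_iff)
    then show False using yK Kc by auto
  qed
  then have "independent K [y, \<one>]" using yc by (intro independent.intros) auto
  then obtain Vs where Vs: "length (Vs @ [y, \<one>]) = n" "independent K (Vs @ [y, \<one>])" "Span K (Vs @ [y, \<one>]) = E"
    using complete_base[OF K n, of "[y, \<one>]"] yE one by auto
  define B where "B = Vs @ [y, \<one>]"
  define sq where "sq x = x [^] (2::nat)" for x
  have Bc: "set B \<subseteq> carrier R" using independent_in_carrier[OF Vs(2)] by (simp add: B_def)
  have sqc: "sq x \<in> carrier R" if "x \<in> carrier R" for x using that by (simp add: sq_def)
  define Ws where "Ws = map sq Vs @ [\<one>]"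
  have Wc: "set Ws \<subseteq> carrier R" using Bc sqc by (auto simp: Ws_def B_def)
  note Sp = Span_subgroup_props[OF K Wc] and Sm = Span_smult_closed[OF K Wc]
  have oneW: "\<one> \<in> Span K Ws" using Span_base_incl[OF K Wc] by (auto simp: Ws_def)
  have KW: "K \<subseteq> Span K Ws"
  proof
    fix k assume "k \<in> K"
    then show "k \<in> Span K Ws" using Sm[OF _ oneW] Kc by force
  qed
  have sqB: "set (map sq B) \<subseteq> Span K Ws"
    using Span_base_incl[OF K Wc] y(2) KW oneW by (auto simp: B_def Ws_def sq_def)
  have sq_comb: "sq (combine Ks Us) = combine (map sq Ks) (map sq Us)"
    if "set Ks \<subseteq> carrier R" "set Us \<subseteq> carrier R" for Ks Us
    using that
  proof (induction Ks Us rule: combine.induct)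
    case (1 k Ks u Us)
    then show ?case by (simp add: sq_def square_add nat_pow_distrib)
  qed (simp_all add: sq_def numeral_2_eq_2)
  have sqE: "sq v \<in> Span K Ws" if v: "v \<in> E" for v
  proof -
    obtain Ks where Ks: "set Ks \<subseteq> K" "v = combine Ks B"
      using v Span_mem_iff_length_version[OF K Bc] Vs(3) by (auto simp: B_def)
    have "sq k \<in> K" if "k \<in> K" for k
    proof -
      have "sq k = k \<otimes> k" using that Kc by (auto simp: sq_def numeral_2_eq_2)
      then show ?thesis using subringE(6)[OF subfieldE(1)[OF K] that that] by simp
    qed
    then have "set (map sq Ks) \<subseteq> K" using Ks(1) by auto
    moreover have "sq v = combine (map sq Ks) (map sq B)" using sq_comb[of Ks B] Ks Kc Bc by auto
    ultimately show ?thesis using combine_mem_Span[OF K Wc _ sqB] by simp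
  qed
  have Wel: "\<exists>b\<in>E. w = sq b" if "w \<in> set Ws" for w
  proof -
    have "set Vs \<subseteq> E" using Span_base_incl[OF K, of "Vs @ [y, \<one>]"] Bc Vs(3) by (auto simp: B_def)
    moreover have "sq \<one> = \<one>" by (simp add: sq_def)
    moreover have "w = \<one> \<or> w \<in> sq ` set Vs" using that by (auto simp: Ws_def)
    ultimately show ?thesis using one by (metis imageE subsetD)
  qed
  have W2: "a \<otimes> b \<in> Span K Ws" if "a \<in> set Ws" "b \<in> set Ws" for a b
  proof -
    from Wel[OF that(1)] Wel[OF that(2)]
    obtain a' b' where ab: "a' \<in> E" "a = sq a'" "b' \<in> E" "b = sq b'" by blast
    then have "a' \<in> carrier R" "b' \<in> carrier R" using subringE(1)[OF E(1)] by auto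
    then have "a \<otimes> b = sq (a' \<otimes> b')" using ab(2,4) by (simp add: sq_def nat_pow_distrib)
    then show ?thesis using sqE subringE(6)[OF E(1)] ab by auto
  qed
  have W1: "a \<otimes> b \<in> Span K Ws" if a: "a \<in> Span K Ws" and b: "b \<in> set Ws" for a b
  proof -
    obtain Ks where Ks: "set Ks \<subseteq> K" "a = combine Ks Ws" using a Span_mem_iff_length_version[OF K Wc] by auto
    have "a \<otimes> b = combine Ks (map (\<lambda>u. u \<otimes> b) Ws)"
      unfolding Ks(2) using combine_l_distr[of Ks Ws b] Ks(1) Kc Wc b by auto
    then show ?thesis using combine_mem_Span[OF K Wc Ks(1), of "map (\<lambda>u. u \<otimes> b) Ws"] W2 b by auto
  qed
  have W0: "a \<otimes> b \<in> Span K Ws" if a: "a \<in> Span K Ws" and b: "b \<in> Span K Ws" for a b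
  proof -
    have ac: "a \<in> carrier R" using a Sp(1) by blast
    obtain Ks where Ks: "set Ks \<subseteq> K" "b = combine Ks Ws" using b Span_mem_iff_length_version[OF K Wc] by auto
    have "a \<otimes> b = b \<otimes> a" using a b Sp(1) m_comm by blast
    also have "\<dots> = combine Ks (map (\<lambda>u. u \<otimes> a) Ws)"
      unfolding Ks(2) using combine_l_distr[of Ks Ws a] Ks(1) Kc Wc ac by auto
    also have "\<dots> = combine Ks (map (\<lambda>u. a \<otimes> u) Ws)" using ac Wc m_comm by (intro arg_cong[of _ _ "combine Ks"] map_cong) auto
    finally show ?thesis using combine_mem_Span[OF K Wc Ks(1), of "map (\<lambda>u. a \<otimes> u) Ws"] W1[OF a] by auto
  qed
  \<comment> \<open>\<open>Span K Ws\<close> is the ring generated by \<open>K\<close> and the squares of \<open>E\<close>. It contains \<open>us\<close>, hence is all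
      of \<open>E\<close>, although \<open>Ws\<close> is shorter than the basis \<open>B\<close>.\<close>
  have Wring: "subring (Span K Ws) R"
    by (rule subringI) (use Sp oneW W0 in auto)
  have "u \<in> Span K Ws" if u: "u \<in> set us" for u
  proof -
    have "u \<in> E" unfolding E_def using finite_extension_mem[OF subfieldE(1)[OF K] us(1)] u by blast
    then have "u [^] (2::nat) \<in> Span K Ws" using sqE[of u] by (simp add: sq_def)
    then have "simple_extension K (u [^] (2::nat)) \<subseteq> Span K Ws"
      using simple_extension_subring_incl[OF Wring KW] by blast
    then show ?thesis using us(3)[OF u] by blast
  qed
  then have "E \<subseteq> Span K Ws" unfolding E_def using finite_extension_subring_incl[OF Wring KW] by blast
  moreover have "set B \<subseteq> E" using Span_base_incl[OF K Bc] Vs(3) by (simp add: B_def)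
  ultimately have BW: "set B \<subseteq> Span K Ws" by blast
  obtain m where m: "m \<le> length Ws" "dimension m K (Span K Ws)"
    using dimension_Span_le[OF K Wc] by blast
  have "length B \<le> m" using independent_length_le_dimension[OF K m(2) _ BW] Vs(2) by (simp add: B_def)
  then have "length B \<le> length Ws" using m(1) by simp
  then show False by (simp add: B_def Ws_def)
qed

text \<open>
  The powers \<open>u = s [^] 2 ^ d\<close> of the generators satisfy \<open>u \<in> K(u [^] 2)\<close> and so generate a
  separable extension, which contains \<open>y = x [^] 2 ^ d\<close>. An element of it with a power \<open>y [^] 2 ^ b\<close>
  in \<open>K\<close> lies in \<open>K\<close> already.
\<close>

lemma purely_inseparable_exponent_bound:
  assumes K: "subfield K R"
    and S: "S \<subseteq> carrier R" "\<And>s. s \<in> S \<Longrightarrow> \<exists>p\<in>carrier (K[X]). p \<noteq> [] \<and> degree p \<le> d \<and> eval p s = \<zero>"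
    and x: "x \<in> generate_field R (K \<union> S)" "x [^] (2 ^ a :: nat) \<in> K"
  shows "x [^] (2 ^ d :: nat) \<in> K"
proof -
  have pwK: "c [^] (m::nat) \<in> K" if "c \<in> K" for c m
    using that subringE(3,6)[OF subfieldE(1)[OF K]] by (induction m) auto
  have algS: "(algebraic over K) s" if "s \<in> S" for s using S(2)[OF that] algebraicI by blast
  have xc: "x \<in> carrier R" using generate_field_in_carrier[OF _ x(1)] S(1) subfieldE(3)[OF K] by blast
  obtain xs where xs: "set xs \<subseteq> S" "x \<in> finite_extension K xs"
    using generate_field_finitary[OF K S(1) algS x(1)] by blast
  define us where "us = map (\<lambda>x. x [^] (2 ^ d :: nat)) xs"
  have us: "set us \<subseteq> carrier R" using xs(1) S(1) by (auto simp: us_def)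
  have usx: "u \<in> simple_extension K (u [^] (2::nat))" if "u \<in> set us" for u
  proof -
    from that obtain s where s: "s \<in> S" "u = s [^] (2 ^ d :: nat)" using xs(1) by (auto simp: us_def)
    obtain p where "p\<in>carrier (K[X])" "p \<noteq> []" "degree p \<le> d" "eval p s = \<zero>" using S(2)[OF s(1)] by blast
    then show ?thesis using frobenius_stabilizes[OF K, of s p d] s S(1) by blast
  qed
  have usa: "(algebraic over K) u" if "u \<in> set us" for u
  proof -
    from that obtain s where s: "s \<in> S" "u = s [^] (2 ^ d :: nat)" using xs(1) by (auto simp: us_def)
    have sc: "s \<in> carrier R" using s S(1) by blast
    have "s [^] (i::nat) \<in> simple_extension K s" for i
      using simple_extension_is_subring[OF subfieldE(1)[OF K] sc] simple_extension_mem[OF subfieldE(1)[OF K] sc]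
      by (induction i) (auto dest: subringE(3,6))
    then show ?thesis using simple_extesion_mem_imp_algebraic[OF K sc algS[OF s(1)]] s(2) by blast
  qed
  define y where "y = x [^] (2 ^ d :: nat)"
  have yE: "y \<in> finite_extension K us"
    unfolding y_def us_def using frobenius_finite_extension[OF K _ xs(2)] xs(1) S(1) by blast
  have yc: "y \<in> carrier R" using xc by (simp add: y_def)
  have pwE: "y [^] (m::nat) \<in> finite_extension K us" for m
    using yE finite_extension_is_subring[OF subfieldE(1)[OF K] us] by (induction m) (auto dest: subringE(3,6))
  have desc: "y [^] (2 ^ b :: nat) \<in> K \<Longrightarrow> y \<in> K" for b
  proof (induction b)
    case 0 then show ?case using yc by simp
  next
    case (Suc b)
    have "(y [^] (2 ^ b :: nat)) [^] (2::nat) \<in> K" using Suc.prems yc by (simp add: nat_pow_pow mult.commute)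
    then have "y [^] (2 ^ b :: nat) \<in> K" using square_mem_imp_mem[OF K us usa usx pwE] by blast
    then show ?case by (rule Suc.IH)
  qed
  have "y [^] (2 ^ a :: nat) = (x [^] (2 ^ a :: nat)) [^] (2 ^ d :: nat)"
    unfolding y_def using xc by (simp add: nat_pow_pow mult.commute)
  then have "y [^] (2 ^ a :: nat) \<in> K" using pwK[OF x(2)] by simp
  then show ?thesis using desc by (simp add: y_def)
qed

text \<open>
  Write \<open>n = 2 ^ a * m\<close> with \<open>m\<close> odd. The factor \<open>2 ^ d\<close> of the exponent replaces \<open>2 ^ a\<close>, and the
  factor \<open>2 ^ fact d - 1\<close> replaces \<open>m\<close>. The bound for the odd part needs conjugates, so everything
  is transported along the embedding \<open>h\<close> into an algebraic closure \<open>L\<close>.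
\<close>

lemma root_exponent_bound:
  assumes tf: "torsion_free_group (unit_group R)" and K: "subfield K R"
    and S: "S \<subseteq> carrier R" "\<And>s. s \<in> S \<Longrightarrow> \<exists>p\<in>carrier (K[X]). p \<noteq> [] \<and> degree p \<le> d \<and> eval p s = \<zero>"
    and gen: "generate_field R (K \<union> S) = carrier R"
    and x: "x \<in> carrier R" "n > 0" "x [^] (n::nat) \<in> K"
  shows "x [^] (2 ^ d * (2 ^ fact d - 1) :: nat) \<in> K"
proof -
  note Kc = subfieldE(3)[OF K]
  have algS: "(algebraic over K) s" if "s \<in> S" for s using S(2)[OF that] algebraicI by blast
  have alg: "(algebraic over K) z" if "z \<in> carrier R" for z
    using algebraic_if_generated_by_algebraic[OF K S(1) algS] that gen by simp
  obtain m where "n = 2 ^ multiplicity 2 n * m" "odd m"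
    by (rule multiplicity_decompose'[of n 2]) (use x(2) in auto)
  then obtain a where am: "n = 2 ^ a * m" "odd m" by blast
  have "(x [^] m) [^] (2 ^ a :: nat) \<in> K" using x am by (simp add: nat_pow_pow mult.commute)
  then have "(x [^] m) [^] (2 ^ d :: nat) \<in> K"
    using purely_inseparable_exponent_bound[OF K S] x(1) gen by simp
  moreover define w where "w = x [^] (2 ^ d :: nat)"
  ultimately have wm: "w [^] m \<in> K" using x(1) by (simp add: nat_pow_pow mult.commute)
  have wc: "w \<in> carrier R" using x(1) by (simp add: w_def)
  obtain L :: "((('a list \<times> nat) multiset) \<Rightarrow> 'a) ring" where L: "algebraic_closure L (indexed_const ` carrier R)"
    and h: "(indexed_const :: 'a \<Rightarrow> (('a list \<times> nat) multiset \<Rightarrow> 'a)) \<in> ring_hom R L" by (rule exists_closure)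
  define h where "h = (indexed_const :: 'a \<Rightarrow> (('a list \<times> nat) multiset \<Rightarrow> 'a))"
  interpret L: algebraic_closure L "h ` carrier R" using L by (simp add: h_def)
  have hh: "h \<in> ring_hom R L" using h by (simp add: h_def)
  interpret H: ring_hom_ring R L h by (rule ring_hom_ringI2[OF ring_axioms L.ring_axioms hh])
  have inj: "inj_on h (carrier R)" unfolding h_def by (rule indexed_const_inj_on)
  interpret L2: char2_algebraically_closed L
  proof
    have "h (\<one> \<oplus> \<one>) = h \<zero>" using one_plus_one by simp
    then show "\<one>\<^bsub>L\<^esub> \<oplus>\<^bsub>L\<^esub> \<one>\<^bsub>L\<^esub> = \<zero>\<^bsub>L\<^esub>" by (simp del: one_plus_one)
  qed
  have K': "subfield (h ` K) L" using H.img_is_subfield(2)[OF K L.one_not_zero] .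
  have hpow: "h (z [^] (i::nat)) = h z [^]\<^bsub>L\<^esub> i" if "z \<in> carrier R" for z i
    using that by (induction i) auto
  have alg': "(L.algebraic over (h ` K)) z" if z: "z \<in> carrier L" for z
  proof (rule L.algebraic_trans[OF K' L.subfield_axioms _ _ z L.algebraic_extension[OF z]])
    show "(L.algebraic over (h ` K)) m" if "m \<in> h ` carrier R" for m
      using that algebraic_hom[OF hh field_axioms L.field_axioms K] alg by blast
    show "h ` K \<subseteq> h ` carrier R" using Kc by blast
  qed
  have gen': "h z \<in> generate_field L (h ` K \<union> h ` S)" if "z \<in> generate_field R (K \<union> S)" for z
    using that
  proof (induction rule: generate_field.induct)
    case one then show ?case by (simp add: generate_field.one)
  next
    case (incl z) then show ?case by (auto intro: generate_field.incl)
  next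
    case (a_inv z)
    then show ?case using gen generate_field.a_inv by fastforce
  next
    case (m_inv z)
    have zc: "z \<in> carrier R" using m_inv gen by blast
    note iz = nonzero_simps[OF zc m_inv(2)]
    have hz: "h z \<noteq> \<zero>\<^bsub>L\<^esub>" using inj m_inv(2) zc H.hom_zero by (metis inj_on_def zero_closed)
    have "h z \<otimes>\<^bsub>L\<^esub> h (inv z) = \<one>\<^bsub>L\<^esub>" using H.hom_mult[OF zc iz(1)] iz(3) by simp
    then have "inv\<^bsub>L\<^esub> (h z) = h (inv z)" using L.comm_inv_char zc iz(1) H.hom_closed by blast
    then show ?case using generate_field.m_inv[OF m_inv(3) hz] by simp
  next
    case (eng_add z1 z2)
    then show ?case using gen generate_field.eng_add[of "h z1" L _ "h z2"] by auto
  next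
    case (eng_mult z1 z2)
    then show ?case using gen generate_field.eng_mult[of "h z1" L _ "h z2"] by auto
  qed
  have "h w [^]\<^bsub>L\<^esub> (2 ^ fact d - 1 :: nat) \<in> h ` K"
  proof (rule L2.odd_root_exponent_bound[OF K' alg' _ _ _ _ am(2)])
    show "h ` S \<subseteq> carrier L" using S(1) by auto
    show "\<exists>p\<in>carrier ((h ` K)[X]\<^bsub>L\<^esub>). p \<noteq> [] \<and> degree p \<le> d \<and> L.eval p s = \<zero>\<^bsub>L\<^esub>" if "s \<in> h ` S" for s
    proof -
      obtain z where z: "z \<in> S" "s = h z" using \<open>s \<in> h ` S\<close> by blast
      obtain p where p: "p\<in>carrier (K[X])" "p \<noteq> []" "degree p \<le> d" "eval p z = \<zero>" using S(2)[OF z(1)] by blast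
      have "map h p \<in> carrier ((h ` K)[X]\<^bsub>L\<^esub>)" using H.subfield_polynomial_hom[OF K L.one_not_zero p(1)] .
      moreover have "L.eval (map h p) s = \<zero>\<^bsub>L\<^esub>"
        using H.eval_hom[OF subfieldE(1)[OF K] _ p(1), of z] z S(1) p(4) by auto
      ultimately show ?thesis using p by (intro bexI[of _ "map h p"]) auto
    qed
    show "c = \<one>\<^bsub>L\<^esub>" if c: "c \<in> h ` K" "i > 0" "c [^]\<^bsub>L\<^esub> (i::nat) = \<one>\<^bsub>L\<^esub>" for c i
    proof -
      obtain k where k: "k \<in> K" "c = h k" using c by blast
      have kc: "k \<in> carrier R" using k Kc by blast
      have "h (k [^] i) = h \<one>" using c k hpow[OF kc] by simp
      then have ki: "k [^] i = \<one>" using inj kc by (simp add: inj_on_def)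
      then have "k \<noteq> \<zero>" using c(2) nat_pow_zero[of i] by auto
      then have "k = \<one>" using torsion_freeD[OF tf kc _ c(2) ki] by blast
      then show ?thesis using k by simp
    qed
    show "h w \<in> generate_field L (h ` K \<union> h ` S)" using gen' gen wc by blast
    show "h w [^]\<^bsub>L\<^esub> m \<in> h ` K" using hpow[OF wc] wm by (metis image_eqI)
  qed
  then obtain k where k: "k \<in> K" "h (w [^] (2 ^ fact d - 1 :: nat)) = h k" using hpow[OF wc] by auto
  then have "w [^] (2 ^ fact d - 1 :: nat) = k" using inj wc Kc by (auto simp: inj_on_def)
  then show ?thesis using k(1) x(1) by (simp add: w_def nat_pow_pow)
qed

end

section \<open>Extending homomorphisms along root closures\<close>

context comm_group
begin

lemma additive_on_generate_zero:
  assumes A: "subgroup A G" and f: "additive_on A f" and Y: "Y \<subseteq> A" "\<And>y. y \<in> Y \<Longrightarrow> f y = 0"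
    and g: "g \<in> generate G Y"
  shows "f g = 0"
proof -
  note fp = additive_on_subgroup_props[OF A f]
  have "subgroup {a\<in>A. f a = 0} G"
    using subgroup.subset[OF A] f subgroup.one_closed[OF A] subgroup.m_closed[OF A] subgroup.m_inv_closed[OF A]
    by unfold_locales (auto simp: fp additive_on_def)
  then have "generate G Y \<subseteq> {a\<in>A. f a = 0}"
    using Y by (intro generate_subgroup_incl) auto
  then show ?thesis using g by blast
qed

lemma generate_insert_decomp:
  assumes Y: "Y \<subseteq> carrier G" and y: "y \<in> carrier G" and g: "g \<in> generate G (insert y Y)"
  shows "\<exists>h\<in>generate G Y. \<exists>e::int. g = h \<otimes> y [^] e"
proof -
  have H: "subgroup (generate G Y) G" using generate_is_subgroup[OF Y] .
  have "insert y Y \<subseteq> {h \<otimes> y [^] (e::int) | h e. h \<in> generate G Y}"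
    using subgroup_mult_powers(2)[OF H y] generate.incl[of _ Y G] by blast
  from generate_subgroup_incl[OF this subgroup_mult_powers(1)[OF H y]]
  show ?thesis using g by blast
qed

text \<open>
  The elements of \<open>Y\<close> are adjoined one by one. If \<open>x\<close> is independent of the previous ones, take \<open>w1\<close>
  with \<open>w1 x \<noteq> 0\<close>, and \<open>w2\<close> with \<open>w2 z \<noteq> 0\<close> for the element \<open>z = y [^] w1 x \<otimes> x [^] (- w1 y)\<close> of the
  kernel of \<open>w1\<close>. The combination of \<open>w1\<close> and \<open>w2\<close> that vanishes at \<open>x\<close> takes the value \<open>w2 z\<close> at
  \<open>y\<close>.
\<close>

lemma separate_from_generate:
  assumes A: "subgroup A G" and C: "C \<subseteq> A"
    and sep: "\<And>u. u \<in> A \<Longrightarrow> (\<forall>n>0. u [^] (n::nat) \<notin> generate G C) \<Longrightarrow> \<exists>f. additive_on A f \<and> (\<forall>c\<in>C. f c = 0) \<and> f u \<noteq> 0"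
    and X: "finite Y" "Y \<subseteq> A" and y: "y \<in> A" "\<forall>n>0. y [^] (n::nat) \<notin> generate G (C \<union> Y)"
  shows "\<exists>f. additive_on A f \<and> (\<forall>c\<in>C \<union> Y. f c = 0) \<and> f y \<noteq> 0"
  using X y
proof (induction Y arbitrary: y rule: finite_induct)
  case empty then show ?case using sep by simp
next
  case (insert x Y)
  note Ac = subgroup.mem_carrier[OF A]
  have CY: "C \<union> Y \<subseteq> carrier G" using C insert.prems Ac by auto
  have xA: "x \<in> A" "Y \<subseteq> A" using insert.prems by auto
  have xc: "x \<in> carrier G" and yc: "y \<in> carrier G" using xA insert.prems Ac by auto
  have CxY: "C \<union> insert x Y = insert x (C \<union> Y)" by auto
  have mono: "generate G (C \<union> Y) \<subseteq> generate G (C \<union> insert x Y)" by (intro mono_generate) auto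
  have H: "subgroup (generate G (C \<union> insert x Y)) G"
    using generate_is_subgroup[of "C \<union> insert x Y"] CY xc by auto
  show ?case
  proof (cases "\<exists>n>0. x [^] (n::nat) \<in> generate G (C \<union> Y)")
    case True
    then obtain n :: nat where n: "n > 0" "x [^] n \<in> generate G (C \<union> Y)" by blast
    have "\<forall>n>0. y [^] (n::nat) \<notin> generate G (C \<union> Y)" using insert.prems(3) mono by blast
    then obtain f where f: "additive_on A f" "\<forall>c\<in>C \<union> Y. f c = 0" "f y \<noteq> 0"
      using insert.IH[OF xA(2) insert.prems(2)] by blast
    have "f (x [^] n) = 0" using additive_on_generate_zero[OF A f(1) _ _ n(2)] f(2) C xA by blast
    then have "f x = 0" using additive_on_subgroup_props(3)[OF A f(1) xA(1), of n] n(1) by simp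
    then show ?thesis using f by auto
  next
    case False
    then obtain w1 where w1: "additive_on A w1" "\<forall>c\<in>C \<union> Y. w1 c = 0" "w1 x \<noteq> 0"
      using insert.IH[OF xA(2) xA(1)] by blast
    define z where "z = y [^] w1 x \<otimes> x [^] (- w1 y)"
    have zA: "z \<in> A" unfolding z_def
      using subgroup.m_closed[OF A] subgroup_int_pow_closed[OF A] xA insert.prems(2) by blast
    have "z [^] (n::nat) \<notin> generate G (C \<union> Y)" if n: "n > 0" for n
    proof
      assume "z [^] n \<in> generate G (C \<union> Y)"
      then have zn: "z [^] int n \<in> generate G (C \<union> insert x Y)" using mono by (auto simp: int_pow_int)
      have xg: "x \<in> generate G (C \<union> insert x Y)" by (intro generate.incl) auto
      have "z [^] int n \<otimes> x [^] (w1 y * int n) \<in> generate G (C \<union> insert x Y)"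
        using subgroup.m_closed[OF H zn subgroup_int_pow_closed[OF H xg]] .
      also have "z [^] int n = y [^] (w1 x * int n) \<otimes> x [^] (- w1 y * int n)"
        unfolding z_def using xc yc by (simp only: int_pow_mult_distrib m_comm int_pow_pow int_pow_closed)
      also have "\<dots> \<otimes> x [^] (w1 y * int n) = y [^] (w1 x * int n) \<otimes> x [^] (- w1 y * int n + w1 y * int n)"
        using xc yc by (simp only: m_assoc int_pow_mult int_pow_closed)
      also have "\<dots> = y [^] (w1 x * int n)" using yc by simp
      finally have e: "y [^] (w1 x * int n) \<in> generate G (C \<union> insert x Y)" .
      then have "inv (y [^] (w1 x * int n)) \<in> generate G (C \<union> insert x Y)" by (rule subgroup.m_inv_closed[OF H])
      then have e': "y [^] (- (w1 x * int n)) \<in> generate G (C \<union> insert x Y)" using yc by (simp only: int_pow_neg)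
      have "y [^] \<bar>w1 x * int n\<bar> \<in> generate G (C \<union> insert x Y)" using e e' by (simp add: abs_if)
      then have "y [^] nat \<bar>w1 x * int n\<bar> \<in> generate G (C \<union> insert x Y)" by (simp add: pow_nat)
      moreover have "nat \<bar>w1 x * int n\<bar> > 0" using n w1(3) by simp
      ultimately show False using insert.prems(3) by blast
    qed
    then obtain w2 where w2: "additive_on A w2" "\<forall>c\<in>C \<union> Y. w2 c = 0" "w2 z \<noteq> 0"
      using insert.IH[OF xA(2) zA] by blast
    define w where "w g = w1 x * w2 g - w2 x * w1 g" for g
    have "additive_on A w" using w1(1) w2(1) by (auto simp: additive_on_def w_def algebra_simps)
    moreover have "w c = 0" if "c \<in> C \<union> insert x Y" for c using that w1(2) w2(2) by (auto simp: w_def)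
    moreover have "w2 z = w1 x * w2 y - w1 y * w2 x"
    proof -
      have "w2 z = w2 (y [^] w1 x) + w2 (x [^] (- w1 y))"
        unfolding z_def using w2(1) subgroup_int_pow_closed[OF A] xA insert.prems(2) unfolding additive_on_def by blast
      then show ?thesis using additive_on_subgroup_props(4)[OF A w2(1)] xA insert.prems(2) by (simp del: int_pow_neg)
    qed
    then have "w y \<noteq> 0" using w2(3) by (simp add: w_def mult.commute)
    ultimately show ?thesis by blast
  qed
qed

text \<open>
  The root closure of the subgroup generated by \<open>Y\<close>: the quotient by it is the largest torsion-free
  quotient of the group in which \<open>Y\<close> becomes trivial.
\<close>

definition isolator :: "'a set \<Rightarrow> 'a set"
  where "isolator Y = {g\<in>carrier G. \<exists>n>0. g [^] (n::nat) \<in> generate G Y}"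

lemma subgroup_isolator:
  assumes Y: "Y \<subseteq> carrier G" shows "subgroup (isolator Y) G"
proof -
  have H: "subgroup (generate G Y) G" using generate_is_subgroup[OF Y] .
  have npow: "a [^] (n::nat) \<in> generate G Y" if "a \<in> generate G Y" for a n
    using subgroup_int_pow_closed[OF H that, of "int n"] by (simp only: int_pow_int)
  show ?thesis
  proof (rule subgroupI)
    show "isolator Y \<subseteq> carrier G" by (auto simp: isolator_def)
    show "isolator Y \<noteq> {}" using subgroup.one_closed[OF H] by (auto simp: isolator_def intro!: exI[of _ \<one>] exI[of _ 1])
    show "inv a \<in> isolator Y" if "a \<in> isolator Y" for a
      using that subgroup.m_inv_closed[OF H] by (auto simp: isolator_def nat_pow_inv)
    show "a \<otimes> b \<in> isolator Y" if ab: "a \<in> isolator Y" "b \<in> isolator Y" for a b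
    proof -
      obtain n m :: nat where nm: "n > 0" "a [^] n \<in> generate G Y" "m > 0" "b [^] m \<in> generate G Y"
        and c: "a \<in> carrier G" "b \<in> carrier G" using ab by (auto simp: isolator_def)
      have "(a \<otimes> b) [^] (n * m) = (a [^] n) [^] m \<otimes> (b [^] m) [^] n"
        using c by (simp add: nat_pow_distrib nat_pow_pow mult.commute)
      then have "(a \<otimes> b) [^] (n * m) \<in> generate G Y" using npow nm subgroup.m_closed[OF H] by simp
      then show ?thesis using c nm(1,3) by (auto simp: isolator_def intro!: exI[of _ "n * m"])
    qed
  qed
qed

lemma isolator_incl: "Y \<subseteq> carrier G \<Longrightarrow> Y \<subseteq> isolator Y"
  by (auto simp: isolator_def generate.incl intro!: exI[of _ 1])

lemma isolator_mono: "Y \<subseteq> Z \<Longrightarrow> isolator Y \<subseteq> isolator Z"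
  using mono_generate[of Y Z] by (auto simp: isolator_def)

text \<open>
  The hypothesis \<open>loc\<close> says of each finitely generated piece over \<open>C\<close> that it lies in a subgroup \<open>A\<close>
  on which the homomorphisms to the integers that vanish on \<open>C\<close> separate the elements outside the
  root closure of \<open>C\<close>, and that roots of elements of \<open>A\<close> return to \<open>A\<close> after a bounded exponent. The
  bound is what makes the root closures below finitely generated modulo each other.
\<close>

context
  fixes C
  assumes C: "C \<subseteq> carrier G"
    and loc: "\<And>Y. finite Y \<Longrightarrow> Y \<subseteq> carrier G \<Longrightarrow> \<exists>N A. N > 0 \<and> subgroup A G \<and> C \<union> Y \<subseteq> A \<and>
      (\<forall>u\<in>carrier G. \<forall>n>0. u [^] (n::nat) \<in> A \<longrightarrow> u [^] (N::nat) \<in> A) \<and>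
      (\<forall>u\<in>A. (\<forall>n>0. u [^] (n::nat) \<notin> generate G C) \<longrightarrow> (\<exists>f. additive_on A f \<and> (\<forall>c\<in>C. f c = 0) \<and> f u \<noteq> 0))"
begin

text \<open>
  With a homomorphism \<open>w0\<close> on \<open>A\<close> that separates \<open>y\<close> from \<open>Y\<close>, the function \<open>w g = w0 (g [^] N)\<close> is
  defined on the larger isolator. An element \<open>g\<close> of it has a positive power of the form
  \<open>h \<otimes> y [^] e\<close> with \<open>h\<close> generated by \<open>C \<union> Y\<close>, and \<open>w g = 0\<close> forces \<open>e = 0\<close>.
\<close>

lemma additive_on_isolator_separates:
  assumes Y: "finite Y" "Y \<subseteq> carrier G" and y: "y \<in> carrier G" "y \<notin> isolator (C \<union> Y)"
  shows "\<exists>w. additive_on (isolator (C \<union> insert y Y)) w \<and> (\<forall>g\<in>isolator (C \<union> insert y Y). w g = 0 \<longleftrightarrow> g \<in> isolator (C \<union> Y)) \<and> w y \<noteq> 0"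
proof -
  obtain N A where NA: "N > 0" "subgroup A G" "C \<union> insert y Y \<subseteq> A"
    "\<And>u n. u\<in>carrier G \<Longrightarrow> n>0 \<Longrightarrow> u [^] (n::nat) \<in> A \<Longrightarrow> u [^] (N::nat) \<in> A"
    and sep: "\<And>u. u \<in> A \<Longrightarrow> (\<forall>n>0. u [^] (n::nat) \<notin> generate G C) \<Longrightarrow> (\<exists>f. additive_on A f \<and> (\<forall>c\<in>C. f c = 0) \<and> f u \<noteq> 0)"
    using loc[of "insert y Y"] Y y(1) by (smt (verit) finite.insertI insert_subset)
  have yn: "\<forall>n>0. y [^] (n::nat) \<notin> generate G (C \<union> Y)" using y unfolding isolator_def by blast
  obtain w0 where w0: "additive_on A w0" "\<forall>c\<in>C \<union> Y. w0 c = 0" "w0 y \<noteq> 0"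
    using separate_from_generate[OF NA(2) _ sep Y(1) _ _ yn] NA(3) by auto
  define H' where "H' = isolator (C \<union> insert y Y)"
  have genA: "generate G (C \<union> insert y Y) \<subseteq> A" using NA(2,3) by (intro generate_subgroup_incl)
  have genYA: "generate G (C \<union> Y) \<subseteq> A" using NA(2,3) by (intro generate_subgroup_incl) auto
  have NA': "g [^] N \<in> A" "g \<in> carrier G" if "g \<in> H'" for g
    using that NA(4) genA by (auto simp: H'_def isolator_def)
  define w where "w g = w0 (g [^] N)" for g
  have wadd: "w (g \<otimes> h) = w g + w h" if "g \<in> H'" "h \<in> H'" for g h
    using that NA' w0(1) by (simp add: w_def nat_pow_distrib additive_on_def)
  have wH: "additive_on H' w" using wadd by (simp add: additive_on_def)
  have CyY: "C \<union> insert y Y \<subseteq> carrier G" using C Y y by auto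
  have H': "subgroup H' G" unfolding H'_def by (rule subgroup_isolator[OF CyY])
  note wp = additive_on_subgroup_props[OF H' wH]
  have yH: "y \<in> H'" unfolding H'_def using isolator_incl[OF CyY] by blast
  have yA: "y \<in> A" using NA(3) by blast
  have wy: "w y \<noteq> 0" using additive_on_subgroup_props(3)[OF NA(2) w0(1) yA, of N] NA(1) w0(3) by (simp add: w_def)
  have sub: "isolator (C \<union> Y) \<subseteq> H'" unfolding H'_def by (intro isolator_mono) auto
  have gen0: "w h = 0" if h: "h \<in> generate G (C \<union> Y)" for h
  proof -
    have "w0 h = 0" using additive_on_generate_zero[OF NA(2) w0(1) _ _ h] w0(2) NA(3) by blast
    then show ?thesis using additive_on_subgroup_props(3)[OF NA(2) w0(1)] h genYA by (auto simp: w_def)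
  qed
  have ker1: "w g = 0" if g: "g \<in> isolator (C \<union> Y)" for g
  proof -
    obtain n :: nat where n: "n > 0" "g [^] n \<in> generate G (C \<union> Y)" using g by (auto simp: isolator_def)
    then have "int n * w g = 0" using gen0[OF n(2)] wp(3)[of g n] sub g by auto
    then show ?thesis using n(1) by simp
  qed
  have ker2: "g \<in> isolator (C \<union> Y)" if g: "g \<in> H'" "w g = 0" for g
  proof -
    obtain n :: nat where n: "n > 0" "g [^] n \<in> generate G (C \<union> insert y Y)" and gc: "g \<in> carrier G"
      using g by (auto simp: H'_def isolator_def)
    have CY: "C \<union> Y \<subseteq> carrier G" using CyY by auto
    have "C \<union> insert y Y = insert y (C \<union> Y)" by auto
    then obtain h and e :: int where he: "h \<in> generate G (C \<union> Y)" "g [^] n = h \<otimes> y [^] e"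
      using generate_insert_decomp[OF CY y(1), of "g [^] n"] n(2) by auto
    have hc: "h \<in> carrier G" using generate_in_carrier[OF CY he(1)] .
    have "generate G (C \<union> Y) \<subseteq> generate G (C \<union> insert y Y)" by (intro mono_generate) auto
    then have hH: "h \<in> H'" using he(1) hc by (auto simp: H'_def isolator_def intro!: exI[of _ 1])
    have "0 = w (g [^] n)" using wp(3)[OF g(1)] g(2) by simp
    also have "\<dots> = w h + w (y [^] e)" unfolding he(2) using wadd[OF hH subgroup_int_pow_closed[OF H' yH]] .
    also have "\<dots> = e * w y" using gen0[OF he(1)] wp(4)[OF yH] by simp
    finally have "e = 0" using wy by simp
    then have "g [^] n \<in> generate G (C \<union> Y)" using he hc by simp
    then show ?thesis using n(1) gc by (auto simp: isolator_def)
  qed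
  show ?thesis using wH ker1 ker2 wy unfolding H'_def by blast
qed

text \<open>
  Unless the two isolators are equal, their quotient embeds into the integers by
  \<open>additive_on_isolator_separates\<close>. It is then infinite cyclic, generated by an element \<open>z\<close>, and \<open>f\<close>
  can be extended by \<open>0\<close> on \<open>z\<close>; the map \<open>r\<close> is the projection along \<open>z\<close>.
\<close>

lemma additive_on_isolator_extend:
  assumes Y: "finite Y" "Y \<subseteq> carrier G" and y: "y \<in> carrier G" and f: "additive_on (isolator (C \<union> Y)) f"
  shows "\<exists>f'. additive_on (isolator (C \<union> insert y Y)) f' \<and> (\<forall>g\<in>isolator (C \<union> Y). f' g = f g)"
proof (cases "y \<in> isolator (C \<union> Y)")
  case True
  have CY: "C \<union> Y \<subseteq> carrier G" using C Y by auto
  have I: "subgroup (isolator (C \<union> Y)) G" using subgroup_isolator[OF CY] .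
  have "C \<union> insert y Y \<subseteq> isolator (C \<union> Y)" using isolator_incl[OF CY] True by auto
  then have gen: "generate G (C \<union> insert y Y) \<subseteq> isolator (C \<union> Y)" using I by (intro generate_subgroup_incl)
  have "isolator (C \<union> insert y Y) \<subseteq> isolator (C \<union> Y)"
  proof
    fix g assume g: "g \<in> isolator (C \<union> insert y Y)"
    then obtain n :: nat where n: "n > 0" "g \<in> carrier G" "g [^] n \<in> isolator (C \<union> Y)" using gen by (auto simp: isolator_def)
    then obtain m :: nat where m: "m > 0" "(g [^] n) [^] m \<in> generate G (C \<union> Y)" by (auto simp: isolator_def)
    then show "g \<in> isolator (C \<union> Y)" using n(1,2)
      by (auto simp: isolator_def nat_pow_pow intro!: exI[of _ "n * m"])
  qed
  then show ?thesis using f by (intro exI[of _ f]) (auto simp: additive_on_def)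
next
  case False
  define H where "H = isolator (C \<union> Y)"
  define H' where "H' = isolator (C \<union> insert y Y)"
  obtain w where w: "additive_on H' w" "\<And>g. g\<in>H' \<Longrightarrow> w g = 0 \<longleftrightarrow> g \<in> H" "w y \<noteq> 0"
    using additive_on_isolator_separates[OF Y y False] unfolding H_def H'_def by blast
  have CyY: "C \<union> insert y Y \<subseteq> carrier G" using C Y y by auto
  have H': "subgroup H' G" unfolding H'_def by (rule subgroup_isolator[OF CyY])
  have yH: "y \<in> H'" unfolding H'_def using isolator_incl[OF CyY] by blast
  have HH': "H \<subseteq> H'" unfolding H_def H'_def by (intro isolator_mono) auto
  note wp = additive_on_subgroup_props[OF H' w(1)]
  obtain z where z: "z \<in> H'" "w z > 0" "\<And>x. x \<in> H' \<Longrightarrow> w z dvd w x"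
    using exists_generating_value[OF H' w(1) yH w(3)] by blast
  note H'c = subgroup.mem_carrier[OF H']
  have zp: "z [^] (e::int) \<in> H'" for e using subgroup_int_pow_closed[OF H' z(1)] .
  define q where "q g = w g div w z" for g
  define r where "r g = g \<otimes> z [^] (- q g)" for g
  have rH: "r g \<in> H" if g: "g \<in> H'" for g
  proof -
    have rg: "r g \<in> H'" unfolding r_def using subgroup.m_closed[OF H' g zp] .
    have "w (r g) = w g + w (z [^] (- q g))" unfolding r_def using w(1) g zp unfolding additive_on_def by blast
    also have "\<dots> = w g - q g * w z" using wp(4)[OF z(1), of "- q g"] by simp
    also have "\<dots> = 0" unfolding q_def using z(3)[OF g] by simp
    finally show ?thesis using w(2)[OF rg] by simp
  qed
  define f' where "f' g = f (r g)" for g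
  have "f' (g \<otimes> h) = f' g + f' h" if gh: "g \<in> H'" "h \<in> H'" for g h
  proof -
    have "w (g \<otimes> h) = w g + w h" using w(1) gh by (simp add: additive_on_def)
    then have q: "q (g \<otimes> h) = q g + q h" unfolding q_def using div_plus_div_distrib_dvd_left[OF z(3)[OF gh(1)]] by simp
    have "r (g \<otimes> h) = r g \<otimes> r h"
      unfolding r_def q using gh H'c z(1) int_pow_mult[of z "- q g" "- q h"] by (simp add: m_ac del: int_pow_neg)
    then show ?thesis using f rH[OF gh(1)] rH[OF gh(2)] by (simp add: f'_def additive_on_def H_def)
  qed
  moreover have "f' g = f g" if g: "g \<in> H" for g
  proof -
    have "w g = 0" using w(2)[of g] g HH' by blast
    then have "r g = g" unfolding r_def q_def using g HH' H'c by auto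
    then show ?thesis by (simp add: f'_def)
  qed
  ultimately show ?thesis unfolding H_def H'_def additive_on_def by (intro exI[of _ f']) auto
qed

text \<open>
  As in Pontryagin's criterion for countable groups, the elements are adjoined one after the other
  in an enumeration, and the homomorphism is extended at each step.
\<close>

lemma exists_additive_if_locally_separated:
  assumes count: "countable (carrier G)" and x0: "x0 \<in> carrier G" "\<forall>n>0. x0 [^] (n::nat) \<notin> generate G C"
  shows "\<exists>f. additive_on (carrier G) f \<and> f x0 \<noteq> 0"
proof -
  define e where "e = from_nat_into (carrier G)"
  have e: "range e = carrier G" unfolding e_def using count x0(1) by (intro range_from_nat_into) auto
  define Y where "Y i = insert x0 (e ` {..<i})" for i :: nat
  have Y: "finite (Y i)" "Y i \<subseteq> carrier G" for i using e x0 by (auto simp: Y_def)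
  have YS: "Y (Suc i) = insert (e i) (Y i)" for i by (auto simp: Y_def lessThan_Suc)
  define I where "I i = isolator (C \<union> Y i)" for i
  have "x0 \<notin> isolator (C \<union> {})" using x0 by (auto simp: isolator_def)
  then obtain f0 where f0: "additive_on (I 0) f0" "f0 x0 \<noteq> 0"
    using additive_on_isolator_separates[of "{}" x0] x0(1) by (auto simp: I_def Y_def)
  have "\<exists>F. \<forall>i. (additive_on (I i) (F i) \<and> (i = 0 \<longrightarrow> F i x0 \<noteq> 0)) \<and> (\<forall>g\<in>I i. F (Suc i) g = F i g)"
  proof (rule dependent_nat_choice)
    show "\<exists>f. additive_on (I 0) f \<and> (0 = (0::nat) \<longrightarrow> f x0 \<noteq> 0)" using f0 by blast
    fix f and i :: nat assume "additive_on (I i) f \<and> (i = 0 \<longrightarrow> f x0 \<noteq> 0)"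
    then show "\<exists>f'. (additive_on (I (Suc i)) f' \<and> (Suc i = 0 \<longrightarrow> f' x0 \<noteq> 0)) \<and> (\<forall>g\<in>I i. f' g = f g)"
      using additive_on_isolator_extend[OF Y(1,2), of "e i" i f] e unfolding I_def YS by auto
  qed
  then obtain F where F: "\<And>i. additive_on (I i) (F i)" "F 0 x0 \<noteq> 0" "\<And>i g. g \<in> I i \<Longrightarrow> F (Suc i) g = F i g" by metis
  have Imono: "I i \<subseteq> I j" if "i \<le> j" for i j
    unfolding I_def Y_def using that by (intro isolator_mono) auto
  have agree: "F j g = F i g" if "i \<le> j" "g \<in> I i" for i j g
    using that(1)
  proof (induction rule: dec_induct)
    case (step n)
    then show ?case using F(3)[of g n] Imono[of i n] that(2) by auto
  qed simp
  have ex: "\<exists>i. g \<in> I i" if g: "g \<in> carrier G" for g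
  proof -
    obtain j where "g = e j" using g e by blast
    then have "g \<in> C \<union> Y (Suc j)" by (auto simp: Y_def)
    moreover have "C \<union> Y (Suc j) \<subseteq> carrier G" using C Y by blast
    ultimately show ?thesis using isolator_incl unfolding I_def by blast
  qed
  define ix where "ix g = (SOME i. g \<in> I i)" for g
  have ix: "g \<in> I (ix g)" if "g \<in> carrier G" for g unfolding ix_def using ex[OF that] by (rule someI_ex)
  define f where "f g = F (ix g) g" for g
  have fF: "f g = F i g" if "g \<in> I i" "g \<in> carrier G" for g i
    using agree[of i "max i (ix g)" g] agree[of "ix g" "max i (ix g)" g] ix[OF that(2)] that(1) by (simp add: f_def)
  have "additive_on (carrier G) f"
    unfolding additive_on_def
  proof (intro ballI)
    fix g h assume gh: "g \<in> carrier G" "h \<in> carrier G"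
    define m where "m = max (ix g) (ix h)"
    have m: "g \<in> I m" "h \<in> I m" using ix[OF gh(1)] ix[OF gh(2)] Imono[of "ix g" m] Imono[of "ix h" m] by (auto simp: m_def)
    have sg: "subgroup (I m) G" unfolding I_def using C Y by (intro subgroup_isolator) auto
    have "g \<otimes> h \<in> I m" using subgroup.m_closed[OF sg m] .
    then show "f (g \<otimes> h) = f g + f h"
      using fF m gh F(1)[of m] by (simp add: additive_on_def)
  qed
  moreover have "f x0 \<noteq> 0"
  proof -
    have "x0 \<in> I 0" using isolator_incl[of "C \<union> Y 0"] C Y x0 unfolding I_def by (auto simp: Y_def)
    then show ?thesis using fF[OF _ x0(1), of 0] F(2) by simp
  qed
  ultimately show ?thesis by blast
qed

end
end

section \<open>Transcendence bases\<close>

context field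
begin

definition monomial_value :: "'a multiset \<Rightarrow> 'a"
  where "monomial_value m = (\<Otimes>t\<in>set_mset m. t [^] count m t)"

lemma eval_at_indices_eq: "eval_at_indices R P = (\<Oplus>m\<in>{m. P m \<noteq> \<zero>}. P m \<otimes> monomial_value m)"
  by (simp add: eval_at_indices_def monomial_value_def)

context
  fixes I K assumes I: "I \<subseteq> carrier R" and K: "subring K R"
begin

lemma monomial_value_closed: "set_mset m \<subseteq> I \<Longrightarrow> monomial_value m \<in> carrier R"
  using I unfolding monomial_value_def by (intro finprod_closed) auto

lemma monomial_value_add_mset:
  assumes m: "set_mset m \<subseteq> I" and i: "i \<in> I"
  shows "monomial_value (add_mset i m) = monomial_value m \<otimes> i"
proof -
  define S where "S = set_mset m - {i}"
  have S: "finite S" "i \<notin> S" by (auto simp: S_def)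
  have ic: "i \<in> carrier R" using i I by blast
  have f: "(\<lambda>t. t [^] count m t) \<in> S \<rightarrow> carrier R" using m I by (auto simp: S_def)
  have "(\<Otimes>t\<in>S. t [^] count (add_mset i m) t) = (\<Otimes>t\<in>S. t [^] count m t)"
    using m I by (intro finprod_cong') (auto simp: S_def)
  moreover have "set_mset (add_mset i m) = insert i S" by (auto simp: S_def)
  ultimately have 1: "monomial_value (add_mset i m) = i [^] Suc (count m i) \<otimes> (\<Otimes>t\<in>S. t [^] count m t)"
    using finprod_insert[OF S, of "\<lambda>t. t [^] count (add_mset i m) t"] m I ic by (auto simp: monomial_value_def S_def)
  have 2: "monomial_value m = i [^] count m i \<otimes> (\<Otimes>t\<in>S. t [^] count m t)"
  proof (cases "i \<in># m")
    case True
    then have "set_mset m = insert i S" by (auto simp: S_def)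
    then show ?thesis using finprod_insert[OF S f] ic by (simp add: monomial_value_def)
  next
    case False
    then have "S = set_mset m" "count m i = 0" by (auto simp: S_def not_in_iff)
    then show ?thesis using finprod_closed[OF f] by (simp add: monomial_value_def)
  qed
  show ?thesis unfolding 1 2 using ic finprod_closed[OF f] by (simp add: m_ac)
qed

lemma indexed_pset_props:
  "Q \<in> indexed_pset I K \<Longrightarrow> finite {m. Q m \<noteq> \<zero>} \<and> (\<forall>m. Q m \<in> K) \<and> (\<forall>m. Q m \<noteq> \<zero> \<longrightarrow> set_mset m \<subseteq> I)"
proof (induction rule: indexed_pset.induct)
  case (indexed_const k)
  have "{m. indexed_const k m \<noteq> \<zero>} \<subseteq> {{#}}" by (auto simp: indexed_const_def)
  then have "finite {m. indexed_const k m \<noteq> \<zero>}" using finite_subset by blast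
  then show ?case using indexed_const subringE(2)[OF K] by (auto simp: indexed_const_def)
next
  case (indexed_padd P Q)
  have Kc: "K \<subseteq> carrier R" using subringE(1)[OF K] .
  have "{m. indexed_padd P Q m \<noteq> \<zero>} \<subseteq> {m. P m \<noteq> \<zero>} \<union> {m. Q m \<noteq> \<zero>}" by (auto simp: indexed_padd_def)
  then have "finite {m. indexed_padd P Q m \<noteq> \<zero>}" using indexed_padd finite_subset by blast
  moreover have "set_mset m \<subseteq> I" if "indexed_padd P Q m \<noteq> \<zero>" for m
  proof -
    have "P m \<noteq> \<zero> \<or> Q m \<noteq> \<zero>" using that by (auto simp: indexed_padd_def)
    then show ?thesis using indexed_padd by blast
  qed
  ultimately show ?case using indexed_padd subringE(7)[OF K] by (auto simp: indexed_padd_def)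
next
  case (indexed_pmult P i)
  have "{m. indexed_pmult P i m \<noteq> \<zero>} \<subseteq> add_mset i ` {m. P m \<noteq> \<zero>}"
  proof
    fix m assume "m \<in> {m. indexed_pmult P i m \<noteq> \<zero>}"
    then have "i \<in># m" "P (m - {#i#}) \<noteq> \<zero>" by (auto simp: indexed_pmult_def split: if_splits)
    then show "m \<in> add_mset i ` {m. P m \<noteq> \<zero>}" by (intro image_eqI[of _ _ "m - {#i#}"]) auto
  qed
  moreover have "finite (add_mset i ` {m. P m \<noteq> \<zero>})" using indexed_pmult by blast
  ultimately have "finite {m. indexed_pmult P i m \<noteq> \<zero>}" by (rule finite_subset)
  moreover have "set_mset m \<subseteq> I" if "indexed_pmult P i m \<noteq> \<zero>" for m
  proof -
    have "i \<in># m" "P (m - {#i#}) \<noteq> \<zero>" using that by (auto simp: indexed_pmult_def split: if_splits)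
    then have "set_mset (m - {#i#}) \<subseteq> I" "m = add_mset i (m - {#i#})" using indexed_pmult by auto
    then show ?thesis using indexed_pmult(2) by (metis insert_subset set_mset_add_mset_insert)
  qed
  ultimately show ?case using indexed_pmult subringE(2)[OF K] by (auto simp: indexed_pmult_def)
qed

lemma eval_at_indices_superset:
  assumes Q: "Q \<in> indexed_pset I K" and S: "finite S" "{m. Q m \<noteq> \<zero>} \<subseteq> S" "\<And>m. m \<in> S \<Longrightarrow> set_mset m \<subseteq> I"
  shows "eval_at_indices R Q = (\<Oplus>m\<in>S. Q m \<otimes> monomial_value m)"
  unfolding eval_at_indices_eq
proof (rule add.finprod_mono_neutral_cong_left[OF S(1,2)])
  have c: "Q m \<in> carrier R" for m using indexed_pset_props[OF Q] subringE(1)[OF K] by blast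
  show "\<And>i. i \<in> S - {m. Q m \<noteq> \<zero>} \<Longrightarrow> Q i \<otimes> monomial_value i = \<zero>" using S(3) monomial_value_closed by auto
  show "(\<lambda>m. Q m \<otimes> monomial_value m) \<in> S \<rightarrow> carrier R" using S(3) monomial_value_closed c by auto
qed auto

lemma eval_at_indices_const: assumes "k \<in> K" shows "eval_at_indices R (indexed_const k) = k"
proof -
  have kc: "k \<in> carrier R" using assms subringE(1)[OF K] by blast
  have "eval_at_indices R (indexed_const k) = (\<Oplus>m\<in>{{#}}. indexed_const k m \<otimes> monomial_value m)"
    by (rule eval_at_indices_superset[OF indexed_pset.indexed_const[OF assms]]) (auto simp: indexed_const_def split: if_splits)
  also have "\<dots> = k" using kc by (simp add: indexed_const_def monomial_value_def)
  finally show ?thesis .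
qed

lemma eval_at_indices_padd:
  assumes P: "P \<in> indexed_pset I K" and Q: "Q \<in> indexed_pset I K"
  shows "eval_at_indices R (indexed_padd P Q) = eval_at_indices R P \<oplus> eval_at_indices R Q"
proof -
  note Pp = indexed_pset_props[OF P] and Qp = indexed_pset_props[OF Q]
  define S where "S = {m. P m \<noteq> \<zero>} \<union> {m. Q m \<noteq> \<zero>}"
  have S: "finite S" "\<And>m. m \<in> S \<Longrightarrow> set_mset m \<subseteq> I" using Pp Qp by (auto simp: S_def)
  have c: "P m \<in> carrier R" "Q m \<in> carrier R" for m using Pp Qp subringE(1)[OF K] by auto
  have mv: "monomial_value m \<in> carrier R" if "m \<in> S" for m using S(2)[OF that] monomial_value_closed by blast
  have "eval_at_indices R (indexed_padd P Q) = (\<Oplus>m\<in>S. indexed_padd P Q m \<otimes> monomial_value m)"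
    by (rule eval_at_indices_superset[OF indexed_pset.indexed_padd[OF P Q] S(1) _ S(2)]) (auto simp: S_def indexed_padd_def)
  also have "\<dots> = (\<Oplus>m\<in>S. P m \<otimes> monomial_value m \<oplus> Q m \<otimes> monomial_value m)"
    using c mv by (intro add.finprod_cong') (auto simp: indexed_padd_def l_distr)
  also have "\<dots> = (\<Oplus>m\<in>S. P m \<otimes> monomial_value m) \<oplus> (\<Oplus>m\<in>S. Q m \<otimes> monomial_value m)"
    using c mv by (intro add.finprod_multf) auto
  also have "(\<Oplus>m\<in>S. P m \<otimes> monomial_value m) = eval_at_indices R P"
    by (rule eval_at_indices_superset[OF P S(1) _ S(2), symmetric]) (auto simp: S_def)
  also have "(\<Oplus>m\<in>S. Q m \<otimes> monomial_value m) = eval_at_indices R Q"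
    by (rule eval_at_indices_superset[OF Q S(1) _ S(2), symmetric]) (auto simp: S_def)
  finally show ?thesis .
qed

lemma eval_at_indices_closed: "Q \<in> indexed_pset I K \<Longrightarrow> eval_at_indices R Q \<in> carrier R"
  unfolding eval_at_indices_eq
proof (intro add.finprod_closed)
  assume "Q \<in> indexed_pset I K"
  note Qp = indexed_pset_props[OF this]
  have "Q m \<in> carrier R" for m using Qp subringE(1)[OF K] by blast
  then show "(\<lambda>m. Q m \<otimes> monomial_value m) \<in> {m. Q m \<noteq> \<zero>} \<rightarrow> carrier R"
    using Qp monomial_value_closed by auto
qed

lemma eval_at_indices_pmult:
  assumes P: "P \<in> indexed_pset I K" and i: "i \<in> I"
  shows "eval_at_indices R (indexed_pmult P i) = eval_at_indices R P \<otimes> i"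
proof -
  note Pp = indexed_pset_props[OF P]
  define S where "S = {m. P m \<noteq> \<zero>}"
  have S: "finite S" "\<And>m. m \<in> S \<Longrightarrow> set_mset m \<subseteq> I" using Pp by (auto simp: S_def)
  have c: "P m \<in> carrier R" for m using Pp subringE(1)[OF K] by auto
  have ic: "i \<in> carrier R" using i I by blast
  have mv: "monomial_value m \<in> carrier R" if "m \<in> S" for m using S(2)[OF that] monomial_value_closed by blast
  have "eval_at_indices R (indexed_pmult P i) = (\<Oplus>m\<in>add_mset i ` S. indexed_pmult P i m \<otimes> monomial_value m)"
  proof (rule eval_at_indices_superset[OF indexed_pset.indexed_pmult[OF P i]])
    show "finite (add_mset i ` S)" using S by simp
    show "{m. indexed_pmult P i m \<noteq> \<zero>} \<subseteq> add_mset i ` S"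
    proof
      fix m assume "m \<in> {m. indexed_pmult P i m \<noteq> \<zero>}"
      then have "i \<in># m" "P (m - {#i#}) \<noteq> \<zero>" by (auto simp: indexed_pmult_def split: if_splits)
      then show "m \<in> add_mset i ` S" by (intro image_eqI[of _ _ "m - {#i#}"]) (auto simp: S_def)
    qed
    show "\<And>m. m \<in> add_mset i ` S \<Longrightarrow> set_mset m \<subseteq> I" using S(2) i by fastforce
  qed
  also have "\<dots> = (\<Oplus>m\<in>S. indexed_pmult P i (add_mset i m) \<otimes> monomial_value (add_mset i m))"
    using c mv S(2) i ic monomial_value_add_mset
    by (intro add.finprod_reindex) (auto simp: inj_on_def indexed_pmult_def)
  also have "\<dots> = (\<Oplus>m\<in>S. (P m \<otimes> monomial_value m) \<otimes> i)"
    using c mv S(2) i ic by (intro add.finprod_cong') (auto simp: indexed_pmult_def monomial_value_add_mset m_assoc)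
  also have "\<dots> = (\<Oplus>m\<in>S. P m \<otimes> monomial_value m) \<otimes> i"
    using c mv ic S(1) by (intro finsum_ldistr[symmetric]) auto
  finally show ?thesis unfolding eval_at_indices_eq S_def .
qed

text \<open>
  The image of the evaluation is the ring \<open>K[I]\<close>.
\<close>

lemma eval_image_subring: "subring (eval_at_indices R ` indexed_pset I K) R" (is "subring ?A R")
  and eval_image_incl: "K \<union> I \<subseteq> eval_at_indices R ` indexed_pset I K"
proof -
  note Ks = subringE[OF K]
  have const: "k \<in> ?A" if "k \<in> K" for k
    using eval_at_indices_const[OF that] indexed_pset.indexed_const[OF that, of I] by (metis image_eqI)
  have add: "a \<oplus> b \<in> ?A" if "a \<in> ?A" "b \<in> ?A" for a b
  proof -
    from that obtain P Q where PQ: "P \<in> indexed_pset I K" "a = eval_at_indices R P" "Q \<in> indexed_pset I K" "b = eval_at_indices R Q"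
      by blast
    then show ?thesis using eval_at_indices_padd[OF PQ(1,3)] indexed_pset.indexed_padd[OF PQ(1,3)] by (metis image_eqI)
  qed
  have var: "a \<otimes> i \<in> ?A" if "a \<in> ?A" "i \<in> I" for a i
  proof -
    from that obtain P where P: "P \<in> indexed_pset I K" "a = eval_at_indices R P" by blast
    then show ?thesis using eval_at_indices_pmult[OF P(1) that(2)] indexed_pset.indexed_pmult[OF P(1) that(2)] by (metis image_eqI)
  qed
  have Ac: "a \<in> carrier R" if "a \<in> ?A" for a using that eval_at_indices_closed by blast
  have smult: "k \<otimes> eval_at_indices R Q \<in> ?A" if k: "k \<in> K" and Q: "Q \<in> indexed_pset I K" for k Q
    using Q
  proof (induction rule: indexed_pset.induct)
    case (indexed_const c)
    then show ?case using eval_at_indices_const[OF indexed_const] const Ks(6)[OF k indexed_const] by simp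
  next
    case (indexed_padd P Q)
    have "k \<otimes> (eval_at_indices R P \<oplus> eval_at_indices R Q) = k \<otimes> eval_at_indices R P \<oplus> k \<otimes> eval_at_indices R Q"
      using k Ks(1) eval_at_indices_closed indexed_padd by (intro r_distr) auto
    then show ?case using eval_at_indices_padd[OF indexed_padd(1,2)] add[OF indexed_padd(3,4)] by simp
  next
    case (indexed_pmult P i)
    have "k \<otimes> (eval_at_indices R P \<otimes> i) = (k \<otimes> eval_at_indices R P) \<otimes> i"
      using k Ks(1) I eval_at_indices_closed indexed_pmult by (intro m_assoc[symmetric]) auto
    then show ?case using eval_at_indices_pmult[OF indexed_pmult(1,2)] var[OF indexed_pmult(3,2)] by simp
  qed
  have mult: "b \<otimes> eval_at_indices R Q \<in> ?A" if b: "b \<in> ?A" and Q: "Q \<in> indexed_pset I K" for b Q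
    using Q
  proof (induction rule: indexed_pset.induct)
    case (indexed_const c)
    obtain P where P: "P \<in> indexed_pset I K" "b = eval_at_indices R P" using b by blast
    have "b \<otimes> c = c \<otimes> b" using Ac[OF b] indexed_const Ks(1) m_comm by blast
    then show ?case using eval_at_indices_const[OF indexed_const] smult[OF indexed_const P(1)] P(2) by simp
  next
    case (indexed_padd P Q)
    have "b \<otimes> (eval_at_indices R P \<oplus> eval_at_indices R Q) = b \<otimes> eval_at_indices R P \<oplus> b \<otimes> eval_at_indices R Q"
      using Ac[OF b] eval_at_indices_closed indexed_padd by (intro r_distr) auto
    then show ?case using eval_at_indices_padd[OF indexed_padd(1,2)] add[OF indexed_padd(3,4)] by simp
  next
    case (indexed_pmult P i)
    have "b \<otimes> (eval_at_indices R P \<otimes> i) = (b \<otimes> eval_at_indices R P) \<otimes> i"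
      using Ac[OF b] I eval_at_indices_closed indexed_pmult by (intro m_assoc[symmetric]) auto
    then show ?case using eval_at_indices_pmult[OF indexed_pmult(1,2)] var[OF indexed_pmult(3,2)] by simp
  qed
  show "K \<union> I \<subseteq> ?A"
  proof
    fix x assume "x \<in> K \<union> I"
    then show "x \<in> ?A"
    proof
      assume x: "x \<in> I"
      then have "\<one> \<otimes> x = x" using I by auto
      then show ?thesis using var[OF const[OF Ks(3)] x] by simp
    qed (rule const)
  qed
  show "subring ?A R"
  proof (rule subringI)
    show "?A \<subseteq> carrier R" using Ac by blast
    show "\<one> \<in> ?A" using const[OF Ks(3)] .
    show "\<ominus> a \<in> ?A" if a: "a \<in> ?A" for a
    proof -
      obtain P where P: "P \<in> indexed_pset I K" "a = eval_at_indices R P" using a by blast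
      have "(\<ominus> \<one>) \<otimes> a \<in> ?A" using smult[OF Ks(5)[OF Ks(3)] P(1)] P(2) by simp
      then show ?thesis using Ac[OF a] by (simp add: l_minus)
    qed
    show "a \<otimes> b \<in> ?A" if "a \<in> ?A" "b \<in> ?A" for a b using mult[OF that(1)] that(2) by blast
    show "a \<oplus> b \<in> ?A" if "a \<in> ?A" "b \<in> ?A" for a b using add[OF that] .
  qed
qed

end

lemma clear_denominators:
  assumes S: "subring S R" and H: "H \<subseteq> S"
  shows "set p \<subseteq> generate_field R H \<Longrightarrow> \<exists>b\<in>S. b \<noteq> \<zero> \<and> (\<forall>c\<in>set p. b \<otimes> c \<in> S)"
proof (induction p)
  case Nil then show ?case using subringE(3)[OF S] by (intro bexI[of _ \<one>]) auto
next
  case (Cons c p)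
  have Hc: "H \<subseteq> carrier R" using H subringE(1)[OF S] by blast
  obtain b where b: "b \<in> S" "b \<noteq> \<zero>" "\<forall>c\<in>set p. b \<otimes> c \<in> S" using Cons by auto
  have "c \<in> generate_field R H" using Cons.prems by simp
  from fractions_of_subring[OF S H this]
  obtain a d where ad: "a \<in> S" "d \<in> S" "d \<noteq> \<zero>" "c = a \<otimes> inv d" by blast
  note Ss = subringE[OF S]
  have cc: "b \<in> carrier R" "a \<in> carrier R" "d \<in> carrier R" using b ad Ss(1) by auto
  have "(d \<otimes> b) \<otimes> e \<in> S" if e: "e \<in> set (c # p)" for e
  proof (cases "e = c")
    case True
    have "(d \<otimes> b) \<otimes> c = (b \<otimes> a) \<otimes> (inv d \<otimes> d)"
      unfolding ad(4) using cc nonzero_simps(1)[OF cc(3) ad(3)] by (simp add: m_ac)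
    also have "\<dots> = b \<otimes> a" using cc nonzero_simps(4)[OF cc(3) ad(3)] by simp
    finally show ?thesis using True Ss(6)[OF b(1) ad(1)] by simp
  next
    case False
    then have "e \<in> set p" using e by simp
    moreover have "e \<in> carrier R" using generate_field_in_carrier[OF Hc] e Cons.prems by auto
    ultimately show ?thesis using b(3) Ss(6)[OF ad(2)] cc by (simp add: m_assoc)
  qed
  moreover have "d \<otimes> b \<in> S" "d \<otimes> b \<noteq> \<zero>" using Ss(6)[OF ad(2) b(1)] cc b ad by (auto simp: integral_iff)
  ultimately show ?case by blast
qed

lemma relation_over_subring:
  assumes S: "subring S R" and H: "H \<subseteq> S" and t: "t \<in> carrier R" "(algebraic over (generate_field R H)) t"
  shows "\<exists>q. set q \<subseteq> S \<and> q \<noteq> [] \<and> hd q \<noteq> \<zero> \<and> eval q t = \<zero>"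
proof -
  have Hc: "H \<subseteq> carrier R" using H subringE(1)[OF S] by blast
  have K: "subfield (generate_field R H) R" by (rule generate_field_is_subfield[OF Hc])
  obtain p where p: "p \<in> carrier ((generate_field R H)[X])" "p \<noteq> []" "eval p t = \<zero>"
    using algebraicE[OF subfieldE(1)[OF K] t] .
  then have pK: "set p \<subseteq> generate_field R H" "hd p \<noteq> \<zero>" by (auto simp: univ_poly_carrier[symmetric] polynomial_def)
  then have pc: "set p \<subseteq> carrier R" using subfieldE(3)[OF K] by blast
  obtain b where b: "b \<in> S" "b \<noteq> \<zero>" "\<forall>c\<in>set p. b \<otimes> c \<in> S" using clear_denominators[OF S H pK(1)] by blast
  have bc: "b \<in> carrier R" using b subringE(1)[OF S] by blast
  have "eval (map (\<lambda>c. b \<otimes> c) p) t = b \<otimes> eval p t" using pc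
  proof (induction p)
    case (Cons a p)
    then show ?case using bc t eval_in_carrier[of p t] by (simp add: r_distr m_assoc)
  qed (use bc in simp)
  then have "eval (map (\<lambda>c. b \<otimes> c) p) t = \<zero>" using p(3) bc by simp
  moreover have "hd (map (\<lambda>c. b \<otimes> c) p) \<noteq> \<zero>" using p(2) pK(2) pc b(2) bc by (cases p) (auto simp: integral_iff)
  ultimately show ?thesis using b(3) p(2) by (intro exI[of _ "map (\<lambda>c. b \<otimes> c) p"]) auto
qed

text \<open>
  After clearing denominators, an algebraic relation of \<open>t\<close> over the field generated by
  \<open>P \<union> (T - {t})\<close> has coefficients that are polynomials in \<open>T - {t}\<close> over \<open>P\<close>. Read as a polynomial
  in \<open>T\<close>, it contradicts the independence of \<open>T\<close>.
\<close>

lemma transcendental_over_remaining_basis: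
  assumes P: "subfield P R" and T: "algebraically_independent R P T" and t: "t \<in> T"
  shows "(transcendental over (generate_field R (P \<union> (T - {t})))) t"
proof (rule ccontr)
  assume "\<not> ?thesis"
  then have alg: "(algebraic over (generate_field R (P \<union> (T - {t})))) t" by (simp add: over_def)
  define I where "I = T - {t}"
  have Tc: "T \<subseteq> carrier R" using T by (simp add: algebraically_independent_def)
  have Ic: "I \<subseteq> carrier R" and tc: "t \<in> carrier R" using Tc t by (auto simp: I_def)
  note Ps = subfieldE(1)[OF P]
  define A where "A = eval_at_indices R ` indexed_pset I P"
  have A: "subring A R" "P \<union> I \<subseteq> A" unfolding A_def using eval_image_subring[OF Ic Ps] eval_image_incl[OF Ic Ps] by auto
  obtain q where q: "set q \<subseteq> A" "q \<noteq> []" "hd q \<noteq> \<zero>" "eval q t = \<zero>"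
    using relation_over_subring[OF A tc alg[folded I_def]] by blast
  obtain Qs where Qs: "set Qs \<subseteq> indexed_pset I P" "map (eval_at_indices R) Qs = q"
  proof -
    have "q \<in> lists (eval_at_indices R ` indexed_pset I P)" using q(1) by (simp add: A_def in_lists_conv_set subset_iff)
    then have "q \<in> map (eval_at_indices R) ` lists (indexed_pset I P)" unfolding lists_image .
    then show ?thesis using that by auto
  qed
  have sub: "Q \<in> indexed_pset T P" if "Q \<in> indexed_pset I P" for Q
    using that by (induction rule: indexed_pset.induct) (auto intro: indexed_pset.intros simp: I_def)
  have ev: "indexed_eval Qs t \<in> indexed_pset T P \<and> eval_at_indices R (indexed_eval Qs t) = eval (map (eval_at_indices R) Qs) t"
    if "set Qs \<subseteq> indexed_pset I P" for Qs
    using that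
  proof (induction Qs rule: rev_induct)
    case Nil
    have z: "\<zero> \<in> P" using subringE(2)[OF Ps] .
    then show ?case using eval_at_indices_const[OF Tc Ps z] indexed_pset.indexed_const[OF z] by simp
  next
    case (snoc Q Qs)
    have QT: "Q \<in> indexed_pset T P" using snoc.prems sub by simp
    have E: "indexed_eval Qs t \<in> indexed_pset T P" "eval_at_indices R (indexed_eval Qs t) = eval (map (eval_at_indices R) Qs) t"
      using snoc by auto
    have eq: "indexed_eval (Qs @ [Q]) t = indexed_padd (indexed_pmult (indexed_eval Qs t) t) Q" by simp
    have M: "indexed_pmult (indexed_eval Qs t) t \<in> indexed_pset T P" using indexed_pset.indexed_pmult[OF E(1) t] .
    have "set (map (eval_at_indices R) Qs) \<subseteq> carrier R"
      using snoc.prems eval_at_indices_closed[OF Ic Ps] by auto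
    then have "eval (map (eval_at_indices R) Qs @ [eval_at_indices R Q]) t
        = eval (map (eval_at_indices R) Qs) t \<otimes> t \<oplus> eval_at_indices R Q"
      using eval_append_aux eval_at_indices_closed[OF Tc Ps QT] tc by blast
    then show ?case unfolding eq
      using eval_at_indices_padd[OF Tc Ps M QT] eval_at_indices_pmult[OF Tc Ps E(1) t] E(2)
        indexed_pset.indexed_padd[OF M QT] by simp
  qed
  have W: "indexed_eval Qs t \<in> indexed_pset T P" "eval_at_indices R (indexed_eval Qs t) = \<zero>"
    using ev[OF Qs(1)] Qs(2) q(4) by auto
  then have zero: "indexed_eval Qs t = indexed_const \<zero>" using T unfolding algebraically_independent_def by blast
  obtain Q Qs' where QQ: "Qs = Q # Qs'" using Qs(2) q(2) by (cases Qs) auto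
  have free: "index_free Q t" "carrier_coeff Q" if "Q \<in> set Qs" for Q
  proof -
    have "Q \<in> indexed_pset I P" using that Qs(1) by blast
    from indexed_pset_props[OF Ic Ps this] show "index_free Q t" "carrier_coeff Q"
      using subringE(1)[OF Ps] by (auto simp: index_free_def carrier_coeff_def I_def)
  qed
  have "Q \<noteq> indexed_const \<zero>"
    using q(3) Qs(2) QQ eval_at_indices_const[OF Tc Ps subringE(2)[OF Ps]] by auto
  moreover have "carrier_coeff Q" "list_all carrier_coeff Qs'" "index_free Q t" "list_all (\<lambda>Q. index_free Q t) Qs'"
    using free QQ by (auto simp: list_all_iff)
  ultimately obtain m where "indexed_eval (Q # Qs') t m \<noteq> \<zero>"
    using exists_indexed_eval_monomial'[of Q Qs' t] by blast
  then show False using zero QQ by (simp add: indexed_const_def split: if_splits)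
qed

text \<open>
  After clearing denominators, the relation of \<open>y\<close> over \<open>k(t)\<close> is a polynomial relation in \<open>t\<close> and
  \<open>y\<close> over \<open>k\<close>. Its coefficients as a polynomial in \<open>t\<close> are polynomials in \<open>y\<close> over \<open>k\<close>. If \<open>t\<close> were
  transcendental over \<open>k(y)\<close>, they would all vanish at \<open>y\<close>, and so be zero because \<open>y\<close> is
  transcendental over \<open>k\<close>.
\<close>

lemma algebraic_exchange:
  assumes k: "subfield k R" and t: "t \<in> carrier R" and y: "y \<in> carrier R"
    and alg: "(algebraic over (generate_field R (k \<union> {t}))) y" and tr: "(transcendental over k) y"
  shows "(algebraic over (generate_field R (k \<union> {y}))) t"
proof (rule ccontr)
  define E where "E = generate_field R (k \<union> {y})"
  note kc = subfieldE(3)[OF k] and ks = subringE[OF subfieldE(1)[OF k]]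
  have E: "subfield E R" unfolding E_def using kc y by (intro generate_field_is_subfield) auto
  note Es = subringE[OF subfieldE(1)[OF E]]
  have kE: "k \<subseteq> E" "y \<in> E" unfolding E_def by (auto intro: generate_field.incl)
  assume "\<not> (algebraic over (generate_field R (k \<union> {y}))) t"
  then have ttr: "(transcendental over E) t" by (simp add: E_def over_def)
  have St: "subring (simple_extension k t) R" by (rule simple_extension_is_subring[OF subfieldE(1)[OF k] t])
  have "k \<union> {t} \<subseteq> simple_extension k t"
    using simple_extension_incl[OF kc t] simple_extension_mem[OF subfieldE(1)[OF k] t] by blast
  from relation_over_subring[OF St this y alg]
  obtain q where q: "set q \<subseteq> simple_extension k t" "q \<noteq> []" "hd q \<noteq> \<zero>" "eval q y = \<zero>" by blast
  have img: "simple_extension k t = (\<lambda>p. eval p t) ` carrier (k[X])" by (rule simple_extension_as_eval_img[OF kc t])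
  obtain rs where rs: "set rs \<subseteq> carrier (k[X])" "map (\<lambda>r. eval r t) rs = q"
  proof -
    have "q \<in> lists ((\<lambda>p. eval p t) ` carrier (k[X]))" using q(1) img by (simp add: in_lists_conv_set subset_iff)
    then have "q \<in> map (\<lambda>p. eval p t) ` lists (carrier (k[X]))" unfolding lists_image .
    then show ?thesis using that by auto
  qed
  have yp: "y [^] (i::nat) \<in> E" for i using kE Es(3,6) by (induction i) auto
  have "\<exists>Q. set Q \<subseteq> E \<and> eval Q t = eval (map (\<lambda>r. eval r t) rs) y \<and> (\<forall>j. coeff Q j = eval (map (\<lambda>r. coeff r j) rs) y)"
    using rs(1)
  proof (induction rs)
    case Nil show ?case by (intro exI[of _ "[]"]) simp
  next
    case (Cons r rs)
    then obtain Q where Q: "set Q \<subseteq> E" "eval Q t = eval (map (\<lambda>r. eval r t) rs) y" "\<forall>j. coeff Q j = eval (map (\<lambda>r. coeff r j) rs) y" by auto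
    have rk: "set r \<subseteq> k" using Cons.prems by (auto simp: univ_poly_carrier[symmetric] polynomial_def)
    define r' where "r' = map (\<lambda>c. y [^] length rs \<otimes> c) r"
    have r'E: "set r' \<subseteq> E" using rk kE yp Es(6) by (auto simp: r'_def)
    have Ec: "E \<subseteq> carrier R" using Es(1) .
    have c: "set r' \<subseteq> carrier R" "set Q \<subseteq> carrier R" "set r \<subseteq> carrier R" using r'E Q(1) Ec rk kc by auto
    have yc: "y [^] length rs \<in> carrier R" using y by simp
    have er': "eval r' t = y [^] length rs \<otimes> eval r t" unfolding r'_def using c(3)
    proof (induction r)
      case (Cons a p)
      then show ?case using yc t eval_in_carrier[of p t] by (simp add: r_distr m_assoc)
    qed (use yc in simp)
    have cr': "coeff r' j = y [^] length rs \<otimes> coeff r j" for j unfolding r'_def using scalar_coeff[OF yc] by simp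
    have pa: "set (poly_add r' Q) \<subseteq> E"
      using poly_add_is_polynomial[OF subfieldE(1)[OF E] r'E Q(1)] polynomial_incl by blast
    have rc: "eval r t \<in> carrier R" "coeff r j \<in> carrier R" for j using eval_in_carrier[OF c(3) t] coeff_in_carrier[OF c(3)] by auto
    show ?case
    proof (intro exI[of _ "poly_add r' Q"] conjI allI)
      show "set (poly_add r' Q) \<subseteq> E" by (rule pa)
      show "eval (poly_add r' Q) t = eval (map (\<lambda>r. eval r t) (r # rs)) y"
        using eval_poly_add[OF c(1,2) t] er' Q(2) rc yc by (simp add: m_comm)
      show "coeff (poly_add r' Q) j = eval (map (\<lambda>r. coeff r j) (r # rs)) y" for j
        using poly_add_coeff[OF c(1,2)] cr' Q(3) rc yc by (simp add: m_comm)
    qed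
  qed
  then obtain Q where Q: "set Q \<subseteq> E" "eval Q t = \<zero>" "\<And>j. coeff Q j = eval (map (\<lambda>r. coeff r j) rs) y" using rs(2) q(4) by auto
  have Qc: "set Q \<subseteq> carrier R" using Q(1) Es(1) by blast
  have nz: "\<forall>x\<in>set p. x = \<zero>" if "normalize p = []" for p using that by (induction p) (auto split: if_splits)
  have "normalize Q \<in> carrier (E[X])" using normalize_gives_polynomial[OF Q(1)] by (simp add: univ_poly_carrier)
  moreover have "eval (normalize Q) t = \<zero>" using eval_normalize[OF Qc t] Q(2) by simp
  ultimately have nQ: "normalize Q = []" using eval_transcendental[OF ttr] by blast
  have cQ: "coeff Q j = \<zero>" for j using normalize_coeff[of Q] nQ by simp
  have all0: "coeff r j = \<zero>" if r: "r \<in> set rs" for r j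
  proof -
    let ?p = "map (\<lambda>r. coeff r j) rs"
    have pk: "set ?p \<subseteq> k"
    proof -
      have "coeff r j \<in> k" if "r \<in> set rs" for r
      proof -
        have "r \<in> carrier (k[X])" using that rs(1) by blast
        then have "set r \<subseteq> k" by (auto simp: univ_poly_carrier[symmetric] polynomial_def)
        moreover have "coeff r j \<in> set r \<union> {\<zero>}" using coeff_img(3)[of r] by blast
        ultimately show ?thesis using ks(2) by auto
      qed
      then show ?thesis by auto
    qed
    have "normalize ?p \<in> carrier (k[X])" using normalize_gives_polynomial[OF pk] by (simp add: univ_poly_carrier)
    moreover have "set ?p \<subseteq> carrier R" using pk kc by blast
    then have "eval (normalize ?p) y = \<zero>" using eval_normalize[of ?p y] y Q(3)[of j] cQ by simp
    ultimately have "normalize ?p = []" using eval_transcendental[OF tr] by blast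
    then show ?thesis using nz[of ?p] r by auto
  qed
  obtain r rs' where rr: "rs = r # rs'" using rs(2) q(2) by (cases rs) auto
  have "r = []"
  proof (rule ccontr)
    assume "r \<noteq> []"
    then have "coeff r (degree r) = hd r" by (rule lead_coeff_simp)
    moreover have "hd r \<noteq> \<zero>" using \<open>r \<noteq> []\<close> rs(1) rr by (auto simp: univ_poly_carrier[symmetric] polynomial_def)
    ultimately show False using all0[of r] rr by simp
  qed
  then show False using q(3) rs(2) rr by auto
qed

section \<open>Countable fields generated in bounded degree\<close>

text \<open>
  The generated field is exhausted by the sets obtained from \<open>H\<close> by finitely many rounds of the
  field operations.
\<close>

lemma countable_generate_field:
  assumes H: "countable H" "H \<subseteq> carrier R"
  shows "countable (generate_field R H)"
proof -
  define step where "step A = A \<union> a_inv R ` A \<union> m_inv R ` A \<union> (\<lambda>(a, b). a \<oplus> b) ` (A \<times> A) \<union> (\<lambda>(a, b). a \<otimes> b) ` (A \<times> A)" for A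
  define S where "S n = (step ^^ n) (insert \<one> H)" for n
  have SS: "S (Suc n) = step (S n)" for n by (simp add: S_def)
  have count: "countable (S n)" for n
  proof (induction n)
    case 0 then show ?case using H by (simp add: S_def)
  next
    case (Suc n) then show ?case unfolding SS step_def by (intro countable_Un countable_image countable_SIGMA)
  qed
  have mono: "S m \<subseteq> S n" if "m \<le> n" for m n
    using that by (induction rule: dec_induct) (auto simp: SS step_def)
  have "\<exists>n. x \<in> S n" if "x \<in> generate_field R H" for x
    using that
  proof (induction rule: generate_field.induct)
    case one then show ?case by (intro exI[of _ 0]) (simp add: S_def)
  next
    case (incl h) then show ?case by (intro exI[of _ 0]) (simp add: S_def)
  next
    case (a_inv h)
    then obtain n where "h \<in> S n" by blast
    then show ?case by (intro exI[of _ "Suc n"]) (simp add: SS step_def)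
  next
    case (m_inv h)
    then obtain n where "h \<in> S n" by blast
    then show ?case by (intro exI[of _ "Suc n"]) (simp add: SS step_def)
  next
    case (eng_add a b)
    then obtain m n where "a \<in> S m" "b \<in> S n" by blast
    then have "a \<in> S (max m n)" "b \<in> S (max m n)" using mono[of m "max m n"] mono[of n "max m n"] by auto
    then show ?case by (intro exI[of _ "Suc (max m n)"]) (force simp: SS step_def)
  next
    case (eng_mult a b)
    then obtain m n where "a \<in> S m" "b \<in> S n" by blast
    then have "a \<in> S (max m n)" "b \<in> S (max m n)" using mono[of m "max m n"] mono[of n "max m n"] by auto
    then show ?case by (intro exI[of _ "Suc (max m n)"]) (force simp: SS step_def)
  qed
  then have "generate_field R H \<subseteq> (\<Union>n. S n)" by blast
  then show ?thesis using count by (meson countable_UN countable_subset countableI_type)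
qed

lemma countable_if_algebraic_over_countable:
  assumes K: "subfield K R" "countable K" and alg: "\<And>x. x \<in> carrier R \<Longrightarrow> (algebraic over K) x"
  shows "countable (carrier R)"
proof -
  define roots_in where "roots_in p = {x\<in>carrier R. eval p x = \<zero>}" for p
  have "carrier (K[X]) \<subseteq> lists K" by (auto simp: univ_poly_carrier[symmetric] polynomial_def in_lists_conv_set)
  then have cp: "countable (carrier (K[X]) - {[]})" using countable_lists[OF K(2)] countable_subset by blast
  have "carrier R \<subseteq> (\<Union>p\<in>carrier (K[X]) - {[]}. roots_in p)"
  proof
    fix x assume x: "x \<in> carrier R"
    obtain p where "p \<in> carrier (K[X])" "p \<noteq> []" "eval p x = \<zero>"
      using algebraicE[OF subfieldE(1)[OF K(1)] x alg[OF x]] .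
    then show "x \<in> (\<Union>p\<in>carrier (K[X]) - {[]}. roots_in p)" using x by (auto simp: roots_in_def)
  qed
  moreover have "countable (roots_in p)" if "p \<in> carrier (K[X]) - {[]}" for p
  proof -
    have "p \<in> carrier (poly_ring R)"
      using that subfieldE(3)[OF K(1)] by (auto simp: univ_poly_carrier[symmetric] polynomial_def)
    then show ?thesis unfolding roots_in_def using finite_card_roots(1) that countable_finite by blast
  qed
  ultimately show ?thesis using cp countable_UN countable_subset by meson
qed

end

text \<open>
  The hypotheses of \<open>exists_additive_if_locally_separated\<close> hold for the group of nonzero elements
  and \<open>C = k - {\<zero>}\<close>. The subgroup \<open>A\<close> for a finite set \<open>Y\<close> is the group of nonzero elements of the
  finite extension \<open>L\<close> of \<open>k(t)\<close> generated by \<open>Y\<close>, and \<open>root_exponent_bound\<close> gives \<open>N\<close>. An element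
  \<open>u\<close> of \<open>L\<close> outside \<open>k\<close> is transcendental over \<open>k\<close>; by the exchange property \<open>t\<close> is algebraic over
  \<open>k(u)\<close>, so that \<open>L\<close> is contained in a finite extension of \<open>k(u)\<close>. The \<open>u\<close>-adic valuation of the
  latter is trivial on \<open>k\<close> and not zero at \<open>u\<close>.
\<close>

lemma (in char2_field) bounded_degree_imp_additive:
  assumes tf: "torsion_free_group (unit_group R)" and count: "countable (carrier R)"
    and k: "subfield k R" "\<And>x. x \<in> carrier R \<Longrightarrow> (algebraic over k) x \<Longrightarrow> x \<in> k"
    and t: "t \<in> carrier R" "t \<notin> k"
    and S: "S \<subseteq> carrier R" "\<And>s. s \<in> S \<Longrightarrow> \<exists>p\<in>carrier ((generate_field R (k \<union> {t}))[X]). p \<noteq> [] \<and> degree p \<le> d \<and> eval p s = \<zero>"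
    and gen: "generate_field R (generate_field R (k \<union> {t}) \<union> S) = carrier R"
  shows "\<exists>f. monoid.additive_on (unit_group R) (carrier (unit_group R)) f \<and> f t \<noteq> 0"
proof -
  interpret M: comm_group "unit_group R" by (rule comm_group_mult_of)
  note [simp] = Multiplicative_Group.nat_pow_mult_of
  note kc = subfieldE(3)[OF k(1)]
  define K where "K = generate_field R (k \<union> {t})"
  have K: "subfield K R" unfolding K_def using kc t by (intro generate_field_is_subfield) auto
  have kK: "k \<subseteq> K" "t \<in> K" unfolding K_def by (auto intro: generate_field.incl)
  have algS: "(algebraic over K) s" if "s \<in> S" for s using S(2)[OF that] algebraicI unfolding K_def by blast
  have alg: "(algebraic over K) z" if "z \<in> carrier R" for z
    using algebraic_if_generated_by_algebraic[OF K S(1) algS] that gen unfolding K_def by simp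
  define C where "C = k - {\<zero>}"
  have sub_units: "subgroup (L - {\<zero>}) (unit_group R)" if L: "subfield L R" for L
  proof (rule M.subgroupI)
    note Ls = subringE[OF subfieldE(1)[OF L]]
    show "L - {\<zero>} \<subseteq> carrier (unit_group R)" using Ls(1) by auto
    show "L - {\<zero>} \<noteq> {}" using Ls(3) by auto
    show "inv\<^bsub>unit_group R\<^esub> a \<in> L - {\<zero>}" if a: "a \<in> L - {\<zero>}" for a
    proof -
      have "a \<in> carrier R" "a \<noteq> \<zero>" using a Ls(1) by auto
      then show ?thesis using inv_unit_group[of a] subfield_m_inv(1)[OF L a] by simp
    qed
    show "a \<otimes>\<^bsub>unit_group R\<^esub> b \<in> L - {\<zero>}" if "a \<in> L - {\<zero>}" "b \<in> L - {\<zero>}" for a b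
      using that Ls(1,6) by (auto simp: integral_iff subset_iff)
  qed
  have genC: "generate (unit_group R) C = C"
    unfolding C_def
    by (rule subset_antisym[OF M.generate_subgroup_incl[OF order_refl sub_units[OF k(1)]]]) (rule subsetI, rule generate.incl)
  define N :: nat where "N = 2 ^ d * (2 ^ fact d - 1)"
  have "N > 0" unfolding N_def using one_less_power[of "2::nat" "fact d"] fact_gt_zero[of d, where ?'a = nat] by simp
  have pure: "u \<in> k" if u: "u \<in> carrier R" "n > 0" "u [^] (n::nat) \<in> k" for u n
    using k(2)[OF u(1) algebraic_if_power_mem[OF subfieldE(1)[OF k(1)] u]] .
  show ?thesis
  proof (rule M.exists_additive_if_locally_separated)
    show "C \<subseteq> carrier (unit_group R)" using kc by (auto simp: C_def)
    show "countable (carrier (unit_group R))" using count by simp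
    show "t \<in> carrier (unit_group R)" using t subringE(2)[OF subfieldE(1)[OF k(1)]] by auto
    show "\<forall>n>0. t [^]\<^bsub>unit_group R\<^esub> (n::nat) \<notin> generate (unit_group R) C"
      using pure[OF t(1)] t(2) unfolding genC by (auto simp: C_def)
  next
    fix Y assume Y: "finite Y" "Y \<subseteq> carrier (unit_group R)"
    obtain xs where xs: "set xs = Y" using finite_list[OF Y(1)] by blast
    have xc: "set xs \<subseteq> carrier R" using xs Y by auto
    have xalg: "\<And>x. x \<in> set xs \<Longrightarrow> (algebraic over K) x" using xc alg by blast
    define L where "L = finite_extension K xs"
    have L: "subfield L R" unfolding L_def by (rule finite_extension_is_subfield[OF K xc xalg])
    have KL: "K \<subseteq> L" unfolding L_def by (rule finite_extension_incl[OF subfieldE(3)[OF K] xc])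
    have YL: "Y \<subseteq> L" unfolding L_def xs[symmetric] by (rule finite_extension_mem[OF subfieldE(1)[OF K] xc])
    note Lc = subfieldE(3)[OF L]
    show "\<exists>N A. N > 0 \<and> subgroup A (unit_group R) \<and> C \<union> Y \<subseteq> A \<and>
      (\<forall>u\<in>carrier (unit_group R). \<forall>n>0. u [^]\<^bsub>unit_group R\<^esub> (n::nat) \<in> A \<longrightarrow> u [^]\<^bsub>unit_group R\<^esub> (N::nat) \<in> A) \<and>
      (\<forall>u\<in>A. (\<forall>n>0. u [^]\<^bsub>unit_group R\<^esub> (n::nat) \<notin> generate (unit_group R) C) \<longrightarrow>
        (\<exists>f. M.additive_on A f \<and> (\<forall>c\<in>C. f c = 0) \<and> f u \<noteq> 0))"
    proof (intro exI[of _ N] exI[of _ "L - {\<zero>}"] conjI ballI allI impI)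
      show "N > 0" by fact
      show "subgroup (L - {\<zero>}) (unit_group R)" by (rule sub_units[OF L])
      show "C \<union> Y \<subseteq> L - {\<zero>}" using kK KL YL Y by (auto simp: C_def)
    next
      fix u and n :: nat assume u: "u \<in> carrier (unit_group R)" "n > 0" "u [^]\<^bsub>unit_group R\<^esub> n \<in> L - {\<zero>}"
      have rel: "\<exists>p\<in>carrier (L[X]). p \<noteq> [] \<and> degree p \<le> d \<and> eval p s = \<zero>" if s: "s \<in> S" for s
      proof -
        obtain p where p: "p \<in> carrier (K[X])" "p \<noteq> []" "degree p \<le> d" "eval p s = \<zero>" using S(2)[OF s] unfolding K_def by blast
        have "p \<in> carrier (L[X])" using p(1) KL by (auto simp: univ_poly_carrier[symmetric] polynomial_def)
        then show ?thesis using p by blast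
      qed
      have LSc: "L \<union> S \<subseteq> carrier R" using Lc S(1) by blast
      have "carrier R \<subseteq> generate_field R (L \<union> S)"
        unfolding gen[symmetric] K_def[symmetric] using KL LSc by (intro mono_generate_field) auto
      then have genL: "generate_field R (L \<union> S) = carrier R" using generate_field_incl[OF LSc] by blast
      have "u [^] N \<in> L" unfolding N_def
        by (rule root_exponent_bound[OF tf L S(1) rel genL]) (use u in auto)
      moreover have "u [^] N \<noteq> \<zero>" using u(1) nat_pow_eq_zeroD by auto
      ultimately show "u [^]\<^bsub>unit_group R\<^esub> N \<in> L - {\<zero>}" by simp
    next
      fix u assume u: "u \<in> L - {\<zero>}" and upow: "\<forall>n>0. u [^]\<^bsub>unit_group R\<^esub> (n::nat) \<notin> generate (unit_group R) C"
      have uc: "u \<in> carrier R" using u Lc by blast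
      have "u [^] (1::nat) \<notin> C" using upow[rule_format, of 1] unfolding genC by simp
      then have "u \<notin> C" unfolding nat_pow_eone[OF uc] .
      then have uk: "u \<notin> k" using u unfolding C_def by blast
      have utr: "(transcendental over k) u" using k(2)[OF uc] uk unfolding over_def by blast
      define K1 where "K1 = generate_field R (k \<union> {u})"
      have K1: "subfield K1 R" unfolding K1_def using kc uc by (intro generate_field_is_subfield) auto
      have kK1: "k \<subseteq> K1" unfolding K1_def by (auto intro: generate_field.incl)
      have talg: "(algebraic over K1) t"
        unfolding K1_def using algebraic_exchange[OF k(1) t(1) uc _ utr] alg[OF uc] unfolding K_def by blast
      define K2 where "K2 = simple_extension K1 t"
      have K2: "subfield K2 R" unfolding K2_def using simple_extension_is_subfield[OF K1 t(1)] talg by simp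
      have K12: "K1 \<subseteq> K2" "t \<in> K2" unfolding K2_def
        using simple_extension_incl[OF subfieldE(3)[OF K1] t(1)] simple_extension_mem[OF subfieldE(1)[OF K1] t(1)] by auto
      have KK2: "K \<subseteq> K2" unfolding K_def
        using K12 kK1 kc t K2 by (intro generate_field_min_subfield1) auto
      have alg1: "(algebraic over K1) z" if z: "z \<in> carrier R" for z
        using algebraic_trans[OF K1 K2 _ K12(1) z algebraic_mono[OF KK2 alg[OF z]]]
          simple_extesion_mem_imp_algebraic[OF K1 t(1) talg] unfolding K2_def by blast
      have txc: "set (xs @ [t]) \<subseteq> carrier R" using xc t by auto
      define M' where "M' = finite_extension K1 (xs @ [t])"
      have alg1': "\<And>x. x \<in> set (xs @ [t]) \<Longrightarrow> (algebraic over K1) x" using txc alg1 by blast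
      have M': "subring M' R" unfolding M'_def by (rule finite_extension_is_subring[OF subfieldE(1)[OF K1] txc])
      have K1M: "K1 \<subseteq> M'" unfolding M'_def by (rule finite_extension_incl[OF subfieldE(3)[OF K1] txc])
      have txM: "set (xs @ [t]) \<subseteq> M'" unfolding M'_def by (rule finite_extension_mem[OF subfieldE(1)[OF K1] txc])
      have fin: "finite_dimension K1 M'" unfolding M'_def by (rule finite_extension_finite_dimension(1)[OF K1 txc alg1'])
      have "subfield M' R" unfolding M'_def by (rule finite_extension_is_subfield[OF K1 txc alg1'])
      then have "K \<subseteq> M'" unfolding K_def using K1M kK1 txM kc t by (intro generate_field_min_subfield1) auto
      then have LM: "L \<subseteq> M'" unfolding L_def using finite_extension_subring_incl[OF M'] txM by auto
      obtain v where v: "M.additive_on (M' - {\<zero>}) v" "v u \<noteq> 0" "\<forall>c\<in>k - {\<zero>}. v c = 0"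
        using exists_additive_valuation[OF k(1) uc utr M'] K1M fin unfolding K1_def by blast
      have "M.additive_on (L - {\<zero>}) v" using v(1) LM unfolding M.additive_on_def by blast
      then show "\<exists>f. M.additive_on (L - {\<zero>}) f \<and> (\<forall>c\<in>C. f c = 0) \<and> f u \<noteq> 0"
        using v unfolding C_def by blast
    qed
  qed
qed

section \<open>Indecomposable multiplicative groups\<close>

theorem theorem4:
  fixes F :: "('a, 'b) ring_scheme" and T :: "'a set"
  assumes "field F"
    and "infinite (carrier F)"
    and "ring_char F = 2"
    and "transcendence_basis F (prime_subfield F) T"
    and "indecomposable_group (Multiplicative_Group.mult_of F)"
  shows "T \<noteq> {}
    \<and> (comm_group (Multiplicative_Group.mult_of F) \<and> torsion_free_group (Multiplicative_Group.mult_of F) \<and> infinite_rank (Multiplicative_Group.mult_of F))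
    \<and> (algebraic_extension F (field_adjoin F (prime_subfield F) T)
        \<and> ring.infinite_dimension F (field_adjoin F (prime_subfield F) T) (carrier F))
    \<and> (finite T \<longrightarrow>
        \<not> generated_in_bounded_degree F (field_adjoin F (prime_subfield F) T))"
proof -
  interpret F: field F by fact
  interpret F: char2_field F
  proof
    have "add_pow F (2::nat) \<one>\<^bsub>F\<^esub> = \<zero>\<^bsub>F\<^esub>"
      using F.add.pow_ord_eq_1[of "\<one>\<^bsub>F\<^esub>"] assms(3) unfolding ring_char_def by (metis F.one_closed)
    then show "\<one>\<^bsub>F\<^esub> \<oplus>\<^bsub>F\<^esub> \<one>\<^bsub>F\<^esub> = \<zero>\<^bsub>F\<^esub>" by (simp add: numeral_2_eq_2)
  qed
  interpret M: comm_group "unit_group F" by (rule F.comm_group_mult_of)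
  let ?P = "prime_subfield F"
  let ?K = "field_adjoin F ?P T"
  have P: "?P = {\<zero>\<^bsub>F\<^esub>, \<one>\<^bsub>F\<^esub>}"
    using F.generate_field_min_subfield1[OF _ F.prime_field, of "{}"] F.zero_in_generate[of "{}"] generate_field.one[of F "{}"]
    unfolding prime_subfield_def by auto
  have Pf: "subfield ?P F" unfolding P by (rule F.prime_field)
  have ind: "algebraically_independent F ?P T" and alg: "algebraic_extension F ?K"
    using assms(4) by (auto simp: transcendence_basis_def)
  have Tc: "T \<subseteq> carrier F" using ind by (simp add: algebraically_independent_def)
  have tf: "torsion_free_group (unit_group F)" by (rule F.torsion_free_unit_group[OF assms(2,5)])
  have "infinite (carrier F - {\<zero>\<^bsub>F\<^esub>, \<one>\<^bsub>F\<^esub>})" using assms(2) by (simp add: Diff_infinite_finite)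
  then obtain a where a: "a \<in> carrier F" "a \<noteq> \<zero>\<^bsub>F\<^esub>" "a \<noteq> \<one>\<^bsub>F\<^esub>" using infinite_imp_nonempty by blast
  have rank: "infinite_rank (unit_group F)" by (rule F.infinite_rank_unit_group[OF tf a])
  have Kx: "(F.algebraic over ?K) x" if "x \<in> carrier F" for x
    using alg that by (simp add: algebraic_extension_def)
  have T0: "T \<noteq> {}"
  proof
    assume "T = {}"
    then have "?K = {\<zero>\<^bsub>F\<^esub>, \<one>\<^bsub>F\<^esub>}"
      using F.generate_field_min_subfield1[OF _ F.prime_field, of "{\<zero>\<^bsub>F\<^esub>, \<one>\<^bsub>F\<^esub>}"] generate_field.incl[of _ "{\<zero>\<^bsub>F\<^esub>, \<one>\<^bsub>F\<^esub>}" F]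
      unfolding field_adjoin_def P by auto
    then have "(F.algebraic over {\<zero>\<^bsub>F\<^esub>, \<one>\<^bsub>F\<^esub>}) a" using Kx[OF a(1)] by simp
    then obtain n where "n > 0" "a [^]\<^bsub>F\<^esub> (n::nat) = \<one>\<^bsub>F\<^esub>"
      using F.algebraic_over_prime_field_imp_torsion[OF a(1,2)] by blast
    then show False using torsion_freeD[OF tf a(1,2)] a(3) by blast
  qed
  then obtain t where t: "t \<in> T" by blast
  have tc: "t \<in> carrier F" using t Tc by blast
  \<comment> \<open>With respect to \<open>k0\<close> the field generated by \<open>T\<close> is a rational function field in the one variable \<open>t\<close>.\<close>
  define k0 where "k0 = generate_field F (?P \<union> (T - {t}))"
  have PTc: "?P \<union> (T - {t}) \<subseteq> carrier F" using subfieldE(3)[OF Pf] Tc by blast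
  have k0: "subfield k0 F" unfolding k0_def by (rule F.generate_field_is_subfield[OF PTc])
  have t0: "(F.transcendental over k0) t"
    unfolding k0_def by (rule F.transcendental_over_remaining_basis[OF Pf ind t])
  have PTk: "?P \<union> (T - {t}) \<subseteq> k0" unfolding k0_def by (auto intro: generate_field.incl)
  have Kc: "?P \<union> T \<subseteq> carrier F" using subfieldE(3)[OF Pf] Tc by blast
  have K: "subfield ?K F" unfolding field_adjoin_def by (rule F.generate_field_is_subfield[OF Kc])
  have Kk: "?K \<subseteq> generate_field F (k \<union> {t})" if k: "subfield k F" "k0 \<subseteq> k" for k
    unfolding field_adjoin_def
  proof (rule F.generate_field_min_subfield1[OF Kc])
    show "subfield (generate_field F (k \<union> {t})) F"
      using subfieldE(3)[OF k(1)] tc by (intro F.generate_field_is_subfield) auto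
    show "?P \<union> T \<subseteq> generate_field F (k \<union> {t})"
      using PTk k(2) by (auto intro!: generate_field.incl)
  qed
  have no_additive: "f z = 0" if "M.additive_on (carrier (unit_group F)) f" "z \<in> carrier (unit_group F)" for f z
    using M.no_additive_on_indecomposable_infinite_rank[OF assms(5) rank that] .
  have tM: "t \<in> carrier (unit_group F)" using tc F.transcendental_inverse_not_mem(1)[OF k0 tc t0] by simp
  have inf: "F.infinite_dimension ?K (carrier F)"
  proof
    assume fin: "F.finite_dimension ?K (carrier F)"
    have eq: "generate_field F (k0 \<union> {t}) = ?K"
    proof
      show "?K \<subseteq> generate_field F (k0 \<union> {t})" by (rule Kk[OF k0 order_refl])
      have "k0 \<subseteq> ?K" unfolding k0_def field_adjoin_def by (rule F.mono_generate_field[OF _ Kc]) auto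
      moreover have "t \<in> ?K" unfolding field_adjoin_def using t by (auto intro: generate_field.incl)
      ultimately show "generate_field F (k0 \<union> {t}) \<subseteq> ?K"
        using subfieldE(3)[OF k0] tc by (intro F.generate_field_min_subfield1[OF _ K]) auto
    qed
    obtain v where "M.additive_on (carrier F - {\<zero>\<^bsub>F\<^esub>}) v" "v t \<noteq> 0"
      using F.exists_additive_valuation[OF k0 tc t0 F.carrier_is_subring] subfieldE(3)[OF K] fin unfolding eq by blast
    then show False using no_additive[of v t] tM by simp
  qed
  have bounded: "\<not> generated_in_bounded_degree F ?K" if finT: "finite T"
  proof
    assume "generated_in_bounded_degree F ?K"
    then obtain S d where S: "S \<subseteq> carrier F" "\<And>x. x \<in> S \<Longrightarrow> (F.algebraic over ?K) x \<and> degree (F.Irr ?K x) \<le> d"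
      "field_adjoin F ?K S = carrier F" unfolding generated_in_bounded_degree_def by blast
    \<comment> \<open>The passage to the relative algebraic closure of \<open>k0\<close> makes the nonzero constants closed under roots.\<close>
    define k where "k = {x\<in>carrier F. (F.algebraic over k0) x}"
    have k: "subfield k F" unfolding k_def by (rule F.subfield_of_algebraics[OF k0])
    have k0k: "k0 \<subseteq> k" using F.algebraic_self[OF subfieldE(1)[OF k0]] subfieldE(3)[OF k0] by (auto simp: k_def)
    have closed: "x \<in> k" if "x \<in> carrier F" "(F.algebraic over k) x" for x
      using F.algebraic_trans[OF k0 k _ k0k that] that(1) by (auto simp: k_def)
    have tk: "t \<notin> k" using t0 by (auto simp: k_def over_def)
    define K' where "K' = generate_field F (k \<union> {t})"
    have K'c: "k \<union> {t} \<subseteq> carrier F" using subfieldE(3)[OF k] tc by blast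
    have K': "subfield K' F" unfolding K'_def by (rule F.generate_field_is_subfield[OF K'c])
    have KK': "?K \<subseteq> K'" unfolding K'_def by (rule Kk[OF k k0k])
    have rel: "\<exists>p\<in>carrier (K'[X]\<^bsub>F\<^esub>). p \<noteq> [] \<and> degree p \<le> d \<and> F.eval p s = \<zero>\<^bsub>F\<^esub>" if s: "s \<in> S" for s
    proof -
      have sc: "s \<in> carrier F" using s S(1) by blast
      note I = F.IrrE[OF K sc conjunct1[OF S(2)[OF s]]]
      have "F.Irr ?K s \<noteq> []" using F.pirreducibleE(1)[OF subfieldE(1)[OF K] I(1,2)] .
      moreover have "F.Irr ?K s \<in> carrier (K'[X]\<^bsub>F\<^esub>)"
        using I(1) KK' by (auto simp: univ_poly_carrier[symmetric] polynomial_def)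
      ultimately show ?thesis using I(4) S(2)[OF s] by blast
    qed
    have K'Sc: "K' \<union> S \<subseteq> carrier F" using subfieldE(3)[OF K'] S(1) by blast
    have "carrier F \<subseteq> generate_field F (K' \<union> S)"
      unfolding S(3)[symmetric] field_adjoin_def[of F ?K] using KK' by (intro F.mono_generate_field[OF _ K'Sc]) auto
    then have gen: "generate_field F (K' \<union> S) = carrier F" using F.generate_field_incl[OF K'Sc] by blast
    have "countable (?P \<union> T)" using finT by (simp add: P countable_finite)
    then have "countable ?K" unfolding field_adjoin_def by (rule F.countable_generate_field[OF _ Kc])
    then have count: "countable (carrier F)" by (rule F.countable_if_algebraic_over_countable[OF K _ Kx])
    obtain f where "M.additive_on (carrier (unit_group F)) f" "f t \<noteq> 0"
      using F.bounded_degree_imp_additive[OF tf count k closed tc tk S(1) rel[unfolded K'_def] gen[unfolded K'_def]] by blast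
    then show False using no_additive tM by blast
  qed
  show ?thesis using T0 M.comm_group_axioms tf rank alg inf bounded by blast
qed

end
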